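(* Let $\mathfrak g$ be a finite-dimensional complex simple Lie algebra, $(i,r),(j,t)\in\tilde\Delta_0$ and $k,l\in\mathbb Z_{\ge1}$. The elements $F_q(\underline{m^{(i)}_{k,r}})$ and $F_q(\underline{m^{(j)}_{l,t}})$ of $\mathfrak K_q(\mathfrak g)$ $q$-commute if (a) $r-d(i,j)\le t\le t+2(l-1)\le r+2(k-1)+d(i,j)$, or (b) $t-d(i,j)\le r\le r+2(k-1)\le t+2(l-1)+d(i,j)$. In particular, for $(j,p)\in\tilde\Delta_0$, $F_q(\underline{m^{(i)}_{k,r}})$ $q$-commutes with $F_q(\underline{X_{j,p}})$ if $r-d(i,j)\le p\le r+2(k-1)+d(i,j)$.
   Context: $\mathfrak g$ is a finite-dimensional simple Lie algebra over $\mathbb C$ with Dynkin index set $I=\{1,\dots,n\}$ and Cartan matrix $(c_{i,j})$, $c_{i,j}=\langle h_i,\alpha_j\rangle$. The integers $d_i\ge1$ satisfy $d_ic_{i,j}=d_jc_{j,i}$ and $\min_i d_i=1$; $D=\mathrm{diag}(d_i)$, $q_i=q^{d_i}$. $d(i,j)$ is the distance of $i,j$ in the Dynkin diagram (a multiple edge counts as one edge). $\tilde\Delta_0=\{(i,p)\in I\times\mathbb Z: p\equiv d(1,i)\bmod 2\}$. Let $\underline C(t)$ be the $I\times I$ matrix with diagonal entries $t+t^{-1}$ and off-diagonal entries $c_{i,j}$, and let $\tilde b_{i,j}(u)$ be the coefficient of $t^u$ in the Laurent expansion at $t=0$ of the $(i,j)$-entry of $D\,\underline C(t)^{-1}$.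 Put $\mathcal N(i,p;j,s)=\tilde b_{i,j}(p-s-1)-\tilde b_{i,j}(s-p-1)-\tilde b_{i,j}(p-s+1)+\tilde b_{i,j}(s-p+1)$. $\mathcal X_q$ is the $\mathbb Z[q^{\pm1/2}]$-algebra (product $*$) generated by $\tilde X_{i,p}^{\pm1}$, $(i,p)\in\tilde\Delta_0$, with $\tilde X_{i,p}*\tilde X_{j,s}=q^{\mathcal N(i,p;j,s)}\tilde X_{j,s}*\tilde X_{i,p}$ and $\tilde X_{i,p}*\tilde X_{i,p}^{-1}=\tilde X_{i,p}^{-1}*\tilde X_{i,p}=1$. Its bar involution is the $\mathbb Z$-algebra anti-involution with $q^{1/2}\mapsto q^{-1/2}$, $\tilde X_{i,p}\mapsto q_i\tilde X_{i,p}$. $\mathcal M$ is the group of commutative Laurent monomials $m=\prod X_{i,p}^{u_{i,p}(m)}$; $m$ is dominant if all $u_{i,p}(m)\ge0$. For $m\in\mathcal M$, $\underline m$ is the unique bar-invariant element of $\mathcal X_q$ of the form $q^r\prod\tilde X_{i,p}^{u_{i,p}(m)}$, $r\in\frac12\mathbb Z$; the $\underline m$ form a $\mathbb Z[q^{\pm1/2}]$-basis of $\mathcal X_q$, and "$m$ occurs in $f$" means $\underline m$ has nonzero coefficient in $f$. For $(i,p+1)\in\tilde\Delta_0$ let $B_{i,p}=X_{i,p-1}X_{i,p+1}\prod_{j:d(i,j)=1}X_{j,p}^{c_{j,i}}$ and $\tilde B_{i,p}=\underline{B_{i,p}}$. $\mathfrak K_{i,q}(\mathfrak g)\subset\mathcal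 X_q$ is the $\mathbb Z[q^{\pm1/2}]$-subalgebra generated by all $\tilde X_{i,l}*(1+q_i^{-1}\tilde B_{i,l+1}^{-1})$, $(i,l)\in\tilde\Delta_0$, and all $\tilde X_{j,s}^{\pm1}$, $j\ne i$; $\mathfrak K_q(\mathfrak g)=\bigcap_{i\in I}\mathfrak K_{i,q}(\mathfrak g)$. For each dominant $m$ there is a unique $F_q(\underline m)\in\mathfrak K_q(\mathfrak g)$ in which $\underline m$ has coefficient $1$ and no other dominant monomial occurs. For $(i,r)\in\tilde\Delta_0$ and $k\ge1$, $m^{(i)}_{k,r}=\prod_{a=0}^{k-1}X_{i,r+2a}$. Elements $f,g\in\mathcal X_q$ $q$-commute if $f*g=q^{c}\,g*f$ for some $c\in\frac12\mathbb Z$. *)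

theory Defs
  imports
    "HOL-Computational_Algebra.Formal_Laurent_Series"
    "HOL-Library.Poly_Mapping"
    "Jordan_Normal_Form.Matrix"
begin

section \<open>Simple Lie algebras and their Cartan matrices\<close>

text \<open>
  The type variable \<^typ>\<open>'g\<close> is the underlying additive group of \<open>\<gg>\<close>.
\<close>

locale simple_lie_algebra = vector_space scale
  for scale :: "complex \<Rightarrow> 'g::ab_group_add \<Rightarrow> 'g" +
  fixes br :: "'g \<Rightarrow> 'g \<Rightarrow> 'g"
  assumes finite_dimensional: "\<exists>B. finite B \<and> span B = UNIV"
    and br_linear_left: "Vector_Spaces.linear scale scale (\<lambda>x. br x y)"
    and br_linear_right: "Vector_Spaces.linear scale scale (\<lambda>y. br x y)"
    and br_alternating: "br x x = 0"
    and jacobi: "br x (br y z) + br y (br z x) + br z (br x y) = 0"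
    and nonabelian: "\<exists>x y. br x y \<noteq> 0"
    and simple: "\<lbrakk>subspace J; \<And>x y. y \<in> J \<Longrightarrow> br x y \<in> J\<rbrakk> \<Longrightarrow> J = {0} \<or> J = UNIV"
begin

text \<open>
  \<open>C\<close>, with index set \<open>I = {1..n}\<close>, is the Cartan matrix of \<open>\<gg>\<close> with respect to
  Chevalley generators \<open>e\<^sub>i, f\<^sub>i\<close> and simple coroots \<open>h\<^sub>i\<close>. The entry
  \<open>c\<^sub>i\<^sub>j = \<langle>h\<^sub>i, \<alpha>\<^sub>j\<rangle>\<close> is the eigenvalue of \<open>ad h\<^sub>i\<close> on the
  simple root space of \<open>\<alpha>\<^sub>j\<close>, which is spanned by \<open>e\<^sub>j\<close>. Linear independence of the
  \<open>h\<^sub>i\<close> cannot be dropped: evaluation modules make \<open>\<gg>\<close> a quotient of affine Lie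
  algebras as well.
\<close>

definition is_cartan_matrix :: "nat \<Rightarrow> (nat \<Rightarrow> nat \<Rightarrow> int) \<Rightarrow> bool" where
  "is_cartan_matrix n C \<longleftrightarrow> (\<exists>e f h :: nat \<Rightarrow> 'g.
     inj_on h {1..n} \<and> independent (h ` {1..n}) \<and>
     (\<forall>i\<in>{1..n}. C i i = 2) \<and>
     (\<forall>i\<in>{1..n}. \<forall>j\<in>{1..n}.
        br (h i) (h j) = 0 \<and>
        br (h i) (e j) = scale (of_int (C i j)) (e j) \<and>
        br (h i) (f j) = scale (- of_int (C i j)) (f j) \<and>
        br (e i) (f j) = (if i = j then h i else 0)) \<and>
     (\<forall>S. subspace S \<and> (\<forall>x\<in>S. \<forall>y\<in>S. br x y \<in> S) \<and> (\<forall>i\<in>{1..n}. e i \<in> S \<and> f i \<in> S)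
        \<longrightarrow> S = UNIV))"

end

definition is_minimal_symmetrizer ::
  "nat \<Rightarrow> (nat \<Rightarrow> nat \<Rightarrow> int) \<Rightarrow> (nat \<Rightarrow> int) \<Rightarrow> bool" where
  "is_minimal_symmetrizer n C d \<longleftrightarrow>
     (\<forall>i\<in>{1..n}. d i \<ge> 1) \<and>
     (\<forall>i\<in>{1..n}. \<forall>j\<in>{1..n}. d i * C i j = d j * C j i) \<and>
     Min (d ` {1..n}) = 1"


section \<open>Dynkin diagram and the commutation exponents\<close>

definition dynkin_edges :: "nat \<Rightarrow> (nat \<Rightarrow> nat \<Rightarrow> int) \<Rightarrow> (nat \<times> nat) set" where
  "dynkin_edges n C = {(i, j). i \<in> {1..n} \<and> j \<in> {1..n} \<and> i \<noteq> j \<and> C i j \<noteq> 0}"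

definition dynkin_dist :: "nat \<Rightarrow> (nat \<Rightarrow> nat \<Rightarrow> int) \<Rightarrow> nat \<Rightarrow> nat \<Rightarrow> nat" where
  "dynkin_dist n C i j = (LEAST k. (i, j) \<in> dynkin_edges n C ^^ k)"

type_synonym vertex = "nat \<times> int"

definition Delta0 :: "nat \<Rightarrow> (nat \<Rightarrow> nat \<Rightarrow> int) \<Rightarrow> vertex set" where
  "Delta0 n C = {(i, p). i \<in> {1..n} \<and> p mod 2 = int (dynkin_dist n C 1 i) mod 2}"

text \<open>
  The matrix \<open>C(t)\<close> over Laurent series in \<open>t\<close>; matrices are indexed from \<open>0\<close>, so the
  \<open>(i, j)\<close>-entry sits at position \<open>(i - 1, j - 1)\<close>. Since \<open>det C(t)\<close> equals
  \<open>t\<^sup>-\<^sup>n\<close> times a power series with integer coefficients and constant term \<open>1\<close>, the inverse,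
  expanded at \<open>t = 0\<close>, already exists over the integral Laurent series.
\<close>

definition Ct_mat :: "nat \<Rightarrow> (nat \<Rightarrow> nat \<Rightarrow> int) \<Rightarrow> int fls mat" where
  "Ct_mat n C = mat n n (\<lambda>(a, b). if a = b then fls_X + fls_X_inv
                                   else of_int (C (Suc a) (Suc b)))"

definition Ct_inv :: "nat \<Rightarrow> (nat \<Rightarrow> nat \<Rightarrow> int) \<Rightarrow> int fls mat" where
  "Ct_inv n C = (THE M. M \<in> carrier_mat n n \<and>
                        inverts_mat (Ct_mat n C) M \<and> inverts_mat M (Ct_mat n C))"

text \<open>
  The value \<open>0\<close> outside \<open>I\<close> makes \<open>Nexp\<close> antisymmetric on all of \<^typ>\<open>nat \<times> int\<close>,
  as the lemmas on quantum tori below require.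
\<close>

definition btilde ::
  "nat \<Rightarrow> (nat \<Rightarrow> nat \<Rightarrow> int) \<Rightarrow> (nat \<Rightarrow> int) \<Rightarrow> nat \<Rightarrow> nat \<Rightarrow> int \<Rightarrow> int" where
  "btilde n C d i j u = (if i \<in> {1..n} \<and> j \<in> {1..n}
     then d i * fls_nth (index_mat (Ct_inv n C) (i - 1, j - 1)) u else 0)"

definition Nexp ::
  "nat \<Rightarrow> (nat \<Rightarrow> nat \<Rightarrow> int) \<Rightarrow> (nat \<Rightarrow> int) \<Rightarrow> vertex \<Rightarrow> vertex \<Rightarrow> int" where
  "Nexp n C d = (\<lambda>(i, p) (j, s).
     btilde n C d i j (p - s - 1) - btilde n C d i j (s - p - 1)
     - btilde n C d i j (p - s + 1) + btilde n C d i j (s - p + 1))"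


section \<open>Quantum tori\<close>

text \<open>
  This section treats the quantum torus of an arbitrary exponent matrix \<open>N\<close>.
  \<open>\<int>[q\<^sup>\<plusminus>\<^sup>1\<^sup>/\<^sup>2]\<close> is the group ring of \<open>\<int>\<close>, with \<open>vpow k\<close> standing for
  \<open>q\<^sup>k\<^sup>/\<^sup>2\<close>; commutative Laurent monomials are written additively as exponent vectors.

  The quantum torus is modelled on its basis of bar-invariant monomials: \<open>single m c\<close> is
  \<open>c\<close> times the bar-invariant monomial attached to \<open>m\<close>, and the product of the bar-invariant
  monomials of \<open>m\<close> and \<open>m'\<close> is \<open>q\<^sup>N\<^sup>(\<^sup>m\<^sup>,\<^sup>m\<^sup>'\<^sup>)\<^sup>/\<^sup>2\<close> times that of
  \<open>m + m'\<close>, with \<open>N\<close> extended bilinearly. The lemmas below show that, for antisymmetric \<open>N\<close>,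
  this is an associative unital algebra generated by invertible elements satisfying
  the defining relations, that \<open>qbar\<close> is the bar involution, and that \<open>single m 1\<close> is
  the bar-invariant multiple of the ordered product of the generators. The commutative
  convolution product that the type class instances provide on this type is not used.
\<close>

type_synonym laurent = "int \<Rightarrow>\<^sub>0 int"
type_synonym monom = "vertex \<Rightarrow>\<^sub>0 int"
type_synonym qtorus = "monom \<Rightarrow>\<^sub>0 laurent"

definition vpow :: "int \<Rightarrow> laurent" where
  "vpow k = Poly_Mapping.single k 1"

definition mform :: "(vertex \<Rightarrow> vertex \<Rightarrow> int) \<Rightarrow> monom \<Rightarrow> monom \<Rightarrow> int" where
  "mform N m m' = (\<Sum>x\<in>Poly_Mapping.keys m. \<Sum>y\<in>Poly_Mapping.keys m'.
                     Poly_Mapping.lookup m x * Poly_Mapping.lookup m' y * N x y)"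

definition qtimes :: "(vertex \<Rightarrow> vertex \<Rightarrow> int) \<Rightarrow> qtorus \<Rightarrow> qtorus \<Rightarrow> qtorus" where
  "qtimes N f g = (\<Sum>m\<in>Poly_Mapping.keys f. \<Sum>m'\<in>Poly_Mapping.keys g.
     Poly_Mapping.single (m + m')
       (vpow (mform N m m') * Poly_Mapping.lookup f m * Poly_Mapping.lookup g m'))"

definition qscalar :: "laurent \<Rightarrow> qtorus" where
  "qscalar c = Poly_Mapping.single 0 c"

text \<open>
  The generators, with \<open>X = q\<^sub>i\<^sup>-\<^sup>1\<^sup>/\<^sup>2\<close> times the bar-invariant monomial, as forced by
  \<open>qbar X = q\<^sub>i X\<close>, and their inverses.
\<close>

definition Xgen :: "(nat \<Rightarrow> int) \<Rightarrow> vertex \<Rightarrow> qtorus" where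
  "Xgen d x = Poly_Mapping.single (Poly_Mapping.single x 1) (vpow (- d (fst x)))"

definition Xinv :: "(nat \<Rightarrow> int) \<Rightarrow> vertex \<Rightarrow> qtorus" where
  "Xinv d x = Poly_Mapping.single (Poly_Mapping.single x (- 1)) (vpow (d (fst x)))"

definition Xpow :: "(vertex \<Rightarrow> vertex \<Rightarrow> int) \<Rightarrow> (nat \<Rightarrow> int) \<Rightarrow> vertex \<Rightarrow> int \<Rightarrow> qtorus" where
  "Xpow N d x u = (if u \<ge> 0 then (qtimes N (Xgen d x) ^^ nat u) (qscalar 1)
                   else (qtimes N (Xinv d x) ^^ nat (- u)) (qscalar 1))"

definition qbar :: "qtorus \<Rightarrow> qtorus" where
  "qbar = Poly_Mapping.map (Poly_Mapping.map_key uminus)"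

definition underline :: "(vertex \<Rightarrow> vertex \<Rightarrow> int) \<Rightarrow> (nat \<Rightarrow> int) \<Rightarrow> monom \<Rightarrow> qtorus" where
  "underline N d m = (THE f. qbar f = f \<and>
     (\<exists>r xs. distinct xs \<and> set xs = Poly_Mapping.keys m \<and>
        f = qtimes N (qscalar (vpow r))
              (foldr (\<lambda>x g. qtimes N (Xpow N d x (Poly_Mapping.lookup m x)) g) xs (qscalar 1))))"

text \<open>The unital subalgebra over \<open>\<int>[q\<^sup>\<plusminus>\<^sup>1\<^sup>/\<^sup>2]\<close> generated by \<open>S\<close>.\<close>

inductive_set qsubalgebra :: "(vertex \<Rightarrow> vertex \<Rightarrow> int) \<Rightarrow> qtorus set \<Rightarrow> qtorus set"
  for N :: "vertex \<Rightarrow> vertex \<Rightarrow> int" and S :: "qtorus set" where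
  scalar: "qscalar c \<in> qsubalgebra N S"
| generator: "f \<in> S \<Longrightarrow> f \<in> qsubalgebra N S"
| add: "\<lbrakk>f \<in> qsubalgebra N S; g \<in> qsubalgebra N S\<rbrakk> \<Longrightarrow> f + g \<in> qsubalgebra N S"
| times: "\<lbrakk>f \<in> qsubalgebra N S; g \<in> qsubalgebra N S\<rbrakk> \<Longrightarrow> qtimes N f g \<in> qsubalgebra N S"

definition q_commute :: "(vertex \<Rightarrow> vertex \<Rightarrow> int) \<Rightarrow> qtorus \<Rightarrow> qtorus \<Rightarrow> bool" where
  "q_commute N f g \<longleftrightarrow> (\<exists>k. qtimes N f g = qtimes N (qscalar (vpow k)) (qtimes N g f))"


subsection \<open>Validation of the model\<close>

lemma vpow_add: "vpow (a + b) = vpow a * vpow b"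
  by (simp add: vpow_def mult_single)

lemma vpow_0 [simp]: "vpow 0 = 1"
  by (simp add: vpow_def)

lemma vpow_inject: "vpow a = vpow b \<longleftrightarrow> a = b"
  by (metis lookup_single_eq lookup_single_not_eq vpow_def zero_neq_one)

lemma mform_superset:
  assumes "finite A" "finite B" "Poly_Mapping.keys m \<subseteq> A" "Poly_Mapping.keys m' \<subseteq> B"
  shows "mform N m m' = (\<Sum>x\<in>A. \<Sum>y\<in>B. Poly_Mapping.lookup m x * Poly_Mapping.lookup m' y * N x y)"
proof -
  have "mform N m m' = (\<Sum>x\<in>Poly_Mapping.keys m. \<Sum>y\<in>B.
          Poly_Mapping.lookup m x * Poly_Mapping.lookup m' y * N x y)"
    unfolding mform_def using assms
    by (intro sum.cong refl sum.mono_neutral_left) (auto simp: in_keys_iff)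
  also have "\<dots> = (\<Sum>x\<in>A. \<Sum>y\<in>B. Poly_Mapping.lookup m x * Poly_Mapping.lookup m' y * N x y)"
    using assms by (intro sum.mono_neutral_left) (auto simp: in_keys_iff)
  finally show ?thesis .
qed

lemma mform_add_left: "mform N (m1 + m2) m' = mform N m1 m' + mform N m2 m'"
proof -
  let ?A = "Poly_Mapping.keys m1 \<union> Poly_Mapping.keys m2"
  have "Poly_Mapping.keys (m1 + m2) \<subseteq> ?A" by (rule Poly_Mapping.keys_add)
  then show ?thesis
    by (simp add: mform_superset[of ?A "Poly_Mapping.keys m'"] lookup_add distrib_right
        sum.distrib)
qed

lemma mform_add_right: "mform N m' (m1 + m2) = mform N m' m1 + mform N m' m2"
proof -
  let ?A = "Poly_Mapping.keys m1 \<union> Poly_Mapping.keys m2"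
  have "Poly_Mapping.keys (m1 + m2) \<subseteq> ?A" by (rule Poly_Mapping.keys_add)
  then show ?thesis
    by (simp add: mform_superset[of "Poly_Mapping.keys m'" ?A] lookup_add distrib_right
        distrib_left sum.distrib)
qed

lemma mform_0 [simp]: "mform N 0 m = 0" "mform N m 0 = 0"
  by (simp_all add: mform_def)

lemma mform_single:
  "mform N (Poly_Mapping.single x a) (Poly_Mapping.single y b) = a * b * N x y"
  by (simp add: mform_superset[of "{x}" "{y}"])

lemma mform_antisym:
  assumes "\<And>x y. N x y = - N y x"
  shows "mform N m m' = - mform N m' m"
proof -
  have "mform N m m' = (\<Sum>y\<in>Poly_Mapping.keys m'. \<Sum>x\<in>Poly_Mapping.keys m.
                     Poly_Mapping.lookup m x * Poly_Mapping.lookup m' y * N x y)"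
    unfolding mform_def by (rule sum.swap)
  also have "\<dots> = (\<Sum>y\<in>Poly_Mapping.keys m'. \<Sum>x\<in>Poly_Mapping.keys m.
                     - (Poly_Mapping.lookup m' y * Poly_Mapping.lookup m x * N y x))"
    by (intro sum.cong refl) (subst assms, simp)
  finally show ?thesis by (simp add: mform_def sum_negf)
qed

lemma qtimes_superset:
  assumes "finite A" "finite B" "Poly_Mapping.keys f \<subseteq> A" "Poly_Mapping.keys g \<subseteq> B"
  shows "qtimes N f g = (\<Sum>m\<in>A. \<Sum>m'\<in>B. Poly_Mapping.single (m + m')
           (vpow (mform N m m') * Poly_Mapping.lookup f m * Poly_Mapping.lookup g m'))"
proof -
  have "qtimes N f g = (\<Sum>m\<in>Poly_Mapping.keys f. \<Sum>m'\<in>B. Poly_Mapping.single (m + m')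
           (vpow (mform N m m') * Poly_Mapping.lookup f m * Poly_Mapping.lookup g m'))"
    unfolding qtimes_def using assms
    by (intro sum.cong refl sum.mono_neutral_left) (auto simp: in_keys_iff)
  also have "\<dots> = (\<Sum>m\<in>A. \<Sum>m'\<in>B. Poly_Mapping.single (m + m')
           (vpow (mform N m m') * Poly_Mapping.lookup f m * Poly_Mapping.lookup g m'))"
    using assms by (intro sum.mono_neutral_left) (auto simp: in_keys_iff)
  finally show ?thesis .
qed

lemma qtimes_add_left: "qtimes N (f1 + f2) g = qtimes N f1 g + qtimes N f2 g"
proof -
  let ?A = "Poly_Mapping.keys f1 \<union> Poly_Mapping.keys f2"
  have "Poly_Mapping.keys (f1 + f2) \<subseteq> ?A" by (rule Poly_Mapping.keys_add)
  then show ?thesis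
    by (simp add: qtimes_superset[of ?A "Poly_Mapping.keys g"] lookup_add distrib_right
        distrib_left sum.distrib single_add)
qed

lemma qtimes_add_right: "qtimes N g (f1 + f2) = qtimes N g f1 + qtimes N g f2"
proof -
  let ?A = "Poly_Mapping.keys f1 \<union> Poly_Mapping.keys f2"
  have "Poly_Mapping.keys (f1 + f2) \<subseteq> ?A" by (rule Poly_Mapping.keys_add)
  then show ?thesis
    by (simp add: qtimes_superset[of "Poly_Mapping.keys g" ?A] lookup_add distrib_right
        distrib_left sum.distrib single_add)
qed

lemma qtimes_0 [simp]: "qtimes N 0 g = 0" "qtimes N g 0 = 0"
  by (simp_all add: qtimes_def)

lemma qtimes_single:
  "qtimes N (Poly_Mapping.single m a) (Poly_Mapping.single m' b) =
     Poly_Mapping.single (m + m') (vpow (mform N m m') * a * b)"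
  by (simp add: qtimes_superset[of "{m}" "{m'}"])

lemma sum_single_lookup:
  fixes f :: "'a \<Rightarrow>\<^sub>0 'b::comm_monoid_add"
  shows "(\<Sum>m\<in>Poly_Mapping.keys f. Poly_Mapping.single m (Poly_Mapping.lookup f m)) = f"
proof (rule poly_mapping_eqI)
  fix x
  have "Poly_Mapping.lookup (\<Sum>m\<in>Poly_Mapping.keys f.
          Poly_Mapping.single m (Poly_Mapping.lookup f m)) x =
        (\<Sum>m\<in>Poly_Mapping.keys f. if m = x then Poly_Mapping.lookup f m else 0)"
    by (simp add: lookup_sum lookup_single when_def)
  then show "Poly_Mapping.lookup (\<Sum>m\<in>Poly_Mapping.keys f.
          Poly_Mapping.single m (Poly_Mapping.lookup f m)) x = Poly_Mapping.lookup f x"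
    by (simp add: in_keys_iff)
qed

lemma poly_mapping_additive_induct:
  fixes f :: "'a \<Rightarrow>\<^sub>0 'b::comm_monoid_add"
  assumes "\<And>m c. P (Poly_Mapping.single m c)" "\<And>f g. P f \<Longrightarrow> P g \<Longrightarrow> P (f + g)"
  shows "P f"
proof -
  have "P (\<Sum>m\<in>A. Poly_Mapping.single m (Poly_Mapping.lookup f m))" if "finite A" for A
    using that
  proof induction
    case empty
    show ?case using assms(1)[of undefined 0] by simp
  qed (simp add: assms)
  from this[of "Poly_Mapping.keys f"]
  show ?thesis by (simp add: sum_single_lookup)
qed

lemma qtimes_assoc: "qtimes N (qtimes N f g) h = qtimes N f (qtimes N g h)"
proof (induction f rule: poly_mapping_additive_induct)
  case (1 m a)
  show ?case
  proof (induction g rule: poly_mapping_additive_induct)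
    case (1 m' b)
    show ?case
      by (induction h rule: poly_mapping_additive_induct)
        (simp_all add: qtimes_single qtimes_add_right mform_add_left mform_add_right
          vpow_add ac_simps)
  qed (simp add: qtimes_add_left qtimes_add_right)
qed (simp add: qtimes_add_left)

lemma qscalar_single:
  "qtimes N (qscalar c) (Poly_Mapping.single m a) = Poly_Mapping.single m (c * a)"
  "qtimes N (Poly_Mapping.single m a) (qscalar c) = Poly_Mapping.single m (c * a)"
  by (simp_all add: qscalar_def qtimes_single mult.commute)

lemma qscalar_central: "qtimes N (qscalar c) f = qtimes N f (qscalar c)"
  by (induction f rule: poly_mapping_additive_induct)
    (simp_all add: qscalar_single qtimes_add_left qtimes_add_right)

lemma qscalar_one: "qtimes N (qscalar 1) f = f"
  by (induction f rule: poly_mapping_additive_induct)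
    (simp_all add: qscalar_single qtimes_add_right)

lemma Xgen_commutation:
  assumes "\<And>x y. N x y = - N y x"
  shows "qtimes N (Xgen d x) (Xgen d y) =
         qtimes N (qscalar (vpow (2 * N x y))) (qtimes N (Xgen d y) (Xgen d x))"
proof -
  have "N x y = 2 * N x y + N y x" using assms[of x y] by simp
  then have *: "vpow (N x y) = vpow (2 * N x y) * vpow (N y x)" by (metis vpow_add)
  show ?thesis
    by (simp add: Xgen_def qtimes_single qscalar_single mform_single * ac_simps)
qed

lemma Xgen_Xinv:
  assumes "\<And>x y. N x y = - N y x"
  shows "qtimes N (Xgen d x) (Xinv d x) = qscalar 1" "qtimes N (Xinv d x) (Xgen d x) = qscalar 1"
proof -
  have "N x x = 0" using assms[of x x] by simp
  then show "qtimes N (Xgen d x) (Xinv d x) = qscalar 1"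
    "qtimes N (Xinv d x) (Xgen d x) = qscalar 1"
    by (simp_all add: Xgen_def Xinv_def qscalar_def qtimes_single mform_single
        flip: vpow_add single_add)
qed

lemma lookup_map_key_uminus:
  "Poly_Mapping.lookup (Poly_Mapping.map_key uminus c) k = Poly_Mapping.lookup c (- k :: int)"
  by (simp add: map_key.rep_eq)

lemma lbar_0 [simp]: "Poly_Mapping.map_key uminus (0 :: laurent) = 0"
  by (rule poly_mapping_eqI) (simp add: lookup_map_key_uminus)

lemma lbar_add:
  "Poly_Mapping.map_key uminus (a + b :: laurent) =
     Poly_Mapping.map_key uminus a + Poly_Mapping.map_key uminus b"
  by (rule poly_mapping_eqI) (simp add: lookup_map_key_uminus lookup_add)

lemma lbar_single:
  "Poly_Mapping.map_key uminus (Poly_Mapping.single k c :: laurent) = Poly_Mapping.single (- k) c"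
  by (rule poly_mapping_eqI) (auto simp: lookup_map_key_uminus lookup_single when_def)

lemma lbar_vpow: "Poly_Mapping.map_key uminus (vpow k) = vpow (- k)"
  by (simp add: vpow_def lbar_single)

lemma lbar_mult:
  "Poly_Mapping.map_key uminus (a * b :: laurent) =
     Poly_Mapping.map_key uminus a * Poly_Mapping.map_key uminus b"
proof (induction a rule: poly_mapping_additive_induct)
  case (1 k c)
  show ?case
    by (induction b rule: poly_mapping_additive_induct)
      (simp_all add: mult_single lbar_single distrib_left lbar_add)
qed (simp add: distrib_right lbar_add)

lemma lookup_qbar:
  "Poly_Mapping.lookup (qbar f) m = Poly_Mapping.map_key uminus (Poly_Mapping.lookup f m)"
  by (simp add: qbar_def map.rep_eq when_def)

lemma qbar_single: "qbar (Poly_Mapping.single m c) =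
    Poly_Mapping.single m (Poly_Mapping.map_key uminus c)"
  by (rule poly_mapping_eqI) (simp add: lookup_qbar lookup_single when_def)

lemma qbar_add: "qbar (f + g) = qbar f + qbar g"
  by (rule poly_mapping_eqI) (simp add: lookup_qbar lookup_add lbar_add)

lemma qbar_qbar: "qbar (qbar f) = f"
  by (rule poly_mapping_eqI, rule poly_mapping_eqI) (simp add: lookup_qbar lookup_map_key_uminus)

lemma qbar_qtimes:
  assumes "\<And>x y. N x y = - N y x"
  shows "qbar (qtimes N f g) = qtimes N (qbar g) (qbar f)"
proof (induction f rule: poly_mapping_additive_induct)
  case (1 m a)
  show ?case
  proof (induction g rule: poly_mapping_additive_induct)
    case (1 m' b)
    have "mform N m' m = - mform N m m'" by (rule mform_antisym) (rule assms)
    then show ?case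
      by (simp add: qtimes_single qbar_single lbar_mult lbar_vpow ac_simps)
  qed (simp add: qtimes_add_left qtimes_add_right qbar_add)
qed (simp add: qtimes_add_left qtimes_add_right qbar_add)

lemma qbar_vpow: "qbar (qscalar (vpow k)) = qscalar (vpow (- k))"
  by (simp add: qscalar_def qbar_single lbar_vpow)

lemma qbar_Xgen: "qbar (Xgen d x) = qtimes N (qscalar (vpow (2 * d (fst x)))) (Xgen d x)"
  by (simp add: Xgen_def qbar_single lbar_vpow qscalar_single flip: vpow_add)

lemma Xpow_eq:
  assumes "\<And>x y. N x y = - N y x"
  shows "Xpow N d x u = Poly_Mapping.single (Poly_Mapping.single x u) (vpow (- u * d (fst x)))"
proof -
  have N0: "N x x = 0" using assms[of x x] by simp
  have pos: "(qtimes N (Xgen d x) ^^ k) (qscalar 1) =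
      Poly_Mapping.single (Poly_Mapping.single x (int k)) (vpow (- int k * d (fst x)))" for k
    by (induction k) (simp_all add: qscalar_def Xgen_def qtimes_single mform_single N0
        algebra_simps flip: vpow_add single_add)
  have neg: "(qtimes N (Xinv d x) ^^ k) (qscalar 1) =
      Poly_Mapping.single (Poly_Mapping.single x (- int k)) (vpow (int k * d (fst x)))" for k
    by (induction k) (simp_all add: qscalar_def Xinv_def qtimes_single mform_single N0
        algebra_simps flip: vpow_add single_add)
  show ?thesis
    by (cases "u \<ge> 0") (simp_all add: Xpow_def pos neg)
qed

lemma underline_eq_single:
  assumes "\<And>x y. N x y = - N y x"
  shows "underline N d m = Poly_Mapping.single m 1"
proof -
  let ?P = "\<lambda>xs. foldr (\<lambda>x g. qtimes N (Xpow N d x (Poly_Mapping.lookup m x)) g) xs (qscalar 1)"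
  have ex: "\<exists>k. ?P xs = Poly_Mapping.single
      (\<Sum>x\<leftarrow>xs. Poly_Mapping.single x (Poly_Mapping.lookup m x)) (vpow k)" for xs
  proof (induction xs)
    case Nil
    show ?case by (intro exI[of _ 0]) (simp add: qscalar_def)
  next
    case (Cons x xs)
    then show ?case
      by (auto simp: Xpow_eq[OF assms] qtimes_single simp flip: vpow_add)
  qed
  have prod: "\<exists>k. ?P xs = Poly_Mapping.single m (vpow k)"
    if "distinct xs" "set xs = Poly_Mapping.keys m" for xs
    using ex[of xs] that
    by (simp add: sum_list_distinct_conv_sum_set sum_single_lookup)
  obtain xs where xs: "distinct xs" "set xs = Poly_Mapping.keys m"
    using finite_distinct_list[OF finite_keys] by metis
  from prod[OF xs] obtain k where k: "?P xs = Poly_Mapping.single m (vpow k)" by blast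
  show ?thesis unfolding underline_def
  proof (rule the_equality, goal_cases)
    case 1
    have eq: "Poly_Mapping.single m 1 = qtimes N (qscalar (vpow (- k))) (?P xs)"
      by (simp add: k qscalar_single flip: vpow_add)
    have "qbar (Poly_Mapping.single m 1) = Poly_Mapping.single m 1"
      using lbar_vpow[of 0] by (simp add: qbar_single)
    then show ?case
      by (intro conjI exI[of _ "- k"] exI[of _ xs]) (assumption | rule xs eq)+
  next
    case (2 f)
    then obtain r ys where "distinct ys" "set ys = Poly_Mapping.keys m"
      "f = qtimes N (qscalar (vpow r)) (?P ys)" by blast
    moreover from this prod[of ys] obtain j' where "?P ys = Poly_Mapping.single m (vpow j')"
      by blast
    ultimately obtain j where f: "f = Poly_Mapping.single m (vpow j)"
      by (simp add: qscalar_single flip: vpow_add)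
    from 2 have "qbar f = f" by (rule conjunct1)
    then have "vpow (- j) = vpow j"
      unfolding f qbar_single lbar_vpow by (metis lookup_single_eq)
    then have "j = 0" by (simp add: vpow_inject)
    then show ?case by (simp add: f)
  qed
qed

lemma underline_expansion:
  assumes "\<And>x y. N x y = - N y x"
  shows "f = (\<Sum>m\<in>Poly_Mapping.keys f.
               qtimes N (qscalar (Poly_Mapping.lookup f m)) (underline N d m))"
  by (simp add: underline_eq_single[OF assms] qscalar_single sum_single_lookup)

lemma underline_inverse:
  assumes "\<And>x y. N x y = - N y x"
  shows "qtimes N (underline N d m) (underline N d (- m)) = qscalar 1"
proof -
  have "mform N m m + mform N m (- m) = 0"
    using mform_add_right[of N m m "- m"] by simp
  moreover have "mform N m m = 0" using mform_antisym[where m = m and m' = m, OF assms] by simp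
  ultimately show ?thesis
    by (simp add: underline_eq_single[OF assms] qtimes_single qscalar_def)
qed


section \<open>The quantum virtual Grothendieck ring\<close>

text \<open>
  The coefficient of the bar-invariant monomial of \<open>m\<close> in \<open>f\<close> is \<open>lookup f m\<close>, by
  \<open>underline_expansion\<close>. The monomials on which elements of \<open>Kiq\<close> are supported
  automatically involve only vertices of \<open>Delta0\<close>.
\<close>

definition dominant :: "nat \<Rightarrow> (nat \<Rightarrow> nat \<Rightarrow> int) \<Rightarrow> monom \<Rightarrow> bool" where
  "dominant n C m \<longleftrightarrow> Poly_Mapping.keys m \<subseteq> Delta0 n C \<and> (\<forall>x. Poly_Mapping.lookup m x \<ge> 0)"

definition Bmonom :: "nat \<Rightarrow> (nat \<Rightarrow> nat \<Rightarrow> int) \<Rightarrow> nat \<Rightarrow> int \<Rightarrow> monom" where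
  "Bmonom n C i p =
     Poly_Mapping.single (i, p - 1) 1 + Poly_Mapping.single (i, p + 1) 1 +
     (\<Sum>j\<in>{j\<in>{1..n}. dynkin_dist n C i j = 1}. Poly_Mapping.single (j, p) (C j i))"

text \<open>
  The inverse of the bar-invariant monomial of \<open>m\<close> is that of \<open>- m\<close>.
\<close>

definition Kiq_gens ::
  "nat \<Rightarrow> (nat \<Rightarrow> nat \<Rightarrow> int) \<Rightarrow> (nat \<Rightarrow> int) \<Rightarrow> nat \<Rightarrow> qtorus set" where
  "Kiq_gens n C d i =
     {qtimes (Nexp n C d) (Xgen d (i, l))
        (qscalar 1 + qtimes (Nexp n C d) (qscalar (vpow (- 2 * d i)))
                       (underline (Nexp n C d) d (- Bmonom n C i (l + 1)))) | l. (i, l) \<in> Delta0 n C}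
     \<union> {Xgen d (j, s) | j s. (j, s) \<in> Delta0 n C \<and> j \<noteq> i}
     \<union> {Xinv d (j, s) | j s. (j, s) \<in> Delta0 n C \<and> j \<noteq> i}"

definition Kiq ::
  "nat \<Rightarrow> (nat \<Rightarrow> nat \<Rightarrow> int) \<Rightarrow> (nat \<Rightarrow> int) \<Rightarrow> nat \<Rightarrow> qtorus set" where
  "Kiq n C d i = qsubalgebra (Nexp n C d) (Kiq_gens n C d i)"

definition Kq :: "nat \<Rightarrow> (nat \<Rightarrow> nat \<Rightarrow> int) \<Rightarrow> (nat \<Rightarrow> int) \<Rightarrow> qtorus set" where
  "Kq n C d = (\<Inter>i\<in>{1..n}. Kiq n C d i)"

text \<open>\<open>Fq n C d m\<close> is \<open>F\<^sub>q\<close> of the bar-invariant monomial of the dominant monomial \<open>m\<close>.\<close>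

definition Fq :: "nat \<Rightarrow> (nat \<Rightarrow> nat \<Rightarrow> int) \<Rightarrow> (nat \<Rightarrow> int) \<Rightarrow> monom \<Rightarrow> qtorus" where
  "Fq n C d m = (THE F. F \<in> Kq n C d \<and> Poly_Mapping.lookup F m = 1 \<and>
     (\<forall>m'. dominant n C m' \<and> m' \<noteq> m \<longrightarrow> Poly_Mapping.lookup F m' = 0))"

definition KR_monom :: "nat \<Rightarrow> nat \<Rightarrow> int \<Rightarrow> monom" where
  "KR_monom i k r = (\<Sum>a<k. Poly_Mapping.single (i, r + 2 * int a) 1)"

end

theory Submission
  imports Defs
begin

text \<open>A dominant monomial of \<open>F\<^sub>q(m\<^sub>1) * F\<^sub>q(m\<^sub>2)\<close> is a product of monomials
  \<open>m\<^sub>1 \<Prod>B\<^sup>-\<^sup>1\<close> and \<open>m\<^sub>2 \<Prod>B\<^sup>-\<^sup>1\<close>. For Kirillov--Reshetikhin monomials every nontrivial such monomial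
  divides out the last \<open>B\<close> of its string, and looking at the rightmost column of the divided-out \<open>B\<close>'s
  the interlacing condition forces the first factor to be \<open>m\<^sub>1\<close> and the divided-out \<open>B\<close>'s of the
  second one to \<open>q\<close>-commute trivially with \<open>m\<^sub>1\<close>. Hence all contributions to dominant monomials get the
  same power of \<open>q\<close> when the factors are exchanged, and an element of \<open>\<K>\<^sub>q\<close> without dominant monomials
  is zero.

  The existence of \<open>F\<^sub>q(m)\<close> rests on rank two: every \<open>{i, j}\<close>-dominant monomial leads an element of
  \<open>\<K>\<^sub>i \<inter> \<K>\<^sub>j\<close>. A quadratic form that does not increase along expansion steps bounds the heights of the
  monomials, so the algorithm stops. The Cartan matrix enters only through its
  positive definiteness, which comes from the trace form of the adjoint representation.\<close>

section \<open>Chevalley generators and the trace form\<close>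

context simple_lie_algebra
begin

text \<open>\<open>Fq\<close> is a definite description, so nothing can be said about it before
  existence and uniqueness are proved. Both rest on an explicit basis of each \<open>Ki i\<close>,
  obtained by straightening words in its generators. The obstacle to existence is that a monomial
  may fail to be dominant for two colours at once, and each of them prescribes its coefficient; an
  extension lying in both \<open>Ki i\<close> and \<open>Ki j\<close> forces the two values to
  agree. The quadratic form is the squared length of the classical weight of a monomial. A step of
  colour \<open>i\<close> divides out at most as many \<open>B\<close>'s as the exponent of colour
  \<open>i\<close> permits, so the weight moves inside its \<open>i\<close>-string and gets no
  longer; completing the square with \<open>rho\<close> then bounds the height from below. In the
  product argument the two inequalities of case (a) do separate jobs: the upper one excludes
  \<open>B\<close>'s from the first factor, the lower one keeps the \<open>B\<close>'s of the second
  factor away from the left end of the first string, where the pairing would be nonzero. Case (b) is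
  case (a) with the factors exchanged.\<close>

lemma br_add_left: "br (x + y) z = br x z + br y z"
  using br_linear_left unfolding Vector_Spaces.linear_iff by blast

lemma br_add_right: "br x (y + z) = br x y + br x z"
  using br_linear_right unfolding Vector_Spaces.linear_iff by blast

lemma br_scale_left: "br (scale c x) y = scale c (br x y)"
  using br_linear_left unfolding Vector_Spaces.linear_iff by blast

lemma br_scale_right: "br x (scale c y) = scale c (br x y)"
  using br_linear_right unfolding Vector_Spaces.linear_iff by blast

lemma br_zero_left [simp]: "br 0 y = 0" and br_zero_right [simp]: "br x 0 = 0"
  using br_scale_left[of 0 0 y] br_scale_right[of x 0 0] by simp_all

lemma br_skew: "br x y = - br y x"
proof -
  have "0 = br (x + y) (x + y)" by (simp only: br_alternating)
  also have "\<dots> = br x y + br y x" unfolding br_add_left br_add_right by (simp add: br_alternating)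
  finally show ?thesis by (metis eq_neg_iff_add_eq_0)
qed

lemma br_minus_right: "br x (- y) = - br x y"
  using br_scale_right[of x "-1" y] by simp

lemma br_minus_left: "br (- x) y = - br x y"
  using br_scale_left[of "-1" x y] by simp

lemma br_derivation: "br x (br y z) = br (br x y) z + br y (br x z)"
proof -
  have "br x (br y z) = - br y (br z x) - br z (br x y)"
    using jacobi[of x y z] by (simp add: algebra_simps eq_neg_iff_add_eq_0)
  then show ?thesis
    using br_skew[of z "br x y"] br_skew[of z x] by (simp add: br_minus_right)
qed

lemma br_sum_left: "br (\<Sum>i\<in>A. g i) y = (\<Sum>i\<in>A. br (g i) y)"
  by (induction A rule: infinite_finite_induct) (auto simp: br_add_left)

lemma br_sum_right: "br y (\<Sum>i\<in>A. g i) = (\<Sum>i\<in>A. br y (g i))"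
  by (induction A rule: infinite_finite_induct) (auto simp: br_add_right)

text \<open>The centre is an ideal, and \<open>nonabelian\<close> keeps it from being the whole
  algebra, so simplicity leaves only zero.\<close>

lemma center_trivial:
  assumes "\<And>y. br x y = 0"
  shows "x = 0"
proof -
  let ?J = "{x. \<forall>y. br x y = 0}"
  have "subspace ?J"
    by (rule subspaceI) (auto simp: br_add_left br_scale_left)
  moreover have "br x y \<in> ?J" if "y \<in> ?J" for x y
  proof -
    have "br x y = 0" using that br_skew[of x y] by simp
    then show ?thesis by simp
  qed
  ultimately have "?J = {0} \<or> ?J = UNIV" by (rule simple)
  moreover have "?J \<noteq> UNIV" using nonabelian by auto
  ultimately show ?thesis using assms by auto
qed

section \<open>Strings for sl_2 in finite dimension\<close>

lemma finite_independent: "independent S \<Longrightarrow> finite S"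
  using finite_dimensional independent_span_bound by (metis subset_UNIV)

text \<open>Eigenvalues separate: applying \<open>br H\<close> to an expression of
  \<open>x k\<close> through its predecessors and subtracting \<open>lam k\<close> times that
  expression leaves a relation among the predecessors. Against finite dimension this is how strings
  are shown to terminate.\<close>

lemma independent_eigenvectors:
  assumes eig: "\<And>k::nat. br H (x k) = scale (lam k) (x k)"
    and inj: "inj lam" and nz: "\<And>k. x k \<noteq> 0"
  shows "inj x \<and> independent (range x)"
proof
  show "inj x"
  proof (rule injI)
    fix j k assume eq: "x j = x k"
    then have "scale (lam j) (x j) = scale (lam k) (x j)" using eig[of j] eig[of k] by metis
    then have "lam j = lam k" using nz[of j] scale_right_imp_eq by blast
    then show "j = k" using inj by (simp add: inj_def)
  qed
  then have injx: "inj_on x A" for A by (meson inj_on_subset subset_UNIV)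
  have "independent (x ` {..<k})" for k
  proof (induction k)
    case 0
    then show ?case by (simp add: independent_empty)
  next
    case (Suc k)
    have "x k \<notin> span (x ` {..<k})"
    proof
      assume "x k \<in> span (x ` {..<k})"
      then obtain u where "x k = (\<Sum>v\<in>x ` {..<k}. scale (u v) v)"
        by (auto simp: span_finite)
      then have u: "x k = (\<Sum>j<k. scale (u (x j)) (x j))"
        by (simp add: sum.reindex[OF injx])
      have "br H (x k) = (\<Sum>j<k. scale (u (x j)) (br H (x j)))"
        by (subst u) (simp add: br_sum_right br_scale_right)
      moreover have "br H (x k) = (\<Sum>j<k. scale (lam k) (scale (u (x j)) (x j)))"
        unfolding eig by (subst u) (rule scale_sum_right)
      ultimately have "(\<Sum>j<k. scale (lam k) (scale (u (x j)) (x j))) =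
          (\<Sum>j<k. scale (u (x j)) (scale (lam j) (x j)))"
        by (simp add: eig)
      then have "(\<Sum>j<k. scale (u (x j) * (lam k - lam j)) (x j)) = 0"
        by (simp add: algebra_simps sum_subtractf)
      then have "(\<Sum>v\<in>x ` {..<k}. scale (u v * (lam k - lam (inv_into UNIV x v))) v) = 0"
        by (simp add: sum.reindex[OF injx] inv_f_f[OF \<open>inj x\<close>])
      then have z: "u v * (lam k - lam (inv_into UNIV x v)) = 0" if "v \<in> x ` {..<k}" for v
        using independentD[OF Suc.IH _ subset_refl, where u = "\<lambda>v. u v * (lam k - lam (inv_into UNIV x v))"]
          that by simp
      have "u (x j) = 0" if "j < k" for j
      proof -
        have "lam k \<noteq> lam j" using inj that by (auto simp: inj_def)
        then show ?thesis using z[of "x j"] that by (simp add: inv_f_f[OF \<open>inj x\<close>])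
      qed
      then have "x k = 0" using u by simp
      then show False using nz by simp
    qed
    then show ?case using Suc.IH by (simp add: lessThan_Suc independent_insertI)
  qed
  note ind = this
  show "independent (range x)"
  proof (rule ccontr)
    assume "\<not> independent (range x)"
    then obtain t u v where t: "finite t" "t \<subseteq> range x" "(\<Sum>v\<in>t. scale (u v) v) = 0" "v \<in> t" "u v \<noteq> 0"
      unfolding dependent_explicit by blast
    obtain J where J: "finite J" "t = x ` J" using t(1,2) finite_subset_image by metis
    obtain k where "J \<subseteq> {..<k}" using finite_nat_iff_bounded J(1) by blast
    then have "t \<subseteq> x ` {..<k}" using J by auto
    then show False using independentD[OF ind[of k] t(1) _ t(3,4)] t(5) by simp
  qed
qed

text \<open>Here \<open>v\<close> is a lowest weight vector. The vectors \<open>E^k v\<close> have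
  the distinct eigenvalues \<open>c + 2k\<close>, so there is a first one that vanishes, at
  \<open>k = M + 1\<close>; applying \<open>F\<close> to it forces
  \<open>(M + 1) (c + M) = 0\<close>.\<close>

lemma sl2_string:
  assumes EF: "br E F = H" and HE: "br H E = scale 2 E"
    and Fv: "br F v = 0" and Hv: "br H v = scale c v" and v: "v \<noteq> 0"
  shows "\<exists>M::nat. c = - of_nat M \<and> (br E ^^ Suc M) v = 0"
proof -
  define x where "x k = (br E ^^ k) v" for k
  have x0: "x 0 = v" and xS: "x (Suc k) = br E (x k)" for k by (simp_all add: x_def)
  have Hx: "br H (x k) = scale (c + 2 * of_nat k) (x k)" for k
  proof (induction k)
    case (Suc k)
    have "br H (x (Suc k)) = br (br H E) (x k) + br E (br H (x k))"
      by (simp add: xS br_derivation[of H])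
    then show ?case by (simp add: HE Suc.IH br_scale_left br_scale_right algebra_simps)
        (simp add: xS br_add_right br_scale_right)
  qed (simp add: x0 Hv)
  have Fx: "br F (x (Suc k)) = scale (- (of_nat (Suc k) * (c + of_nat k))) (x k)" for k
  proof (induction k)
    case 0
    have "br F (br E v) = br (br F E) v + br E (br F v)" by (rule br_derivation)
    also have "\<dots> = - br H v" using br_skew[of F E] by (simp add: EF Fv br_minus_left)
    finally show ?case by (simp add: x0 xS Hv)
  next
    case (Suc k)
    have "br F (br E (x (Suc k))) = br (br F E) (x (Suc k)) + br E (br F (x (Suc k)))"
      by (rule br_derivation)
    also have "\<dots> = - br H (x (Suc k)) + scale (- (of_nat (Suc k) * (c + of_nat k))) (x (Suc k))"
    proof -
      have "br F E = - H" using br_skew[of F E] by (simp add: EF)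
      then show ?thesis by (simp only: Suc.IH br_minus_left br_scale_right xS[symmetric])
    qed
    finally show ?case
      by (simp only: xS[of "Suc k"] Hx scale_minus_left[symmetric] scale_left_distrib[symmetric])
        (simp add: algebra_simps)
  qed
  have "\<exists>k. x k = 0"
  proof (rule ccontr)
    assume "\<nexists>k. x k = 0"
    then have "inj x \<and> independent (range x)"
      by (intro independent_eigenvectors[OF Hx]) (auto simp: inj_def)
    then have "finite (range x)" "inj x" using finite_independent by auto
    then show False using finite_imageD infinite_UNIV_nat by blast
  qed
  define K where "K = (LEAST k. x k = 0)"
  have K: "x K = 0" unfolding K_def using \<open>\<exists>k. x k = 0\<close> by (rule LeastI_ex)
  have "K \<noteq> 0" using K x0 v by (metis)
  then obtain M where M: "K = Suc M" using not0_implies_Suc by blast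
  have "x M \<noteq> 0" using not_less_Least[of M "\<lambda>k. x k = 0"] M by (auto simp: K_def)
  moreover have "scale (- (of_nat (Suc M) * (c + of_nat M))) (x M) = 0"
    using Fx[of M] K M by simp
  ultimately have "of_nat (Suc M) * (c + of_nat M) = 0" by simp
  then have "c + of_nat M = 0" using of_nat_neq_0[of M, where 'a = complex] by (simp only: mult_eq_0_iff) blast
  then have "c = - of_nat M" by (simp add: eq_neg_iff_add_eq_0)
  then show ?thesis using K M by (auto simp: x_def)
qed

end

locale chevalley_generators = simple_lie_algebra scale br
  for scale :: "complex \<Rightarrow> 'g::ab_group_add \<Rightarrow> 'g" and br +
  fixes n :: nat and C :: "nat \<Rightarrow> nat \<Rightarrow> int" and e f h :: "nat \<Rightarrow> 'g"
  assumes inj_h: "inj_on h {1..n}" and indep_h: "independent (h ` {1..n})"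
    and C_diag: "i \<in> {1..n} \<Longrightarrow> C i i = 2"
    and hh: "\<lbrakk>i \<in> {1..n}; j \<in> {1..n}\<rbrakk> \<Longrightarrow> br (h i) (h j) = 0"
    and he: "\<lbrakk>i \<in> {1..n}; j \<in> {1..n}\<rbrakk> \<Longrightarrow> br (h i) (e j) = scale (of_int (C i j)) (e j)"
    and hf: "\<lbrakk>i \<in> {1..n}; j \<in> {1..n}\<rbrakk> \<Longrightarrow> br (h i) (f j) = scale (- of_int (C i j)) (f j)"
    and ef: "\<lbrakk>i \<in> {1..n}; j \<in> {1..n}\<rbrakk> \<Longrightarrow> br (e i) (f j) = (if i = j then h i else 0)"
    and generate: "\<lbrakk>subspace S; \<And>x y. x \<in> S \<Longrightarrow> y \<in> S \<Longrightarrow> br x y \<in> S;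
      \<And>i. i \<in> {1..n} \<Longrightarrow> e i \<in> S \<and> f i \<in> S\<rbrakk> \<Longrightarrow> S = UNIV"
begin

lemma h_nonzero: "i \<in> {1..n} \<Longrightarrow> h i \<noteq> 0"
  using indep_h dependent_zero by (metis imageI)

lemma e_nonzero: "i \<in> {1..n} \<Longrightarrow> e i \<noteq> 0" and f_nonzero: "i \<in> {1..n} \<Longrightarrow> f i \<noteq> 0"
  using h_nonzero ef[of i i] by auto

text \<open>\<open>e j\<close> is a lowest weight vector for the sl_2 of colour \<open>i\<close>,
  because \<open>f i\<close> and \<open>e j\<close> commute. The string yields the sign of
  \<open>C i j\<close> and the Serre relation at once.\<close>

lemma string_e:
  assumes "i \<in> {1..n}" "j \<in> {1..n}" "i \<noteq> j"
  shows "\<exists>M::nat. C i j = - int M \<and> (br (e i) ^^ Suc M) (e j) = 0"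
proof -
  have "br (f i) (e j) = 0" using ef[of j i] br_skew[of "f i" "e j"] assms by auto
  moreover have "br (h i) (e i) = scale 2 (e i)" using he[of i i] C_diag[of i] assms by simp
  ultimately obtain M where "complex_of_int (C i j) = - of_nat M" "(br (e i) ^^ Suc M) (e j) = 0"
    using sl2_string[of "e i" "f i" "h i" "e j" "of_int (C i j)"] ef[of i i] he[of i j]
      e_nonzero[of j] assms by auto
  moreover from this(1) have "C i j = - int M"
    by (metis of_int_eq_iff of_int_minus of_int_of_nat_eq)
  ultimately show ?thesis by blast
qed

text \<open>The triple \<open>f i\<close>, \<open>e i\<close>, \<open>- h i\<close> again satisfies
  the sl_2 relations, and \<open>f j\<close> is a lowest weight vector for it with the same
  eigenvalue \<open>C i j\<close>.\<close>

lemma string_f: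
  assumes "i \<in> {1..n}" "j \<in> {1..n}" "i \<noteq> j"
  shows "\<exists>M::nat. C i j = - int M \<and> (br (f i) ^^ Suc M) (f j) = 0"
proof -
  have "br (f i) (- e i) = h i"
    using ef[of i i] br_skew[of "f i" "e i"] assms by (simp add: br_minus_right)
  moreover have "br (- e i) (f j) = 0" using ef[of i j] assms by (simp add: br_minus_left)
  moreover have "br (f i) (e i) = - h i" using ef[of i i] br_skew[of "f i" "e i"] assms by simp
  then have "br (f i) (e i) = - h i" .
  ultimately obtain M where "complex_of_int (C i j) = - of_nat M" "(br (f i) ^^ Suc M) (f j) = 0"
    using sl2_string[of "f i" "e i" "- h i" "f j" "of_int (C i j)"] hf[of i j] hf[of i i] C_diag[of i]
      f_nonzero[of j] ef[of i j] assms by (auto simp: br_minus_left)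
  moreover from this(1) have "C i j = - int M"
    by (metis of_int_eq_iff of_int_minus of_int_of_nat_eq)
  ultimately show ?thesis by blast
qed

lemma C_nonpos: "\<lbrakk>i \<in> {1..n}; j \<in> {1..n}; i \<noteq> j\<rbrakk> \<Longrightarrow> C i j \<le> 0"
  using string_e by fastforce

text \<open>Let \<open>A\<close> be the subalgebra generated by the \<open>e j\<close>,
  \<open>f j\<close> with \<open>j \<in> R\<close>. The strings joining the other colours to these
  have length zero, so the other generators annihilate \<open>A\<close>. Hence every generator
  normalizes \<open>A\<close>, which is therefore an ideal; by simplicity it is everything, and an
  \<open>e i\<close> outside \<open>R\<close> would be central.\<close>

lemma connected:
  assumes R: "R \<subseteq> {1..n}" "R \<noteq> {}"
    and sep: "\<And>i j. i \<in> {1..n} - R \<Longrightarrow> j \<in> R \<Longrightarrow> C i j = 0"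
  shows "R = {1..n}"
proof -
  define good where "good S \<longleftrightarrow> subspace S \<and> (\<forall>x\<in>S. \<forall>y\<in>S. br x y \<in> S) \<and> (\<forall>i\<in>R. e i \<in> S \<and> f i \<in> S)" for S
  define A where "A = \<Inter>{S. good S}"
  have A_sub: "A \<subseteq> S" if "good S" for S using that by (auto simp: A_def)
  have "good A"
    unfolding good_def A_def by (auto simp: good_def intro!: subspace_Inter)
  then have A: "subspace A" "\<And>x y. x \<in> A \<Longrightarrow> y \<in> A \<Longrightarrow> br x y \<in> A"
    "\<And>i. i \<in> R \<Longrightarrow> e i \<in> A" "\<And>i. i \<in> R \<Longrightarrow> f i \<in> A"
    unfolding good_def by auto
  \<comment> \<open>The centralizer of \<open>z\<close> is itself a subalgebra; once it contains the
    generators of \<open>A\<close> it is one of the sets whose intersection is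
    \<open>A\<close>.\<close>
  have centralizer: "br z y = 0" if "\<And>j. j \<in> R \<Longrightarrow> br z (e j) = 0 \<and> br z (f j) = 0" "y \<in> A" for z y
  proof -
    have "good {y. br z y = 0}"
      unfolding good_def
      by (intro conjI subspaceI ballI) (auto simp: br_add_right br_scale_right br_derivation[of z] that(1))
    then show ?thesis using A_sub that(2) by blast
  qed
  have kill: "br (e i) y = 0" "br (f i) y = 0" if i: "i \<in> {1..n} - R" and y: "y \<in> A" for i y
  proof -
    have "br (e i) (e j) = 0 \<and> br (e i) (f j) = 0 \<and> br (f i) (e j) = 0 \<and> br (f i) (f j) = 0"
      if "j \<in> R" for j
      using string_e[of i j] string_f[of i j] sep[OF i that] ef[of i j] ef[of j i]
        br_skew[of "f i" "e j"] i that R by fastforce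
    then show "br (e i) y = 0" "br (f i) y = 0" using centralizer[OF _ y] by blast+
  qed
  have "{x. \<forall>y\<in>A. br x y \<in> A} = UNIV"
  proof (rule generate)
    show "subspace {x. \<forall>y\<in>A. br x y \<in> A}"
      by (rule subspaceI)
        (auto simp: br_add_left br_scale_left subspace_0[OF A(1)] subspace_add[OF A(1)] subspace_scale[OF A(1)])
  next
    fix x y assume xy: "x \<in> {x. \<forall>y\<in>A. br x y \<in> A}" "y \<in> {x. \<forall>y\<in>A. br x y \<in> A}"
    have "br (br x y) z \<in> A" if "z \<in> A" for z
    proof -
      have "br (br x y) z = br x (br y z) - br y (br x z)"
        using br_derivation[of x y z] by simp
      then show ?thesis using xy that subspace_diff[OF A(1)] by simp
    qed
    then show "br x y \<in> {x. \<forall>y\<in>A. br x y \<in> A}" by simp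
  next
    fix i assume "i \<in> {1..n}"
    then show "e i \<in> {x. \<forall>y\<in>A. br x y \<in> A} \<and> f i \<in> {x. \<forall>y\<in>A. br x y \<in> A}"
      using A(2-4) kill subspace_0[OF A(1)] by (cases "i \<in> R") auto
  qed
  then have "A = {0} \<or> A = UNIV" by (intro simple A(1)) blast
  moreover have "A \<noteq> {0}" using R A(3) e_nonzero by (metis equals0I singletonD subsetD)
  ultimately have "A = UNIV" by blast
  then have "{1..n} - R = {}"
    using kill(1) center_trivial e_nonzero by (metis DiffD1 UNIV_I equals0I)
  then show ?thesis using R by blast
qed

section \<open>Weights and definiteness of the trace form\<close>

definition weight_vectors :: "'g set" where
  "weight_vectors = {x. \<forall>i\<in>{1..n}. \<exists>z::int. br (h i) x = scale (of_int z) x}"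

text \<open>Brackets add weights, so the weight vectors span a subalgebra, and it contains the
  generators.\<close>

lemma span_weight_vectors: "span weight_vectors = UNIV"
proof (rule generate)
  show "subspace (span weight_vectors)" by (rule subspace_span)
next
  fix i assume "i \<in> {1..n}"
  then have "e i \<in> weight_vectors" "f i \<in> weight_vectors"
    unfolding weight_vectors_def using he hf by (auto intro: exI[of _ "- C _ _"])
  then show "e i \<in> span weight_vectors \<and> f i \<in> span weight_vectors" by (simp add: span_base)
next
  have base: "br x y \<in> weight_vectors" if xy: "x \<in> weight_vectors" "y \<in> weight_vectors" for x y
    unfolding weight_vectors_def
  proof (intro CollectI ballI)
    fix i assume i: "i \<in> {1..n}"
    obtain a where "br (h i) x = scale (of_int a) x" using xy(1) i unfolding weight_vectors_def by blast
    moreover obtain b where "br (h i) y = scale (of_int b) y" using xy(2) i unfolding weight_vectors_def by blast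
    ultimately have "br (h i) (br x y) = scale (of_int (a + b)) (br x y)"
      by (simp add: br_derivation[of "h i"] br_scale_left br_scale_right scale_left_distrib)
    then show "\<exists>z::int. br (h i) (br x y) = scale (of_int z) (br x y)" by blast
  qed
  fix x y assume x: "x \<in> span weight_vectors" and y: "y \<in> span weight_vectors"
  have w: "br x y \<in> span weight_vectors" if "x \<in> weight_vectors" for x
    using y
  proof (induction rule: span_induct_alt)
    case (step c u v)
    then show ?case using that base
      by (simp add: br_add_right br_scale_right span_add span_scale span_base)
  qed (simp add: span_zero)
  show "br x y \<in> span weight_vectors" using x
    by (induction rule: span_induct_alt) (simp_all add: w br_add_left br_scale_left span_add span_scale span_zero)
qed

text \<open>Expanded in the basis \<open>B\<close>, both composites give the same double sum with
  its two indices exchanged. Writing the trace through \<open>representation\<close> avoids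
  matrices.\<close>

lemma trace_commute:
  assumes B: "independent B" "finite B" "span B = UNIV"
    and T: "\<And>x y. T (x + y) = T x + T y" "\<And>c x. T (scale c x) = scale c (T x)"
    and S: "\<And>x y. S (x + y) = S x + S y" "\<And>c x. S (scale c x) = scale c (S x)"
  shows "(\<Sum>b\<in>B. representation B (T (S b)) b) = (\<Sum>b\<in>B. representation B (S (T b)) b)"
proof -
  have expand: "representation B (T (S b)) b = (\<Sum>c\<in>B. representation B (S b) c * representation B (T c) b)"
    if T: "\<And>x y. T (x + y) = T x + T y" "\<And>c x. T (scale c x) = scale c (T x)"
    for T S :: "'g \<Rightarrow> 'g" and b
  proof -
    have T_sum: "T (\<Sum>c\<in>A. g c) = (\<Sum>c\<in>A. T (g c))" if "finite A" for A :: "'g set" and g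
      using that T(2)[of 0 0] by induction (simp_all add: T(1))
    have "S b = (\<Sum>c\<in>B. scale (representation B (S b) c) c)"
      using sum_representation_eq[OF B(1), of "S b" B] B by simp
    then have "T (S b) = T (\<Sum>c\<in>B. scale (representation B (S b) c) c)" by simp
    also have "\<dots> = (\<Sum>c\<in>B. scale (representation B (S b) c) (T c))"
      by (simp add: T_sum[OF B(2)] T(2))
    finally show ?thesis
      using B by (simp add: representation_sum representation_scale)
  qed
  show ?thesis
    unfolding expand[OF T, of S] expand[OF S, of T]
    by (subst sum.swap) (simp add: mult.commute)
qed

text \<open>The trace form \<open>K(x, y) = tr (ad x \<circ> ad y)\<close> is invariant, so \<open>K(h\<^sub>i, h\<^sub>j)\<close> equals
  \<open>K([e\<^sub>i, f\<^sub>i], h\<^sub>j) = K(e\<^sub>i, [f\<^sub>i, h\<^sub>j]) = c\<^sub>j\<^sub>i K(e\<^sub>i, f\<^sub>i)\<close>; on a basis of weight vectors it is a sum of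
  squares.\<close>

lemma trace_form:
  obtains B :: "'g set" and w :: "'g \<Rightarrow> nat \<Rightarrow> int" where
    "finite B"
    "\<And>x. (\<And>b. b \<in> B \<Longrightarrow> (\<Sum>i\<in>{1..n}. x i * real_of_int (w b i)) = 0) \<Longrightarrow> \<forall>i\<in>{1..n}. x i = 0"
    "\<And>i j. i \<in> {1..n} \<Longrightarrow> j \<in> {1..n} \<Longrightarrow>
       2 * (\<Sum>b\<in>B. w b i * w b j) = C j i * (\<Sum>b\<in>B. w b i * w b i)"
proof -
  obtain B where B: "B \<subseteq> weight_vectors" "independent B" "weight_vectors \<subseteq> span B"
    using maximal_independent_subset[of weight_vectors] by metis
  then have span: "span B = UNIV"
    using span_weight_vectors span_mono[OF B(3)] by (simp add: span_span) blast
  have finB: "finite B" using finite_independent B(2) .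
  have "\<forall>b\<in>B. \<exists>z. \<forall>i\<in>{1..n}. br (h i) b = scale (of_int (z i)) b"
    using B(1) unfolding weight_vectors_def by (intro ballI bchoice) blast
  then obtain w where w: "\<And>b i. b \<in> B \<Longrightarrow> i \<in> {1..n} \<Longrightarrow> br (h i) b = scale (of_int (w b i)) b"
    by metis
  define tr where "tr T = (\<Sum>b\<in>B. representation B (T b) b)" for T
  define K where "K x y = tr (\<lambda>v. br x (br y v))" for x y
  note tr_comm = trace_commute[OF B(2) finB span, folded tr_def]
  have tr_diff: "tr (\<lambda>v. T v - S v) = tr T - tr S" for T S
    unfolding tr_def using span by (simp add: representation_diff[OF B(2)] sum_subtractf)
  \<comment> \<open>By the Jacobi identity ad [x, y] is the commutator of ad x and ad y; cyclicity
    of the trace turns this into the commutator of ad y and ad z.\<close>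
  have inv: "K (br x y) z = K x (br y z)" for x y z
  proof -
    have "K (br x y) z = tr (\<lambda>v. br x (br y (br z v)) - br y (br x (br z v)))"
      unfolding K_def by (simp add: br_derivation[of x y])
    also have "\<dots> = tr (\<lambda>v. br x (br y (br z v))) - tr (\<lambda>v. br y (br x (br z v)))"
      by (rule tr_diff)
    also have "tr (\<lambda>v. br y (br x (br z v))) = tr (\<lambda>v. br x (br z (br y v)))"
      by (rule tr_comm) (simp_all add: br_add_right br_scale_right)
    also have "tr (\<lambda>v. br x (br y (br z v))) - tr (\<lambda>v. br x (br z (br y v))) =
        tr (\<lambda>v. br x (br y (br z v)) - br x (br z (br y v)))"
      by (rule tr_diff[symmetric])
    also have "\<dots> = K x (br y z)"
      unfolding K_def by (simp add: br_derivation[of y z] br_add_right)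
    finally show ?thesis .
  qed
  have K_hh: "K (h i) (h j) = of_int (\<Sum>b\<in>B. w b i * w b j)" if "i \<in> {1..n}" "j \<in> {1..n}" for i j
    unfolding K_def tr_def of_int_sum
  proof (rule sum.cong[OF refl])
    fix b assume b: "b \<in> B"
    then have "b \<in> span B" by (simp add: span_base)
    then show "representation B (br (h i) (br (h j) b)) b = of_int (w b i * w b j)"
      using b that by (simp add: w br_scale_right representation_scale[OF B(2)] representation_basis[OF B(2)]
          span_scale mult.commute)
  qed
  have K_scale: "K x (scale c y) = c * K x y" for x c y
    unfolding K_def tr_def using span
    by (simp add: br_scale_left br_scale_right representation_scale[OF B(2)] sum_distrib_left)
  have K_ef: "K (h i) (h j) = of_int (C j i) * K (e i) (f i)" if "i \<in> {1..n}" "j \<in> {1..n}" for i j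
  proof -
    have "br (f i) (h j) = scale (of_int (C j i)) (f i)"
      using br_skew[of "f i" "h j"] hf[of j i] that by simp
    then show ?thesis using inv[of "e i" "f i" "h j"] ef[of i i] that by (simp add: K_scale)
  qed
  show ?thesis
  proof (rule that[OF finB])
    \<comment> \<open>A combination of coroots on which all weights vanish acts by zero on a basis,
      hence is central and zero; independence of the \<open>h i\<close> then kills its
      coefficients.\<close>
    fix x :: "nat \<Rightarrow> real" assume x: "\<And>b. b \<in> B \<Longrightarrow> (\<Sum>i\<in>{1..n}. x i * real_of_int (w b i)) = 0"
    define y where "y = (\<Sum>i\<in>{1..n}. scale (of_real (x i)) (h i))"
    have "br y v = 0" for v
    proof -
      have "v \<in> span B" using span by simp
      then show ?thesis
      proof (induction rule: span_induct_alt)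
        case (step c b v)
        have "br y b = (\<Sum>i\<in>{1..n}. scale (of_real (x i)) (scale (of_int (w b i)) b))"
          unfolding y_def by (simp add: br_sum_left br_scale_left w[OF step(1)])
        also have "\<dots> = scale (of_real (\<Sum>i\<in>{1..n}. x i * real_of_int (w b i))) b"
          by (simp add: scale_sum_left)
        finally have "br y b = 0" by (simp only: x[OF step(1)] of_real_0 scale_zero_left)
        then show ?case using step by (simp add: br_add_right br_scale_right)
      qed simp
    qed
    then have "y = 0" by (rule center_trivial)
    moreover have "(\<Sum>v\<in>h ` {1..n}. scale (of_real (x (inv_into {1..n} h v))) v) = y"
      unfolding y_def sum.reindex[OF inj_h]
      by (intro sum.cong refl) (simp only: o_apply inv_into_f_f[OF inj_h])
    ultimately have "(\<Sum>v\<in>h ` {1..n}. scale (of_real (x (inv_into {1..n} h v))) v) = 0"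
      by simp
    then have "of_real (x (inv_into {1..n} h v)) = (0::complex)" if "v \<in> h ` {1..n}" for v
      using independentD[OF indep_h _ subset_refl, of "\<lambda>v. of_real (x (inv_into {1..n} h v))" v] that
      by simp
    then show "\<forall>i\<in>{1..n}. x i = 0" using inv_into_f_f[OF inj_h] by force
  next
    fix i j assume ij: "i \<in> {1..n}" "j \<in> {1..n}"
    have "of_int (\<Sum>b\<in>B. w b i * w b j) = of_int (C j i) * K (e i) (f i)"
      using K_hh[OF ij] K_ef[OF ij] by simp
    moreover have "of_int (\<Sum>b\<in>B. w b i * w b i) = 2 * K (e i) (f i)"
      using K_hh[OF ij(1,1)] K_ef[OF ij(1,1)] C_diag[OF ij(1)] by simp
    ultimately have "(of_int (2 * (\<Sum>b\<in>B. w b i * w b j)) :: complex) =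
        of_int (C j i * (\<Sum>b\<in>B. w b i * w b i))"
      unfolding of_int_mult by simp
    then show "2 * (\<Sum>b\<in>B. w b i * w b j) = C j i * (\<Sum>b\<in>B. w b i * w b i)"
      by (simp only: of_int_eq_iff)
  qed
qed

text \<open>\<open>S\<close> is the Gram matrix of the coroots under the trace form, a sum of
  squares over the weights and definite because the weights separate coroots. Since
  \<open>2 * S i j = C j i * S i i\<close>, substituting \<open>y i / S i i\<close> turns the form
  of \<open>S\<close> into half of the desired one, which dictates \<kappa> as the inverse of the
  diagonal of \<open>S\<close>.\<close>

lemma C_positive_definite:
  obtains \<kappa> :: "nat \<Rightarrow> real" where
    "\<And>i. i \<in> {1..n} \<Longrightarrow> \<kappa> i > 0"
    "\<And>i j. i \<in> {1..n} \<Longrightarrow> j \<in> {1..n} \<Longrightarrow> \<kappa> i * C i j = \<kappa> j * C j i"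
    "\<And>y. \<exists>i\<in>{1..n}. y i \<noteq> 0 \<Longrightarrow> (\<Sum>i\<in>{1..n}. \<Sum>j\<in>{1..n}. \<kappa> i * C i j * y i * y j) > 0"
proof -
  obtain B :: "'g set" and w :: "'g \<Rightarrow> nat \<Rightarrow> int" where finB: "finite B"
    and inj: "\<And>x. (\<And>b. b \<in> B \<Longrightarrow> (\<Sum>i\<in>{1..n}. x i * real_of_int (w b i)) = 0) \<Longrightarrow> \<forall>i\<in>{1..n}. x i = 0"
    and form: "\<And>i j. i \<in> {1..n} \<Longrightarrow> j \<in> {1..n} \<Longrightarrow>
       2 * (\<Sum>b\<in>B. w b i * w b j) = C j i * (\<Sum>b\<in>B. w b i * w b i)"
    by (rule trace_form) blast
  define S where "S i j = real_of_int (\<Sum>b\<in>B. w b i * w b j)" for i j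
  have S_sym: "S i j = S j i" for i j by (simp add: S_def mult.commute)
  have S: "2 * S i j = C j i * S i i" if "i \<in> {1..n}" "j \<in> {1..n}" for i j
    using arg_cong[OF form[OF that], of real_of_int] by (simp add: S_def)
  have square: "(\<Sum>i\<in>{1..n}. \<Sum>j\<in>{1..n}. S i j * x i * x j) =
      (\<Sum>b\<in>B. (\<Sum>i\<in>{1..n}. x i * real_of_int (w b i))\<^sup>2)" for x
  proof -
    have "(\<Sum>b\<in>B. (\<Sum>i\<in>{1..n}. x i * real_of_int (w b i))\<^sup>2) =
        (\<Sum>b\<in>B. \<Sum>i\<in>{1..n}. \<Sum>j\<in>{1..n}. (x i * w b i) * (x j * w b j))"
      by (simp add: power2_eq_square sum_product)
    also have "\<dots> = (\<Sum>i\<in>{1..n}. \<Sum>b\<in>B. \<Sum>j\<in>{1..n}. (x i * w b i) * (x j * w b j))"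
      by (rule sum.swap)
    also have "\<dots> = (\<Sum>i\<in>{1..n}. \<Sum>j\<in>{1..n}. \<Sum>b\<in>B. (x i * w b i) * (x j * w b j))"
      by (intro sum.cong refl sum.swap)
    finally show ?thesis by (simp add: S_def sum_distrib_left mult_ac)
  qed
  have pos: "(\<Sum>i\<in>{1..n}. \<Sum>j\<in>{1..n}. S i j * x i * x j) > 0" if nz: "\<exists>i\<in>{1..n}. x i \<noteq> 0" for x
  proof -
    have "\<exists>b\<in>B. (\<Sum>i\<in>{1..n}. x i * real_of_int (w b i)) \<noteq> 0" using inj[of x] nz by blast
    then have "(\<Sum>b\<in>B. (\<Sum>i\<in>{1..n}. x i * real_of_int (w b i))\<^sup>2) \<noteq> 0"
      using finB by (simp add: sum_nonneg_eq_0_iff)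
    moreover have "(\<Sum>b\<in>B. (\<Sum>i\<in>{1..n}. x i * real_of_int (w b i))\<^sup>2) \<ge> 0" by (simp add: sum_nonneg)
    ultimately show ?thesis unfolding square by linarith
  qed
  have S_pos: "S i i > 0" if i: "i \<in> {1..n}" for i
  proof -
    have "(\<Sum>a\<in>{1..n}. \<Sum>b\<in>{1..n}. S a b * (if a = i then 1 else 0) * (if b = i then 1 else 0)) > 0"
      by (rule pos) (use i in auto)
    also have "(\<Sum>a\<in>{1..n}. \<Sum>b\<in>{1..n}. S a b * (if a = i then 1 else 0) * (if b = i then 1 else 0)) = S i i"
      using i by (simp add: if_distrib[of "\<lambda>x. _ * x"] if_distribR cong: if_cong)
    finally show ?thesis .
  qed
  show ?thesis
  proof (rule that[of "\<lambda>i. 1 / S i i"])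
    fix i j assume "i \<in> {1..n}" "j \<in> {1..n}"
    then show "1 / S i i * C i j = 1 / S j j * C j i"
      using S[of i j] S[of j i] S_sym[of i j] S_pos[of i] S_pos[of j] by (simp add: field_simps)
  next
    fix y :: "nat \<Rightarrow> real" assume y: "\<exists>i\<in>{1..n}. y i \<noteq> 0"
    have "(\<Sum>i\<in>{1..n}. \<Sum>j\<in>{1..n}. 1 / S i i * C i j * y i * y j) =
        2 * (\<Sum>i\<in>{1..n}. \<Sum>j\<in>{1..n}. S i j * (y i / S i i) * (y j / S j j))"
      unfolding sum_distrib_left
    proof (intro sum.cong refl)
      fix i j assume ij: "i \<in> {1..n}" "j \<in> {1..n}"
      have "2 * (S i j * (y i / S i i) * (y j / S j j)) = (2 * S j i) * (y i / S i i) * (y j / S j j)"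
        by (simp add: S_sym[of i j])
      also have "\<dots> = 1 / S i i * C i j * y i * y j"
        using S[of j i] ij S_pos[of j] by simp
      finally show "1 / S i i * C i j * y i * y j = 2 * (S i j * (y i / S i i) * (y j / S j j))" by simp
    qed
    moreover have "(\<Sum>i\<in>{1..n}. \<Sum>j\<in>{1..n}. S i j * (y i / S i i) * (y j / S j j)) > 0"
      by (rule pos) (use y S_pos in fastforce)
    ultimately show "(\<Sum>i\<in>{1..n}. \<Sum>j\<in>{1..n}. 1 / S i i * C i j * y i * y j) > 0" by simp
  qed (simp add: S_pos)
qed

end

lemma (in simple_lie_algebra) chevalley_generators_exist:
  assumes "is_cartan_matrix n C"
  shows "\<exists>e f h. chevalley_generators scale br n C e f h"
  using assms unfolding is_cartan_matrix_def
proof (elim exE conjE, intro exI)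
  fix e f h :: "nat \<Rightarrow> 'g"
  assume "inj_on h {1..n}" "independent (h ` {1..n})" "\<forall>i\<in>{1..n}. C i i = 2"
    "\<forall>i\<in>{1..n}. \<forall>j\<in>{1..n}. br (h i) (h j) = 0 \<and>
        br (h i) (e j) = scale (of_int (C i j)) (e j) \<and>
        br (h i) (f j) = scale (- of_int (C i j)) (f j) \<and>
        br (e i) (f j) = (if i = j then h i else 0)"
    "\<forall>S. subspace S \<and> (\<forall>x\<in>S. \<forall>y\<in>S. br x y \<in> S) \<and> (\<forall>i\<in>{1..n}. e i \<in> S \<and> f i \<in> S)
        \<longrightarrow> S = UNIV"
  note * = this
  show "chevalley_generators scale br n C e f h"
    by (intro chevalley_generators.intro chevalley_generators_axioms.intro simple_lie_algebra_axioms)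
      (use * in blast)+
qed

section \<open>Cartan matrices of finite type\<close>

text \<open>When the index \<open>s\<close> is eliminated, the pivot is \<open>c0\<close>. It equals
  the value of the form at \<open>w\<close>, the unit vector at \<open>s\<close> minus the solution
  for the column of \<open>s\<close>, so definiteness makes it positive.\<close>

lemma positive_definite_solvable:
  fixes a :: "'i \<Rightarrow> 'i \<Rightarrow> real"
  assumes "finite S" and sym: "\<And>i j. i \<in> S \<Longrightarrow> j \<in> S \<Longrightarrow> a i j = a j i"
    and pos: "\<And>x. \<exists>i\<in>S. x i \<noteq> 0 \<Longrightarrow> (\<Sum>i\<in>S. \<Sum>j\<in>S. a i j * x i * x j) > 0"
  shows "\<exists>z. \<forall>t\<in>S. (\<Sum>j\<in>S. a t j * z j) = \<phi> t"
  using assms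
proof (induction S arbitrary: \<phi> rule: finite_induct)
  case (insert s S)
  have pos_S: "(\<Sum>i\<in>S. \<Sum>j\<in>S. a i j * x i * x j) > 0" if "\<exists>i\<in>S. x i \<noteq> 0" for x
  proof -
    let ?x = "\<lambda>i. if i = s then 0 else x i"
    have "(\<Sum>i\<in>insert s S. \<Sum>j\<in>insert s S. a i j * ?x i * ?x j) > 0"
      by (rule insert.prems(2)) (use that insert.hyps in auto)
    also have "(\<Sum>i\<in>insert s S. \<Sum>j\<in>insert s S. a i j * ?x i * ?x j) =
        (\<Sum>i\<in>S. \<Sum>j\<in>S. a i j * x i * x j)"
    proof -
      have "(\<Sum>i\<in>insert s S. \<Sum>j\<in>insert s S. a i j * ?x i * ?x j) =
        (\<Sum>i\<in>S. \<Sum>j\<in>S. a i j * ?x i * ?x j)"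
        using insert.hyps by simp
      also have "\<dots> = (\<Sum>i\<in>S. \<Sum>j\<in>S. a i j * x i * x j)"
        using insert.hyps by (intro sum.cong refl) auto
      finally show ?thesis .
    qed
    finally show ?thesis .
  qed
  have IH: "\<exists>z. \<forall>t\<in>S. (\<Sum>j\<in>S. a t j * z j) = \<psi> t" for \<psi>
    by (rule insert.IH) (use insert.prems(1) pos_S in auto)
  obtain z0 where z0: "\<And>t. t \<in> S \<Longrightarrow> (\<Sum>j\<in>S. a t j * z0 j) = a t s"
    using IH[of "\<lambda>t. a t s"] by blast
  obtain z1 where z1: "\<And>t. t \<in> S \<Longrightarrow> (\<Sum>j\<in>S. a t j * z1 j) = \<phi> t"
    using IH[of \<phi>] by blast
  define c0 where "c0 = a s s - (\<Sum>j\<in>S. a s j * z0 j)"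
  define w where "w j = (if j = s then 1 else - z0 j)" for j
  have row: "(\<Sum>j\<in>insert s S. a t j * w j) = (if t = s then c0 else 0)" if "t \<in> insert s S" for t
  proof -
    have "(\<Sum>j\<in>S. a t j * w j) = - (\<Sum>j\<in>S. a t j * z0 j)"
      unfolding sum_negf[symmetric] using insert.hyps by (intro sum.cong refl) (auto simp: w_def)
    then show ?thesis using insert.hyps z0[of t] that by (auto simp: c0_def w_def)
  qed
  have "0 < (\<Sum>i\<in>insert s S. \<Sum>j\<in>insert s S. a i j * w i * w j)"
    by (rule insert.prems(2)) (auto simp: w_def)
  also have "\<dots> = (\<Sum>i\<in>insert s S. w i * (\<Sum>j\<in>insert s S. a i j * w j))"
    by (simp add: sum_distrib_left mult_ac)
  also have "\<dots> = (\<Sum>i\<in>insert s S. w i * (if i = s then c0 else 0))"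
    by (intro sum.cong refl) (simp only: row)
  also have "\<dots> = (\<Sum>i\<in>insert s S. if i = s then c0 else 0)"
    by (intro sum.cong refl) (simp add: w_def)
  also have "\<dots> = c0" using insert.hyps by simp
  finally have c0: "c0 > 0" .
  define c where "c = (\<phi> s - (\<Sum>j\<in>S. a s j * z1 j)) / c0"
  define z where "z j = (if j = s then c else z1 j - c * z0 j)" for j
  have "(\<Sum>j\<in>insert s S. a t j * z j) = \<phi> t" if "t \<in> insert s S" for t
  proof -
    have "(\<Sum>j\<in>S. a t j * z j) = (\<Sum>j\<in>S. a t j * z1 j - c * (a t j * z0 j))"
      using insert.hyps by (intro sum.cong refl) (auto simp: z_def algebra_simps)
    then have "(\<Sum>j\<in>insert s S. a t j * z j) =
        a t s * c + ((\<Sum>j\<in>S. a t j * z1 j) - c * (\<Sum>j\<in>S. a t j * z0 j))"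
      using insert.hyps by (simp add: sum_subtractf sum_distrib_left z_def)
    moreover have "c * c0 = \<phi> s - (\<Sum>j\<in>S. a s j * z1 j)" using c0 by (simp add: c_def)
    then have "a s s * c - c * (\<Sum>j\<in>S. a s j * z0 j) = \<phi> s - (\<Sum>j\<in>S. a s j * z1 j)"
      by (simp add: c0_def algebra_simps)
    ultimately show ?thesis using that z0[of t] z1[of t] by (auto simp: algebra_simps)
  qed
  then show ?case by blast
qed simp

text \<open>From here on the Lie algebra enters only through these properties of its Cartan matrix.
  The two symmetrizers have different tasks: \<open>d\<close> is the integral one in the commutation
  exponents, \<kappa> the real one whose form is known to be definite.\<close>

locale cartan_data =
  fixes n :: nat and C :: "nat \<Rightarrow> nat \<Rightarrow> int" and d :: "nat \<Rightarrow> int" and \<kappa> :: "nat \<Rightarrow> real"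
  assumes n_pos: "n \<ge> 1"
    and C_diag: "i \<in> {1..n} \<Longrightarrow> C i i = 2"
    and C_nonpos: "\<lbrakk>i \<in> {1..n}; j \<in> {1..n}; i \<noteq> j\<rbrakk> \<Longrightarrow> C i j \<le> 0"
    and connected: "\<lbrakk>R \<subseteq> {1..n}; R \<noteq> {}; \<And>i j. i \<in> {1..n} - R \<Longrightarrow> j \<in> R \<Longrightarrow> C i j = 0\<rbrakk> \<Longrightarrow> R = {1..n}"
    and d_pos: "i \<in> {1..n} \<Longrightarrow> d i \<ge> 1"
    and d_sym: "\<lbrakk>i \<in> {1..n}; j \<in> {1..n}\<rbrakk> \<Longrightarrow> d i * C i j = d j * C j i"
    and \<kappa>_pos: "i \<in> {1..n} \<Longrightarrow> \<kappa> i > 0"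
    and \<kappa>_sym: "\<lbrakk>i \<in> {1..n}; j \<in> {1..n}\<rbrakk> \<Longrightarrow> \<kappa> i * C i j = \<kappa> j * C j i"
    and positive_definite: "\<exists>i\<in>{1..n}. y i \<noteq> 0 \<Longrightarrow>
      (\<Sum>i\<in>{1..n}. \<Sum>j\<in>{1..n}. \<kappa> i * C i j * y i * y j) > 0"
begin

abbreviation "I \<equiv> {1..n}"
abbreviation "ddist \<equiv> dynkin_dist n C"

section \<open>The Dynkin diagram as a graph\<close>

definition adj :: "nat \<Rightarrow> nat \<Rightarrow> bool" where
  "adj i j \<longleftrightarrow> i \<in> I \<and> j \<in> I \<and> i \<noteq> j \<and> C i j \<noteq> 0"

lemma C_eq_0_iff:
  assumes "i \<in> I" "j \<in> I"
  shows "C i j = 0 \<longleftrightarrow> C j i = 0"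
proof -
  have "d i * C i j = d j * C j i" "d i \<noteq> 0" "d j \<noteq> 0"
    using d_sym[OF assms] d_pos[OF assms(1)] d_pos[OF assms(2)] by simp_all
  then show ?thesis by (metis mult_eq_0_iff)
qed

lemma adj_sym: "adj i j \<longleftrightarrow> adj j i"
  using C_eq_0_iff by (auto simp: adj_def)

lemma adj_neg: "adj i j \<Longrightarrow> C i j \<le> -1"
  using C_nonpos[of i j] unfolding adj_def by linarith

lemma edges_iff: "(i, j) \<in> dynkin_edges n C \<longleftrightarrow> adj i j"
  by (auto simp: dynkin_edges_def adj_def)

lemma relpow_edges_sym: "(i, j) \<in> dynkin_edges n C ^^ k \<Longrightarrow> (j, i) \<in> dynkin_edges n C ^^ k"
proof (induction k arbitrary: j)
  case (Suc k)
  then obtain m where "(i, m) \<in> dynkin_edges n C ^^ k" "(m, j) \<in> dynkin_edges n C" by auto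
  then have "(m, i) \<in> dynkin_edges n C ^^ k" "(j, m) \<in> dynkin_edges n C"
    using Suc.IH by (auto simp: edges_iff adj_sym)
  then show ?case by (rule relpow_Suc_I2[rotated])
qed auto

lemma reachable:
  assumes i: "i \<in> I" and j: "j \<in> I"
  shows "\<exists>k. (i, j) \<in> dynkin_edges n C ^^ k"
proof -
  let ?R = "{j \<in> I. \<exists>k. (i, j) \<in> dynkin_edges n C ^^ k}"
  have "(i, i) \<in> dynkin_edges n C ^^ 0" by simp
  then have "?R \<noteq> {}" using i by blast
  moreover have "C a b = 0" if ab: "a \<in> I - ?R" "b \<in> ?R" for a b
  proof (rule ccontr)
    assume "C a b \<noteq> 0"
    moreover have "a \<noteq> b" using ab by blast
    ultimately have "adj a b" using ab by (simp add: adj_def)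
    then have "(b, a) \<in> dynkin_edges n C" using adj_sym edges_iff by blast
    moreover obtain k where "(i, b) \<in> dynkin_edges n C ^^ k" using ab by blast
    ultimately have "(i, a) \<in> dynkin_edges n C ^^ Suc k" by auto
    then show False using ab by blast
  qed
  ultimately have "?R = I" by (intro connected) auto
  then show ?thesis using j by blast
qed

lemma relpow_dist: "\<lbrakk>i \<in> I; j \<in> I\<rbrakk> \<Longrightarrow> (i, j) \<in> dynkin_edges n C ^^ ddist i j"
  unfolding dynkin_dist_def by (rule LeastI_ex) (rule reachable)

lemma dist_le: "(i, j) \<in> dynkin_edges n C ^^ k \<Longrightarrow> ddist i j \<le> k"
  unfolding dynkin_dist_def by (rule Least_le)

lemma dist_refl [simp]: "ddist i i = 0"
  using dist_le[of i i 0] by simp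

lemma dist_sym: "\<lbrakk>i \<in> I; j \<in> I\<rbrakk> \<Longrightarrow> ddist i j = ddist j i"
  by (metis relpow_edges_sym relpow_dist dist_le le_antisym)

lemma dist_adj_le: "\<lbrakk>i \<in> I; adj j k\<rbrakk> \<Longrightarrow> ddist i k \<le> ddist i j + 1"
  using dist_le[of i k "Suc (ddist i j)"] relpow_dist[of i j]
  by (metis Suc_eq_plus1 adj_def edges_iff relpow_Suc_I)

lemma dist_eq_1_iff:
  assumes "i \<in> I" "j \<in> I"
  shows "ddist i j = 1 \<longleftrightarrow> adj i j"
proof
  assume "ddist i j = 1"
  then show "adj i j" using relpow_dist[OF assms] by (simp add: edges_iff)
next
  assume a: "adj i j"
  then have "ddist i j \<le> 1" using dist_le[of i j 1] by (simp add: edges_iff)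
  moreover have "ddist i j \<noteq> 0"
  proof
    assume "ddist i j = 0"
    then show False using relpow_dist[OF assms] a by (simp add: adj_def)
  qed
  ultimately show "ddist i j = 1" by simp
qed

lemma dist_parent:
  assumes "i \<in> I" "j \<in> I" "i \<noteq> j"
  shows "\<exists>k. adj k j \<and> Suc (ddist i k) = ddist i j"
proof -
  have "ddist i j \<noteq> 0"
  proof
    assume "ddist i j = 0"
    then show False using relpow_dist[OF assms(1,2)] assms(3) by simp
  qed
  then obtain m where m: "ddist i j = Suc m" using not0_implies_Suc by blast
  then obtain k where k: "(i, k) \<in> dynkin_edges n C ^^ m" "adj k j"
    using relpow_dist[OF assms(1,2)] by (auto simp: edges_iff)
  have "ddist i k \<le> m" using dist_le k(1) by blast
  moreover have "ddist i j \<le> ddist i k + 1" using dist_adj_le assms(1) k(2) by blast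
  ultimately show ?thesis using k(2) m by (intro exI[of _ k]) simp
qed

text \<open>Positive definiteness is applied to the vector with entries \<open>1 / \<surd>\<kappa>\<^sub>i\<close>.\<close>

lemma card_edges: "card (dynkin_edges n C) < 2 * n"
proof -
  let ?E = "dynkin_edges n C"
  define x where "x i = 1 / sqrt (\<kappa> i)" for i
  define a where "a i j = \<kappa> i * C i j * x i * x j" for i j
  have fin: "finite ?E" by (rule finite_subset[of _ "I \<times> I"]) (auto simp: dynkin_edges_def)
  have diag: "a i i = 2" if "i \<in> I" for i
    using \<kappa>_pos[OF that] C_diag[OF that] by (simp add: a_def x_def)
  \<comment> \<open>On an edge \<open>a i j\<close> is minus the square root of
    \<open>C i j * C j i\<close>, a positive integer.\<close>
  have edge: "a i j \<le> - 1" if "adj i j" for i j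
  proof -
    have ij: "i \<in> I" "j \<in> I" using that by (auto simp: adj_def)
    have "a i j * a i j = (\<kappa> i * C i j) * (\<kappa> j * C j i) * (x i * x i) * (x j * x j)"
      using \<kappa>_sym[OF ij] by (simp add: a_def)
    also have "\<dots> = C i j * C j i" using \<kappa>_pos[OF ij(1)] \<kappa>_pos[OF ij(2)] by (simp add: x_def)
    also have "\<dots> \<ge> 1"
    proof -
      have "1 \<le> (- C i j) * (- C j i)"
        using mult_mono[of 1 "- C i j" 1 "- C j i"] adj_neg[OF that] adj_neg[of j i] that adj_sym[of i j] by simp
      then have "1 \<le> C i j * C j i" by simp
      then show ?thesis by (metis of_int_1_le_iff of_int_mult)
    qed
    finally have sq: "1 \<le> a i j * a i j" .
    have "a i j \<le> 0"
      using adj_neg[OF that] \<kappa>_pos[OF ij(1)] \<kappa>_pos[OF ij(2)]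
      by (simp add: a_def x_def mult_nonneg_nonpos mult_nonpos_nonneg divide_nonpos_pos)
    then show ?thesis using sq mult_left_mono[of "- a i j" 1 "- a i j"] by (cases "- a i j \<le> 1") auto
  qed
  have "0 < (\<Sum>i\<in>I. \<Sum>j\<in>I. a i j)"
    unfolding a_def by (rule positive_definite) (use n_pos \<kappa>_pos[of 1] in \<open>auto simp: x_def intro!: bexI[of _ 1]\<close>)
  also have "\<dots> = (\<Sum>p\<in>I \<times> I. a (fst p) (snd p))" by (simp add: sum.cartesian_product case_prod_beta)
  also have "\<dots> = (\<Sum>p\<in>(\<lambda>i. (i, i)) ` I \<union> ?E. a (fst p) (snd p))"
    by (rule sum.mono_neutral_right) (auto simp: dynkin_edges_def a_def)
  also have "\<dots> = (\<Sum>p\<in>(\<lambda>i. (i, i)) ` I. a (fst p) (snd p)) + (\<Sum>p\<in>?E. a (fst p) (snd p))"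
    by (rule sum.union_disjoint) (use fin in \<open>auto simp: dynkin_edges_def\<close>)
  also have "(\<Sum>p\<in>(\<lambda>i. (i, i)) ` I. a (fst p) (snd p)) = 2 * n"
    by (subst sum.reindex) (auto simp: inj_on_def diag)
  also have "(\<Sum>p\<in>?E. a (fst p) (snd p)) \<le> (\<Sum>p\<in>?E. - 1)"
    by (rule sum_mono) (use edge in \<open>auto simp: edges_iff\<close>)
  finally show ?thesis by simp
qed

text \<open>The diagram is a tree. Joining every vertex other than 1 to a parent one step closer to
  1 uses \<open>2 * n - 2\<close> directed edges; an edge between vertices at equal distance would
  add two more and contradict \<open>card_edges\<close>. So the distances at the ends of an edge
  differ by exactly one.\<close>

lemma dist_parity:
  assumes "adj a b"
  shows "odd (ddist 1 a + ddist 1 b)"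
proof -
  have one: "1 \<in> I" using n_pos by simp
  have ab: "a \<in> I" "b \<in> I" "a \<noteq> b" using assms by (auto simp: adj_def)
  have "ddist 1 a \<noteq> ddist 1 b"
  proof
    assume eq: "ddist 1 a = ddist 1 b"
    obtain p where p: "\<And>j. j \<in> I - {1} \<Longrightarrow> adj (p j) j \<and> Suc (ddist 1 (p j)) = ddist 1 j"
      using dist_parent[OF one] by (metis DiffE singletonI)
    define P1 where "P1 = (\<lambda>j. (j, p j)) ` (I - {1})"
    define P2 where "P2 = (\<lambda>j. (p j, j)) ` (I - {1})"
    have "card P1 = n - 1" "card P2 = n - 1" using one
      by (auto simp: P1_def P2_def card_image inj_on_def)
    moreover have fin: "finite P1" "finite P2" by (simp_all add: P1_def P2_def)
    moreover have "P1 \<inter> P2 = {}"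
    proof -
      have False if "j \<in> I - {1}" "j' \<in> I - {1}" "j = p j'" "p j = j'" for j j'
        using p[OF that(1)] p[OF that(2)] that(3,4) by simp
      then show ?thesis unfolding P1_def P2_def by blast
    qed
    ultimately have "card (P1 \<union> P2) = 2 * n - 2" by (simp add: card_Un_disjoint)
    moreover have "(P1 \<union> P2) \<inter> {(a, b), (b, a)} = {}"
    proof -
      have False if "j \<in> I - {1}" "{j, p j} = {a, b}" for j
        using p[OF that(1)] that(2) eq by (auto simp: doubleton_eq_iff)
      then show ?thesis unfolding P1_def P2_def by blast
    qed
    ultimately have "card (P1 \<union> P2 \<union> {(a, b), (b, a)}) = 2 * n"
      using fin ab n_pos by (subst card_Un_disjoint) auto
    moreover have "P1 \<union> P2 \<union> {(a, b), (b, a)} \<subseteq> dynkin_edges n C"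
    proof -
      have "(j, p j) \<in> dynkin_edges n C \<and> (p j, j) \<in> dynkin_edges n C" if "j \<in> I - {1}" for j
        using p[OF that] adj_sym edges_iff by blast
      moreover have "(a, b) \<in> dynkin_edges n C \<and> (b, a) \<in> dynkin_edges n C"
        using assms adj_sym edges_iff by blast
      ultimately show ?thesis unfolding P1_def P2_def by blast
    qed
    moreover have "finite (dynkin_edges n C)"
      by (rule finite_subset[of _ "I \<times> I"]) (auto simp: dynkin_edges_def)
    ultimately have "2 * n \<le> card (dynkin_edges n C)" by (metis card_mono)
    then show False using card_edges by simp
  qed
  moreover have "ddist 1 a \<le> ddist 1 b + 1" "ddist 1 b \<le> ddist 1 a + 1"
    using dist_adj_le[OF one] assms adj_sym by auto
  ultimately have "ddist 1 a = Suc (ddist 1 b) \<or> ddist 1 b = Suc (ddist 1 a)" by linarith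
  then show ?thesis by auto
qed

section \<open>The symmetric form of the Cartan matrix\<close>

definition Bf :: "(nat \<Rightarrow> real) \<Rightarrow> (nat \<Rightarrow> real) \<Rightarrow> real" where
  "Bf x y = (\<Sum>i\<in>I. \<Sum>j\<in>I. \<kappa> i * C i j * x i * y j)"

lemma Bf_sym: "Bf x y = Bf y x"
proof -
  have "Bf x y = (\<Sum>j\<in>I. \<Sum>i\<in>I. \<kappa> i * C i j * x i * y j)" unfolding Bf_def by (rule sum.swap)
  also have "\<dots> = Bf y x" unfolding Bf_def using \<kappa>_sym by (intro sum.cong refl) (auto simp: mult_ac)
  finally show ?thesis .
qed

lemma Bf_diff: "Bf (\<lambda>i. x i - y i) (\<lambda>i. x i - y i) = Bf x x - 2 * Bf x y + Bf y y"
proof -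
  have "Bf (\<lambda>i. x i - y i) (\<lambda>i. x i - y i) = Bf x x - Bf x y - Bf y x + Bf y y"
    unfolding Bf_def by (simp add: algebra_simps sum.distrib sum_subtractf)
  then show ?thesis using Bf_sym[of y x] by simp
qed

lemma Bf_nonneg: "Bf x x \<ge> 0"
proof (cases "\<exists>i\<in>I. x i \<noteq> 0")
  case True
  then show ?thesis using positive_definite[of x] by (simp add: Bf_def)
next
  case False
  then show ?thesis by (simp add: Bf_def)
qed

text \<open>Riesz representation for a definite form. It provides \<open>rho\<close> and the
  classical weight of a monomial as vectors in simple-root coordinates.\<close>

lemma Bf_represent: "\<exists>z. \<forall>y. Bf z y = (\<Sum>i\<in>I. \<phi> i * y i)"
proof -
  have "\<exists>z. \<forall>t\<in>I. (\<Sum>j\<in>I. \<kappa> t * C t j * z j) = \<phi> t"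
    by (rule positive_definite_solvable) (use \<kappa>_sym positive_definite in auto)
  then obtain z where z: "\<And>t. t \<in> I \<Longrightarrow> (\<Sum>j\<in>I. \<kappa> t * C t j * z j) = \<phi> t" by blast
  have "Bf y z = (\<Sum>i\<in>I. \<phi> i * y i)" for y
  proof -
    have "Bf y z = (\<Sum>i\<in>I. y i * (\<Sum>j\<in>I. \<kappa> i * C i j * z j))"
      unfolding Bf_def by (simp add: sum_distrib_left mult_ac)
    also have "\<dots> = (\<Sum>i\<in>I. \<phi> i * y i)" by (intro sum.cong refl) (subst z, simp_all)
    finally show ?thesis .
  qed
  then show ?thesis using Bf_sym by metis
qed

lemma C_product_le_3:
  assumes "i \<in> I" "j \<in> I" "i \<noteq> j"
  shows "C i j * C j i \<le> 3"
proof -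
  \<comment> \<open>With the entry 2 at \<open>j\<close>, this entry at \<open>i\<close> minimises
    the form; the value there is \<open>2 * \<kappa> j * (4 - C i j * C j i)\<close>.\<close>
  let ?y = "\<lambda>k. if k = i then - real_of_int (C i j) else if k = j then 2 else 0"
  have "0 < (\<Sum>a\<in>I. \<Sum>b\<in>I. \<kappa> a * C a b * ?y a * ?y b)"
    by (rule positive_definite) (use assms in \<open>auto intro!: bexI[of _ j]\<close>)
  also have "\<dots> = (\<Sum>a\<in>{i, j}. \<Sum>b\<in>{i, j}. \<kappa> a * C a b * ?y a * ?y b)"
    by (intro sum.mono_neutral_cong_right ballI) (use assms in auto)
  also have "\<dots> = 2 * \<kappa> i * C i j * C i j - 2 * (\<kappa> i * C i j) * C i j - 2 * (\<kappa> j * C j i) * C i j + 8 * \<kappa> j"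
    using assms C_diag[OF assms(1)] C_diag[OF assms(2)] by (simp add: algebra_simps)
  also have "\<dots> = 2 * \<kappa> j * (4 - real_of_int (C i j * C j i))"
    by (simp add: algebra_simps)
  finally have "real_of_int (C i j * C j i) < 4"
    using \<kappa>_pos[OF assms(2)] by (simp add: zero_less_mult_iff)
  then show ?thesis by linarith
qed

lemma adj_cases:
  assumes "adj i j"
  shows "C i j = -1 \<and> C j i \<in> {-1, -2, -3} \<or> C j i = -1 \<and> C i j \<in> {-1, -2, -3}"
proof -
  define x y where "x = - C i j" and "y = - C j i"
  have "x \<ge> 1" "y \<ge> 1" using adj_neg[OF assms] adj_neg[of j i] assms adj_sym by (auto simp: x_def y_def)
  moreover have xy: "x * y \<le> 3" using C_product_le_3[of i j] assms by (auto simp: adj_def x_def y_def)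
  moreover have "x \<le> 3" "y \<le> 3"
    using order_trans[OF _ xy, of x] order_trans[OF _ xy, of y] mult_left_mono[of 1 y x]
      mult_right_mono[of 1 x y] \<open>x \<ge> 1\<close> \<open>y \<ge> 1\<close> by simp_all
  ultimately have "x \<in> {1, 2, 3}" "y \<in> {1, 2, 3}" by auto
  then have "x = 1 \<and> y \<in> {1, 2, 3} \<or> y = 1 \<and> x \<in> {1, 2, 3}" using xy by auto
  then show ?thesis by (auto simp: x_def y_def)
qed

end

section \<open>The inverse of \<open>C(t)\<close> and the commutation exponents\<close>

lemma mform_sum_right: "mform N m (\<Sum>x\<in>A. g x) = (\<Sum>x\<in>A. mform N m (g x))"
  by (induction A rule: infinite_finite_induct) (simp_all add: mform_add_right)

context cartan_data
begin

definition Aoff :: "nat \<Rightarrow> nat \<Rightarrow> int" where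
  "Aoff i j = (if i = j then 0 else C i j)"

text \<open>Since \<open>C(t) = t\<^sup>-\<^sup>1 + A + t\<close>, the coefficients of \<open>C(t)\<^sup>-\<^sup>1\<close> obey a three-term recursion.\<close>

fun inv_coeff :: "nat \<Rightarrow> nat \<Rightarrow> nat \<Rightarrow> int" where
  "inv_coeff 0 i j = 0"
| "inv_coeff (Suc 0) i j = (if i = j then 1 else 0)"
| "inv_coeff (Suc (Suc u)) i j = - (\<Sum>k\<in>I. Aoff i k * inv_coeff (Suc u) k j) - inv_coeff u i j"

text \<open>Each coefficient matrix is a polynomial in \<open>Aoff\<close> and hence commutes with
  it. This makes the right inverse of \<open>C(t)\<close> a left inverse too.\<close>

lemma inv_coeff_commute:
  "i \<in> I \<Longrightarrow> j \<in> I \<Longrightarrow> (\<Sum>k\<in>I. Aoff i k * inv_coeff u k j) = (\<Sum>k\<in>I. inv_coeff u i k * Aoff k j)"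
proof (induction u arbitrary: i j rule: induct_nat_012)
  case 1
  then show ?case by (simp add: if_distrib[of "\<lambda>x. _ * x"] if_distrib[of "\<lambda>x. x * _"] cong: if_cong)
next
  case (ge2 u)
  have "(\<Sum>k\<in>I. Aoff i k * inv_coeff (Suc (Suc u)) k j) =
      - (\<Sum>k\<in>I. Aoff i k * (\<Sum>l\<in>I. Aoff k l * inv_coeff (Suc u) l j)) - (\<Sum>k\<in>I. Aoff i k * inv_coeff u k j)"
    by (simp add: right_diff_distrib sum_subtractf sum_negf)
  also have "(\<Sum>k\<in>I. Aoff i k * (\<Sum>l\<in>I. Aoff k l * inv_coeff (Suc u) l j)) =
      (\<Sum>k\<in>I. Aoff i k * (\<Sum>l\<in>I. inv_coeff (Suc u) k l * Aoff l j))"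
    by (intro sum.cong refl arg_cong2[where f = "(*)"] ge2.IH(2)) (use ge2.prems in auto)
  also have "\<dots> = (\<Sum>l\<in>I. (\<Sum>k\<in>I. Aoff i k * inv_coeff (Suc u) k l) * Aoff l j)"
    unfolding sum_distrib_left sum_distrib_right by (subst sum.swap) (simp add: mult.assoc)
  also have "(\<Sum>k\<in>I. Aoff i k * inv_coeff u k j) = (\<Sum>k\<in>I. inv_coeff u i k * Aoff k j)"
    by (rule ge2.IH(1)) (use ge2.prems in auto)
  also have "- (\<Sum>l\<in>I. (\<Sum>k\<in>I. Aoff i k * inv_coeff (Suc u) k l) * Aoff l j) - (\<Sum>k\<in>I. inv_coeff u i k * Aoff k j) =
      (\<Sum>k\<in>I. inv_coeff (Suc (Suc u)) i k * Aoff k j)"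
    by (simp add: left_diff_distrib sum_subtractf sum_negf)
  finally show ?case .
qed simp

text \<open>\<open>D\<close> times \<open>Aoff\<close> is symmetric, hence so is \<open>D\<close>
  times every polynomial in \<open>Aoff\<close>. Antisymmetry of the commutation exponents rests on
  this.\<close>

lemma inv_coeff_symmetric:
  "i \<in> I \<Longrightarrow> j \<in> I \<Longrightarrow> d i * inv_coeff u i j = d j * inv_coeff u j i"
proof (induction u arbitrary: i j rule: induct_nat_012)
  case (ge2 u)
  have "d i * (\<Sum>k\<in>I. Aoff i k * inv_coeff (Suc u) k j) = (\<Sum>k\<in>I. Aoff k i * (d k * inv_coeff (Suc u) k j))"
    unfolding sum_distrib_left
  proof (intro sum.cong refl)
    fix k assume "k \<in> I"
    then have "d i * Aoff i k = d k * Aoff k i" using d_sym[of i k] ge2.prems by (auto simp: Aoff_def)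
    then show "d i * (Aoff i k * inv_coeff (Suc u) k j) = Aoff k i * (d k * inv_coeff (Suc u) k j)"
      by (metis mult.assoc mult.commute)
  qed
  also have "\<dots> = (\<Sum>k\<in>I. Aoff k i * (d j * inv_coeff (Suc u) j k))"
    by (intro sum.cong refl arg_cong2[where f = "(*)"] ge2.IH(2)) (use ge2.prems in auto)
  also have "\<dots> = d j * (\<Sum>k\<in>I. inv_coeff (Suc u) j k * Aoff k i)"
    by (simp add: sum_distrib_left mult_ac)
  also have "(\<Sum>k\<in>I. inv_coeff (Suc u) j k * Aoff k i) = (\<Sum>k\<in>I. Aoff j k * inv_coeff (Suc u) k i)"
    by (rule inv_coeff_commute[symmetric]) (use ge2.prems in auto)
  finally show ?case using ge2.IH(1)[OF ge2.prems] by (simp add: right_diff_distrib)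
qed simp_all

definition inv_entry :: "nat \<Rightarrow> nat \<Rightarrow> int fls" where
  "inv_entry i j = fps_to_fls (Abs_fps (\<lambda>u. inv_coeff u i j))"

definition coeff :: "nat \<Rightarrow> nat \<Rightarrow> int \<Rightarrow> int" where
  "coeff i j u = (if u < 0 then 0 else inv_coeff (nat u) i j)"

lemma nth_inv_entry: "fls_nth (inv_entry i j) u = coeff i j u"
  by (simp add: inv_entry_def coeff_def)

lemma coeff_rec:
  "coeff i j (u - 1) + coeff i j (u + 1) + (\<Sum>k\<in>I. Aoff i k * coeff k j u) = (if i = j \<and> u = 0 then 1 else 0)"
proof -
  consider "u < -1" | "u = -1" | "u = 0" | "u > 0" by linarith
  then show ?thesis
  proof cases
    case 4
    then obtain m where u: "u = int (Suc m)" using zero_less_imp_eq_int by (metis gr0_conv_Suc)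
    have "nat (u - 1) = m" "nat u = Suc m" "nat (u + 1) = Suc (Suc m)" using u by auto
    then show ?thesis using 4 by (simp add: coeff_def)
  qed (simp_all add: coeff_def)
qed

lemma coeff_rec':
  assumes "i \<in> I" "j \<in> I"
  shows "coeff i j (u - 1) + coeff i j (u + 1) + (\<Sum>k\<in>I. coeff i k u * Aoff k j) = (if i = j \<and> u = 0 then 1 else 0)"
proof -
  have "(\<Sum>k\<in>I. coeff i k u * Aoff k j) = (\<Sum>k\<in>I. Aoff i k * coeff k j u)"
    using inv_coeff_commute[OF assms, of "nat u"] by (cases "u < 0") (simp_all add: coeff_def)
  then show ?thesis using coeff_rec by simp
qed

lemma nth_times_Ct:
  fixes f :: "int fls"
  shows "fls_nth (fls_X * f + fls_X_inv * f) u = fls_nth f (u - 1) + fls_nth f (u + 1)"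
  by (simp add: fls_X_times_conv_shift fls_X_inv_times_conv_shift)

lemma Ct_sum:
  assumes "a < n" "b < n"
  shows "(\<Sum>c<n. Ct_mat n C $$ (a, c) * inv_entry (Suc c) (Suc b)) = (if a = b then 1 else 0)"
    and "(\<Sum>c<n. inv_entry (Suc a) (Suc c) * Ct_mat n C $$ (c, b)) = (if a = b then 1 else 0)"
proof -
  have split: "Ct_mat n C $$ (a, c) = (if a = c then fls_X + fls_X_inv else 0) + of_int (Aoff (Suc a) (Suc c))"
    if "a < n" "c < n" for a c using that by (simp add: Ct_mat_def Aoff_def)
  have nth_of_int: "fls_nth (of_int z * f) u = z * fls_nth f u" for z u and f :: "int fls"
    by (simp add: fls_of_int)
  have idx: "(\<Sum>c<n. g (Suc c)) = (\<Sum>k\<in>I. g k)" for g :: "nat \<Rightarrow> int"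
    by (rule sum.reindex_bij_witness[of _ "\<lambda>k. k - 1" Suc]) auto
  have one: "fls_nth (if a = b then 1 else 0 :: int fls) u = (if Suc a = Suc b \<and> u = 0 then 1 else 0)" for u
    by simp
  show "(\<Sum>c<n. Ct_mat n C $$ (a, c) * inv_entry (Suc c) (Suc b)) = (if a = b then 1 else 0)"
  proof (rule fls_eqI)
    fix u
    have expand: "(\<Sum>c<n. Ct_mat n C $$ (a, c) * inv_entry (Suc c) (Suc b)) =
        (fls_X * inv_entry (Suc a) (Suc b) + fls_X_inv * inv_entry (Suc a) (Suc b)) +
        (\<Sum>c<n. of_int (Aoff (Suc a) (Suc c)) * inv_entry (Suc c) (Suc b))"
    proof -
    have "(\<Sum>c<n. Ct_mat n C $$ (a, c) * inv_entry (Suc c) (Suc b)) =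
        (\<Sum>c<n. (if c = a then (fls_X + fls_X_inv) * inv_entry (Suc c) (Suc b) else 0) +
          of_int (Aoff (Suc a) (Suc c)) * inv_entry (Suc c) (Suc b))"
      by (intro sum.cong refl) (use assms in \<open>auto simp: split distrib_right\<close>)
    also have "\<dots> = (fls_X * inv_entry (Suc a) (Suc b) + fls_X_inv * inv_entry (Suc a) (Suc b)) +
        (\<Sum>c<n. of_int (Aoff (Suc a) (Suc c)) * inv_entry (Suc c) (Suc b))"
      using assms by (simp add: sum.distrib distrib_right)
    finally show ?thesis .
    qed
    have "fls_nth (\<Sum>c<n. Ct_mat n C $$ (a, c) * inv_entry (Suc c) (Suc b)) u = coeff (Suc a) (Suc b) (u - 1) + coeff (Suc a) (Suc b) (u + 1) +
        (\<Sum>k\<in>I. Aoff (Suc a) k * coeff k (Suc b) u)"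
      unfolding expand by (simp only: fls_plus_nth nth_times_Ct nth_inv_entry fls_nth_sum nth_of_int flip: idx)
        (simp add: fls_X_times_conv_shift fls_X_inv_times_conv_shift nth_inv_entry)
    also have "\<dots> = (if Suc a = Suc b \<and> u = 0 then 1 else 0)" by (rule coeff_rec)
    finally show "fls_nth (\<Sum>c<n. Ct_mat n C $$ (a, c) * inv_entry (Suc c) (Suc b)) u = fls_nth (if a = b then 1 else 0) u"
      unfolding one .
  qed
  show "(\<Sum>c<n. inv_entry (Suc a) (Suc c) * Ct_mat n C $$ (c, b)) = (if a = b then 1 else 0)"
  proof (rule fls_eqI)
    fix u
    have expand: "(\<Sum>c<n. inv_entry (Suc a) (Suc c) * Ct_mat n C $$ (c, b)) =
        (fls_X * inv_entry (Suc a) (Suc b) + fls_X_inv * inv_entry (Suc a) (Suc b)) +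
        (\<Sum>c<n. of_int (Aoff (Suc c) (Suc b)) * inv_entry (Suc a) (Suc c))"
    proof -
    have "(\<Sum>c<n. inv_entry (Suc a) (Suc c) * Ct_mat n C $$ (c, b)) =
        (\<Sum>c<n. (if c = b then (fls_X + fls_X_inv) * inv_entry (Suc a) (Suc c) else 0) +
          of_int (Aoff (Suc c) (Suc b)) * inv_entry (Suc a) (Suc c))"
    proof (intro sum.cong refl)
      fix c assume "c \<in> {..<n}"
      then have "Ct_mat n C $$ (c, b) = (if c = b then fls_X + fls_X_inv else 0) + of_int (Aoff (Suc c) (Suc b))"
        using assms by (intro split) auto
      then show "inv_entry (Suc a) (Suc c) * Ct_mat n C $$ (c, b) =
          (if c = b then (fls_X + fls_X_inv) * inv_entry (Suc a) (Suc c) else 0) +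
          of_int (Aoff (Suc c) (Suc b)) * inv_entry (Suc a) (Suc c)"
        by (simp add: algebra_simps)
    qed
    also have "\<dots> = (fls_X * inv_entry (Suc a) (Suc b) + fls_X_inv * inv_entry (Suc a) (Suc b)) +
        (\<Sum>c<n. of_int (Aoff (Suc c) (Suc b)) * inv_entry (Suc a) (Suc c))"
      using assms by (simp add: sum.distrib distrib_right)
    finally show ?thesis .
    qed
    have "fls_nth (\<Sum>c<n. inv_entry (Suc a) (Suc c) * Ct_mat n C $$ (c, b)) u = coeff (Suc a) (Suc b) (u - 1) + coeff (Suc a) (Suc b) (u + 1) +
        (\<Sum>k\<in>I. coeff (Suc a) k u * Aoff k (Suc b))"
      unfolding expand by (simp only: fls_plus_nth nth_times_Ct nth_inv_entry fls_nth_sum nth_of_int flip: idx)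
        (simp add: fls_X_times_conv_shift fls_X_inv_times_conv_shift nth_inv_entry mult.commute)
    also have "\<dots> = (if Suc a = Suc b \<and> u = 0 then 1 else 0)"
      by (rule coeff_rec') (use assms in auto)
    finally show "fls_nth (\<Sum>c<n. inv_entry (Suc a) (Suc c) * Ct_mat n C $$ (c, b)) u = fls_nth (if a = b then 1 else 0) u"
      unfolding one .
  qed
qed

lemma Ct_inv_eq: "Ct_inv n C = mat n n (\<lambda>(a, b). inv_entry (Suc a) (Suc b))"
proof -
  let ?M = "mat n n (\<lambda>(a, b). inv_entry (Suc a) (Suc b))"
  have Ct: "Ct_mat n C \<in> carrier_mat n n" by (simp add: Ct_mat_def)
  have right: "Ct_mat n C * ?M = 1\<^sub>m n"
  proof (rule eq_matI)
    fix a b assume "a < dim_row (1\<^sub>m n)" "b < dim_col (1\<^sub>m n)"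
    then have ab: "a < n" "b < n" by simp_all
    have "(Ct_mat n C * ?M) $$ (a, b) = (\<Sum>c<n. Ct_mat n C $$ (a, c) * inv_entry (Suc c) (Suc b))"
      using ab Ct by (simp add: scalar_prod_def lessThan_atLeast0)
    then show "(Ct_mat n C * ?M) $$ (a, b) = 1\<^sub>m n $$ (a, b)" using ab Ct_sum(1) by simp
  qed (use Ct in auto)
  have left: "?M * Ct_mat n C = 1\<^sub>m n"
  proof (rule eq_matI)
    fix a b assume "a < dim_row (1\<^sub>m n)" "b < dim_col (1\<^sub>m n)"
    then have ab: "a < n" "b < n" by simp_all
    have "(?M * Ct_mat n C) $$ (a, b) = (\<Sum>c<n. inv_entry (Suc a) (Suc c) * Ct_mat n C $$ (c, b))"
      using ab Ct by (simp add: scalar_prod_def lessThan_atLeast0)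
    then show "(?M * Ct_mat n C) $$ (a, b) = 1\<^sub>m n $$ (a, b)" using ab Ct_sum(2) by simp
  qed (use Ct in auto)
  show ?thesis unfolding Ct_inv_def
  proof (rule the_equality)
    show "?M \<in> carrier_mat n n \<and> inverts_mat (Ct_mat n C) ?M \<and> inverts_mat ?M (Ct_mat n C)"
      using left right Ct by (simp add: inverts_mat_def)
  next
    fix M assume M: "M \<in> carrier_mat n n \<and> inverts_mat (Ct_mat n C) M \<and> inverts_mat M (Ct_mat n C)"
    have "?M = 1\<^sub>m n * ?M" by simp
    also have "1\<^sub>m n = M * Ct_mat n C" using M by (auto simp: inverts_mat_def)
    also have "(M * Ct_mat n C) * ?M = M * (Ct_mat n C * ?M)"
      by (rule assoc_mult_mat) (use M Ct in auto)
    also have "\<dots> = M" using right_mult_one_mat[OF conjunct1[OF M]] by (simp only: right)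
    finally show "M = ?M" by simp
  qed
qed

lemma btilde_eq: "i \<in> I \<Longrightarrow> j \<in> I \<Longrightarrow> btilde n C d i j u = d i * coeff i j u"
  by (auto simp: btilde_def Ct_inv_eq nth_inv_entry)

lemma btilde_sym: "btilde n C d i j u = btilde n C d j i u"
proof (cases "i \<in> I \<and> j \<in> I")
  case True
  then show ?thesis using inv_coeff_symmetric[of i j "nat u"] by (simp add: btilde_eq coeff_def)
next
  case False
  then show ?thesis by (auto simp: btilde_def)
qed

abbreviation "N \<equiv> Nexp n C d"

lemma N_antisym: "N x y = - N y x"
proof (cases x, cases y)
  fix i p j s assume "x = (i, p)" "y = (j, s)"
  then show ?thesis by (simp add: Nexp_def btilde_sym[of i j])
qed

abbreviation B :: "vertex \<Rightarrow> monom" where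
  "B x \<equiv> Bmonom n C (fst x) (snd x)"

abbreviation X :: "vertex \<Rightarrow> monom" where
  "X x \<equiv> Poly_Mapping.single x 1"

lemma neighbours_eq: "j \<in> I \<Longrightarrow> {k \<in> I. dynkin_dist n C j k = 1} = {k. adj j k}"
  using dist_eq_1_iff by (auto simp: adj_def)

text \<open>Summing against a \<open>B\<close> multiplies the series of the \<open>btilde\<close> by
  a column of \<open>C(t)\<close>. These series are the entries of \<open>D\<close> times the
  inverse of \<open>C(t)\<close>, so the combination \<open>G\<close> is concentrated at 0, where it
  is \<open>d i\<close> if \<open>i = j\<close>. At each of \<open>p = s + 1\<close> and
  \<open>p = s - 1\<close> two of the four shifts in \<open>Nexp\<close> hit 0, whence the factor
  2.\<close>

lemma mform_X_Bmonom:
  assumes i: "i \<in> I" and j: "j \<in> I"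
  shows "mform N (X (i, p)) (Bmonom n C j s) =
    (if i = j then 2 * d i * (of_bool (p = s + 1) - of_bool (p = s - 1)) else 0)"
proof -
  define b where "b k u = d i * coeff i k u" for k u
  define G where "G u = b j (u - 1) + b j (u + 1) + (\<Sum>k\<in>I. b k u * Aoff k j)" for u
  have G: "G u = (if i = j \<and> u = 0 then d i else 0)" for u
  proof -
    have "G u = d i * (coeff i j (u - 1) + coeff i j (u + 1) + (\<Sum>k\<in>I. coeff i k u * Aoff k j))"
      unfolding G_def b_def by (simp add: distrib_left sum_distrib_left mult.assoc)
    then show ?thesis unfolding coeff_rec'[OF assms] by simp
  qed
  have Nb: "N (i, p) (k, s) = b k (p - s - 1) - b k (s - p - 1) - b k (p - s + 1) + b k (s - p + 1)"
    if "k \<in> I" for k s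
    using that i by (simp add: Nexp_def btilde_eq b_def)
  have "(\<Sum>k\<in>{k. adj j k}. C k j * N (i, p) (k, s)) = (\<Sum>k\<in>I. N (i, p) (k, s) * Aoff k j)"
  proof (rule sum.mono_neutral_cong_left)
    show "\<forall>k\<in>I - {k. adj j k}. N (i, p) (k, s) * Aoff k j = 0"
      using j C_eq_0_iff[OF j] by (auto simp: adj_def Aoff_def)
  qed (auto simp: adj_def Aoff_def)
  also have "\<dots> = (\<Sum>k\<in>I. b k (p - s - 1) * Aoff k j) - (\<Sum>k\<in>I. b k (s - p - 1) * Aoff k j)
      - (\<Sum>k\<in>I. b k (p - s + 1) * Aoff k j) + (\<Sum>k\<in>I. b k (s - p + 1) * Aoff k j)"
    by (simp add: Nb algebra_simps sum.distrib sum_subtractf)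
  finally have S: "(\<Sum>k\<in>{k. adj j k}. C k j * N (i, p) (k, s)) = \<dots>" .
  have "mform N (X (i, p)) (Bmonom n C j s) =
      N (i, p) (j, s - 1) + N (i, p) (j, s + 1) + (\<Sum>k\<in>{k. adj j k}. C k j * N (i, p) (k, s))"
    unfolding Bmonom_def neighbours_eq[OF j]
    by (simp add: mform_add_right mform_sum_right mform_single)
  also have "\<dots> = G (p - s - 1) - G (s - p - 1) - G (p - s + 1) + G (s - p + 1)"
    unfolding S G_def by (simp add: Nb[OF j] algebra_simps)
  also have "\<dots> = (if i = j then 2 * d i * (of_bool (p = s + 1) - of_bool (p = s - 1)) else 0)"
    unfolding G by auto
  finally show ?thesis .
qed

end

section \<open>The quantum torus\<close>

abbreviation "lookup \<equiv> Poly_Mapping.lookup"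
abbreviation "keys \<equiv> Poly_Mapping.keys"
abbreviation "single \<equiv> Poly_Mapping.single"

lemma mform_sum_left: "mform N (\<Sum>x\<in>A. g x) m = (\<Sum>x\<in>A. mform N (g x) m)"
  by (induction A rule: infinite_finite_induct) (simp_all add: mform_add_left)

lemma mform_minus_right: "mform N m (- m') = - mform N m m'"
  using mform_add_right[of N m m' "- m'"] by simp

lemma mform_diff_right: "mform N m (m1 - m2) = mform N m m1 - mform N m m2"
  using mform_add_right[of N m "m1 - m2" m2] by simp

lemma mform_diff_left: "mform N (m1 - m2) m = mform N m1 m - mform N m2 m"
  using mform_add_left[of N "m1 - m2" m2 m] by simp

lemma mform_single_left: "mform N (single y c) m = c * mform N (single y 1) m"
  by (simp add: mform_superset[of "{y}" "keys m"] sum_distrib_left mult.assoc)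

lemma lookup_qscalar_times: "lookup (qtimes N (qscalar c) f) m = c * lookup f m"
  by (induction f rule: poly_mapping_additive_induct)
    (auto simp: qscalar_single qtimes_add_right lookup_add distrib_left lookup_single when_def)

lemma qscalar_times_assoc: "qtimes N (qscalar a) (qtimes N (qscalar b) f) = qtimes N (qscalar (a * b)) f"
  by (rule poly_mapping_eqI) (simp add: lookup_qscalar_times mult.assoc)

lemma qscalar_left_commute: "qtimes N f (qtimes N (qscalar c) g) = qtimes N (qscalar c) (qtimes N f g)"
  by (metis qtimes_assoc qscalar_central)

lemma lookup_single_times:
  "lookup (qtimes N (single x c) f) m = vpow (mform N x (m - x)) * c * lookup f (m - x)"
  by (induction f rule: poly_mapping_additive_induct)
    (auto simp: qtimes_single qtimes_add_right lookup_add distrib_left lookup_single when_def algebra_simps)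

lemma lookup_qtimes:
  assumes "finite A" "finite A'" "keys f \<subseteq> A" "keys g \<subseteq> A'"
  shows "lookup (qtimes N f g) m = (\<Sum>a\<in>A. \<Sum>b\<in>A'.
     if a + b = m then vpow (mform N a b) * lookup f a * lookup g b else 0)"
  by (subst qtimes_superset[OF assms]) (simp add: lookup_sum lookup_single when_def)

lemma keys_qtimes: "m \<in> keys (qtimes N f g) \<Longrightarrow> \<exists>a\<in>keys f. \<exists>b\<in>keys g. m = a + b"
proof -
  assume "m \<in> keys (qtimes N f g)"
  then have nz: "lookup (qtimes N f g) m \<noteq> 0" by (simp add: in_keys_iff)
  show ?thesis
  proof (rule ccontr)
    assume "\<not> ?thesis"
    then have "lookup (qtimes N f g) m = 0"
      unfolding lookup_qtimes[OF finite_keys finite_keys subset_refl subset_refl]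
      by (intro sum.neutral ballI) auto
    then show False using nz by simp
  qed
qed

lemma qtimes_sum_right: "qtimes N f (\<Sum>x\<in>A. g x) = (\<Sum>x\<in>A. qtimes N f (g x))"
  by (induction A rule: infinite_finite_induct) (simp_all add: qtimes_add_right)

lemma qscalar_minus_one: "qtimes N (qscalar (- 1)) f = - f"
  by (rule poly_mapping_eqI) (simp add: lookup_qscalar_times)

lemma qsubalgebra_scale: "f \<in> qsubalgebra N S \<Longrightarrow> qtimes N (qscalar c) f \<in> qsubalgebra N S"
  by (intro qsubalgebra.times qsubalgebra.scalar)

lemma qsubalgebra_zero: "0 \<in> qsubalgebra N S"
  using qsubalgebra.scalar[of 0 N S] by (simp add: qscalar_def)

lemma qsubalgebra_diff: "\<lbrakk>f \<in> qsubalgebra N S; g \<in> qsubalgebra N S\<rbrakk> \<Longrightarrow> f - g \<in> qsubalgebra N S"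
  using qsubalgebra.add[of f N S "- g"] qsubalgebra_scale[of g N S "- 1"] by (simp add: qscalar_minus_one)

lemma qsubalgebra_sum: "(\<And>x. x \<in> A \<Longrightarrow> g x \<in> qsubalgebra N S) \<Longrightarrow> (\<Sum>x\<in>A. g x) \<in> qsubalgebra N S"
  by (induction A rule: infinite_finite_induct) (auto simp: qsubalgebra_zero intro: qsubalgebra.add)

lemma vpow_unit: "vpow k * vpow (- k) = 1" "vpow (- k) * vpow k = 1"
  by (simp_all flip: vpow_add)

context cartan_data
begin

abbreviation qmult (infixl "\<star>" 70) where "f \<star> g \<equiv> qtimes N f g"

abbreviation Ki :: "nat \<Rightarrow> qtorus set" where "Ki \<equiv> Kiq n C d"

lemma mform_skew: "mform N a b = - mform N b a"
  by (rule mform_antisym) (rule N_antisym)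

lemma qtimes_one [simp]: "f \<star> qscalar 1 = f" and one_qtimes [simp]: "qscalar 1 \<star> f = f"
  using qscalar_one qscalar_central by metis+

lemma mform_self [simp]: "mform N m m = 0"
  using mform_skew[of m m] by simp

lemma Delta0_iff: "(i, p) \<in> Delta0 n C \<longleftrightarrow> i \<in> I \<and> even (p - int (dynkin_dist n C 1 i))"
  by (auto simp: Delta0_def mod_eq_dvd_iff)

lemma Delta0_color: "(i, p) \<in> Delta0 n C \<Longrightarrow> i \<in> I"
  by (simp add: Delta0_iff)

lemma Delta0_shift2: "(i, p) \<in> Delta0 n C \<Longrightarrow> (i, p + 2) \<in> Delta0 n C \<and> (i, p - 2) \<in> Delta0 n C"
  by (auto simp: Delta0_iff)

lemma Delta0_parity: "\<lbrakk>(i, p) \<in> Delta0 n C; (i, s) \<in> Delta0 n C\<rbrakk> \<Longrightarrow> even (p - s)"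
  by (auto simp: Delta0_iff)

lemma Delta0_adj:
  assumes "(i, p) \<in> Delta0 n C" "adj i j"
  shows "(j, p + 1) \<in> Delta0 n C" "(j, p - 1) \<in> Delta0 n C"
proof -
  have "odd (dynkin_dist n C 1 i + dynkin_dist n C 1 j)" by (rule dist_parity) (rule assms)
  moreover have "j \<in> I" using assms(2) by (simp add: adj_def)
  ultimately show "(j, p + 1) \<in> Delta0 n C" "(j, p - 1) \<in> Delta0 n C"
    using assms(1) by (auto simp: Delta0_iff)
qed

lemma lookup_B:
  assumes "j \<in> I"
  shows "lookup (Bmonom n C j s) (k, p) = (if k = j then of_bool (p = s - 1) + of_bool (p = s + 1)
    else if k \<in> I \<and> p = s then Aoff k j else 0)"
proof -
  have fin: "finite {k. adj j k}" by (rule finite_subset[of _ I]) (auto simp: adj_def)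
  have "lookup (Bmonom n C j s) (k, p) = of_bool (k = j \<and> p = s - 1) + of_bool (k = j \<and> p = s + 1) +
      (\<Sum>l\<in>{k. adj j k}. if l = k \<and> p = s then C l j else 0)"
    unfolding Bmonom_def fst_conv snd_conv neighbours_eq[OF assms] lookup_add lookup_sum
    by (auto simp: lookup_single when_def intro!: sum.cong)
  also have "(\<Sum>l\<in>{k. adj j k}. if l = k \<and> p = s then C l j else 0) = (if adj j k \<and> p = s then C k j else 0)"
    using fin by (cases "p = s") simp_all
  also have "\<dots> = (if k \<noteq> j \<and> k \<in> I \<and> p = s then Aoff k j else 0)"
    using assms C_eq_0_iff[of j k] by (auto simp: Aoff_def adj_def)
  finally show ?thesis by (auto simp: Aoff_def)
qed

lemma keys_B:
  assumes "(j, s - 1) \<in> Delta0 n C"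
  shows "keys (Bmonom n C j s) \<subseteq> Delta0 n C"
proof
  fix x assume x: "x \<in> keys (Bmonom n C j s)"
  obtain k p where [simp]: "x = (k, p)" by (cases x)
  have j: "j \<in> I" using assms by (rule Delta0_color)
  have "lookup (Bmonom n C j s) (k, p) \<noteq> 0" using x by (simp add: in_keys_iff)
  then have "k = j \<and> (p = s - 1 \<or> p = s + 1) \<or> k \<noteq> j \<and> k \<in> I \<and> p = s \<and> Aoff k j \<noteq> 0"
    unfolding lookup_B[OF j] of_bool_def by (simp split: if_splits)
  moreover have "adj j k" if "k \<noteq> j" "k \<in> I" "Aoff k j \<noteq> 0"
    using that j C_eq_0_iff[OF j that(2)] by (simp add: Aoff_def adj_def)
  moreover have "(j, s + 1) \<in> Delta0 n C" using assms by (simp add: Delta0_iff)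
  ultimately show "x \<in> Delta0 n C"
    using assms Delta0_adj(1)[OF assms] by auto
qed

lemma mform_B:
  assumes "keys m \<subseteq> I \<times> UNIV" "j \<in> I"
  shows "mform N m (Bmonom n C j s) = 2 * d j * (lookup m (j, s + 1) - lookup m (j, s - 1))"
proof -
  let ?B = "Bmonom n C j s"
  have one: "mform N (single x c) ?B = 2 * d j * c * (of_bool (x = (j, s + 1)) - of_bool (x = (j, s - 1)))"
    if "x \<in> I \<times> UNIV" for x c
    using that mform_X_Bmonom[of "fst x" j "snd x" s] assms(2)
    by (subst mform_single_left) (cases x, auto)
  have "mform N m ?B = mform N (\<Sum>x\<in>keys m. single x (lookup m x)) ?B" by (simp add: sum_single_lookup)
  also have "\<dots> = (\<Sum>x\<in>keys m. 2 * d j * lookup m x * (of_bool (x = (j, s + 1)) - of_bool (x = (j, s - 1))))"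
    unfolding mform_sum_left by (intro sum.cong refl one) (use assms in auto)
  also have "\<dots> = 2 * d j * (\<Sum>x\<in>keys m. (if x = (j, s + 1) then lookup m x else 0) - (if x = (j, s - 1) then lookup m x else 0))"
    unfolding sum_distrib_left by (intro sum.cong refl) auto
  also have "\<dots> = 2 * d j * (lookup m (j, s + 1) - lookup m (j, s - 1))"
    by (simp add: sum_subtractf in_keys_iff)
  finally show ?thesis .
qed

lemma keys_B_color: "j \<in> I \<Longrightarrow> keys (Bmonom n C j s) \<subseteq> I \<times> UNIV"
proof
  fix x assume "j \<in> I" "x \<in> keys (Bmonom n C j s)"
  moreover obtain k p where "x = (k, p)" by (cases x)
  ultimately show "x \<in> I \<times> UNIV" using lookup_B[of j s k p] by (auto simp: in_keys_iff split: if_splits)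
qed

lemma Delta0_sub: "Delta0 n C \<subseteq> I \<times> UNIV"
  by (auto simp: Delta0_def)

lemma keys_diff: "keys (a - b) \<subseteq> keys a \<union> keys (b :: monom)"
  using Poly_Mapping.keys_add[of a "- b"] by (simp add: keys_minus)

section \<open>Products of the \<open>B\<close>'s and their independence\<close>

definition Bs :: "vertex multiset \<Rightarrow> monom" where
  "Bs V = (\<Sum>x\<in>#V. B x)"

lemma Bs_empty [simp]: "Bs {#} = 0" and Bs_add_mset [simp]: "Bs (add_mset x V) = B x + Bs V"
  and Bs_union: "Bs (V + W) = Bs V + Bs W"
  by (simp_all add: Bs_def)

lemma lookup_Bs:
  assumes "set_mset V \<subseteq> I \<times> UNIV" "k \<in> I"
  shows "lookup (Bs V) (k, p) = int (count V (k, p + 1)) + int (count V (k, p - 1)) +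
    (\<Sum>j\<in>I. Aoff k j * int (count V (j, p)))"
  using assms(1)
proof (induction V)
  case (add x V)
  obtain j s where x: "x = (j, s)" by (cases x)
  have j: "j \<in> I" using add.prems x by auto
  have "(\<Sum>a\<in>I. Aoff k a * int (count (add_mset x V) (a, p))) =
      (\<Sum>a\<in>I. Aoff k a * int (count V (a, p)) + (if a = j then if p = s then Aoff k j else 0 else 0))"
    unfolding x by (intro sum.cong refl) (auto simp: algebra_simps)
  also have "\<dots> = (\<Sum>a\<in>I. Aoff k a * int (count V (a, p))) + (if p = s then Aoff k j else 0)"
    using j by (simp add: sum.distrib)
  finally have S: "(\<Sum>a\<in>I. Aoff k a * int (count (add_mset x V) (a, p))) = \<dots>" .
  show ?case unfolding S
    using add.IH add.prems lookup_B[OF j, of s k p] assms(2)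
    by (auto simp: x lookup_add Aoff_def)
qed simp

lemma lookup_Bs_outside:
  assumes "set_mset V \<subseteq> I \<times> UNIV" "k \<notin> I"
  shows "lookup (Bs V) (k, p) = 0"
  using assms
proof (induction V)
  case (add x V)
  then show ?case using lookup_B[of "fst x" "snd x" k p] by (auto simp: lookup_add)
qed simp

text \<open>Cancel the common part and let \<open>p\<close> be the leftmost column left over. A
  \<open>B\<close> of column \<open>s\<close> extends from \<open>s - 1\<close> to
  \<open>s + 1\<close>, so column \<open>p - 1\<close> sees only the \<open>B\<close>'s of column
  \<open>p\<close>; their multiplicities would agree although the remainders are disjoint.\<close>

lemma Bs_inject:
  assumes V: "set_mset V \<subseteq> I \<times> UNIV" and W: "set_mset W \<subseteq> I \<times> UNIV" and eq: "Bs V = Bs W"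
  shows "V = W"
proof (rule ccontr)
  assume neq: "V \<noteq> W"
  define V' W' where "V' = V - W" and "W' = W - V"
  have V': "set_mset V' \<subseteq> I \<times> UNIV" "set_mset W' \<subseteq> I \<times> UNIV"
    using V W by (auto simp: V'_def W'_def dest: in_diffD)
  have VW: "V = V' + (V \<inter># W)" "W = W' + (V \<inter># W)"
    unfolding V'_def W'_def by (rule multiset_eqI, simp add: min_def)+
  then have eq': "Bs V' = Bs W'" using eq by (metis Bs_union add_right_cancel)
  define P where "P = snd ` (set_mset V' \<union> set_mset W')"
  have "V' \<noteq> {#} \<or> W' \<noteq> {#}" using VW neq by auto
  then have P: "finite P" "P \<noteq> {}" by (auto simp: P_def)
  define p where "p = Min P"
  have pmin: "p \<le> s" if "(j, s) \<in># V' \<or> (j, s) \<in># W'" for j s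
    unfolding p_def using P that by (intro Min_le) (force simp: P_def)+
  have "p \<in> P" unfolding p_def using P by (rule Min_in)
  then obtain j where j: "(j, p) \<in># V' \<or> (j, p) \<in># W'" by (force simp: P_def)
  then have jI: "j \<in> I" using V' by auto
  have low: "count V' (k, s) = 0" "count W' (k, s) = 0" if "s < p" for k s
    using pmin[of k s] that by (simp_all flip: not_in_iff) (meson not_le)+
  have "lookup (Bs V') (j, p - 1) = int (count V' (j, p))" "lookup (Bs W') (j, p - 1) = int (count W' (j, p))"
    using lookup_Bs[OF V'(1) jI, of "p - 1"] lookup_Bs[OF V'(2) jI, of "p - 1"] low by simp_all
  then have "count V' (j, p) = count W' (j, p)" using eq' by simp
  then have "count V' (j, p) = 0 \<and> count W' (j, p) = 0" by (auto simp: V'_def W'_def)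
  then show False using j by (simp add: count_eq_zero_iff)
qed

lemma Bs_eq_0: "\<lbrakk>set_mset V \<subseteq> I \<times> UNIV; Bs V = 0\<rbrakk> \<Longrightarrow> V = {#}"
  using Bs_inject[of V "{#}"] by simp

section \<open>Monomials in the algebras \<open>\<K>\<^sub>i\<close>\<close>

definition idom :: "nat \<Rightarrow> monom \<Rightarrow> bool" where
  "idom i m \<longleftrightarrow> keys m \<subseteq> Delta0 n C \<and> (\<forall>p. lookup m (i, p) \<ge> 0)"

definition colorless :: "nat \<Rightarrow> monom \<Rightarrow> bool" where
  "colorless i m \<longleftrightarrow> keys m \<subseteq> Delta0 n C \<and> (\<forall>p. lookup m (i, p) = 0)"

lemma dominant_iff: "dominant n C m \<longleftrightarrow> keys m \<subseteq> Delta0 n C \<and> (\<forall>i\<in>I. idom i m)"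
proof (intro iffI conjI ballI)
  assume *: "keys m \<subseteq> Delta0 n C \<and> (\<forall>i\<in>I. idom i m)"
  have "lookup m x \<ge> 0" for x
  proof (cases "x \<in> keys m")
    case True
    then have "fst x \<in> I" using * Delta0_sub by force
    then show ?thesis using * by (cases x) (auto simp: idom_def)
  qed (simp add: in_keys_iff)
  then show "dominant n C m" using * by (simp add: dominant_def)
qed (auto simp: dominant_def idom_def)

text \<open>Models the monomials of a product of the generators of \<open>\<K>\<^sub>i\<close> with leading monomial \<open>a\<close>.\<close>

definition istep :: "nat \<Rightarrow> monom \<Rightarrow> monom \<Rightarrow> bool" where
  "istep i a m \<longleftrightarrow> idom i a \<and> (\<exists>W. set_mset W \<subseteq> {i} \<times> UNIV \<and>
     (\<forall>l. int (count W (i, l + 1)) \<le> lookup a (i, l)) \<and> m = a - Bs W)"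

text \<open>The defining generator of \<open>Ki i\<close> multiplied by \<open>q_i^(1/2)\<close>.
  The factor \<open>q_i^-1\<close> in front of the inverse of \<open>B\<close> cancels against the
  pairing of the variable with \<open>B\<close>, so both terms become bar-invariant
  monomials.\<close>

definition Gen :: "nat \<Rightarrow> int \<Rightarrow> qtorus" where
  "Gen i l = single (X (i, l)) 1 + single (X (i, l) - B (i, l + 1)) 1"

lemma Gen_in_K:
  assumes "(i, l) \<in> Delta0 n C"
  shows "Gen i l \<in> Ki i"
proof -
  have i: "i \<in> I" using assms by (rule Delta0_color)
  let ?g = "qtimes N (Xgen d (i, l)) (qscalar 1 + qtimes N (qscalar (vpow (- 2 * d i)))
                       (underline N d (- Bmonom n C i (l + 1))))"
  have XB: "mform N (X (i, l)) (Bmonom n C i (l + 1)) = - 2 * d i"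
    using mform_X_Bmonom[OF i i, of l "l + 1"] by simp
  have "?g \<in> Ki i"
    unfolding Kiq_def by (rule qsubalgebra.generator) (use assms in \<open>auto simp: Kiq_gens_def\<close>)
  then have "qscalar (vpow (d i)) \<star> ?g \<in> Ki i" unfolding Kiq_def by (rule qsubalgebra_scale)
  also have "qscalar (vpow (d i)) \<star> ?g = Gen i l"
    unfolding underline_eq_single[OF N_antisym] Xgen_def Gen_def
    by (simp add: qscalar_single qtimes_add_right qtimes_single mform_minus_right XB flip: vpow_add)
  finally show ?thesis .
qed

lemma single_in_K_add:
  assumes "single a 1 \<in> Ki i" "single b 1 \<in> Ki i"
  shows "single (a + b) 1 \<in> Ki i"
proof -
  have "qscalar (vpow (- mform N a b)) \<star> (single a 1 \<star> single b 1) \<in> Ki i"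
    using assms unfolding Kiq_def by (intro qsubalgebra_scale qsubalgebra.times)
  then show ?thesis by (simp add: qtimes_single qscalar_single vpow_unit)
qed

lemma single_in_K:
  assumes "colorless i m"
  shows "single m c \<in> Ki i"
proof -
  have one: "single (0 :: monom) 1 \<in> Ki i"
    using qsubalgebra.scalar[of 1] by (simp add: Kiq_def qscalar_def)
  have X: "single (X x) 1 \<in> Ki i" "single (- X x) 1 \<in> Ki i" if "x \<in> Delta0 n C" "fst x \<noteq> i" for x
  proof -
    obtain j s where x: "x = (j, s)" by (cases x)
    have "Xgen d x \<in> Kiq_gens n C d i" "Xinv d x \<in> Kiq_gens n C d i"
      unfolding Kiq_gens_def x using that[unfolded x fst_conv] by blast+
    then have "Xgen d x \<in> Ki i" "Xinv d x \<in> Ki i" unfolding Kiq_def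
      by (auto intro: qsubalgebra.generator)
    then have "qscalar (vpow (d (fst x))) \<star> Xgen d x \<in> Ki i" "qscalar (vpow (- d (fst x))) \<star> Xinv d x \<in> Ki i"
      unfolding Kiq_def by (auto intro: qsubalgebra_scale)
    then show "single (X x) 1 \<in> Ki i" "single (- X x) 1 \<in> Ki i"
      by (simp_all add: Xgen_def Xinv_def qscalar_single vpow_unit single_uminus)
  qed
  have pow: "single (single x u) 1 \<in> Ki i" if "x \<in> Delta0 n C" "fst x \<noteq> i" for x and u :: int
  proof (induction u rule: int_induct[where k = 0])
    case base
    then show ?case using one by simp
  next
    case (step1 u)
    then show ?case using single_in_K_add[OF _ X(1)[OF that]] by (simp add: single_add)
  next
    case (step2 u)
    then show ?case using single_in_K_add[OF _ X(2)[OF that]] by (simp add: single_diff)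
  qed
  have "single (\<Sum>x\<in>A. single x (lookup m x)) 1 \<in> Ki i" if "finite A" "A \<subseteq> keys m" for A
    using that
  proof induction
    case (insert x A)
    have "lookup m x \<noteq> 0" using insert.prems by (auto simp: in_keys_iff)
    then have "x \<in> Delta0 n C \<and> fst x \<noteq> i"
      using assms insert.prems by (cases x) (auto simp: colorless_def)
    then show ?case using insert pow by (simp add: single_in_K_add)
  qed (use one in simp)
  from this[of "keys m"] have "single m 1 \<in> Ki i" by (simp add: sum_single_lookup)
  then have "qscalar c \<star> single m 1 \<in> Ki i" unfolding Kiq_def by (rule qsubalgebra_scale)
  then show ?thesis by (simp add: qscalar_single)
qed

section \<open>Straightening products of the generators of \<open>Ki i\<close>\<close>

lemma mform_colorless_B:
  assumes "colorless i \<mu>" "i \<in> I"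
  shows "mform N \<mu> (Bmonom n C i s) = 0" "mform N (Bmonom n C i s) \<mu> = 0"
proof -
  show "mform N \<mu> (Bmonom n C i s) = 0"
    using mform_B[of \<mu> i s] assms Delta0_sub by (auto simp: colorless_def)
  then show "mform N (Bmonom n C i s) \<mu> = 0" using mform_skew[of \<mu> "Bmonom n C i s"] by simp
qed

lemma single_Gen_commute:
  assumes "colorless i \<mu>" "i \<in> I"
  shows "single \<mu> c \<star> Gen i l = qscalar (vpow (2 * mform N \<mu> (X (i, l)))) \<star> (Gen i l \<star> single \<mu> c)"
  using mform_skew[of "X (i, l)" \<mu>] mform_colorless_B[OF assms]
  by (simp add: Gen_def qtimes_add_right qtimes_add_left qtimes_single qscalar_single mform_diff_right
      mform_diff_left algebra_simps mult.assoc[symmetric] flip: vpow_add)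

text \<open>The only failure of \<open>q\<close>-commutativity among the generators is between neighbours
  \<open>l\<close>, \<open>l + 2\<close>, and the correction term contains no variable of colour \<open>i\<close>.\<close>

lemma Gen_commute:
  assumes "(i, l) \<in> Delta0 n C" "(i, l') \<in> Delta0 n C" "l < l'"
  shows "\<exists>c c'. Gen i l' \<star> Gen i l = qscalar c \<star> (Gen i l \<star> Gen i l') +
      (if l' = l + 2 then single (X (i, l) + X (i, l') - B (i, l + 1)) c' else 0)"
proof -
  have i: "i \<in> I" using assms(1) by (rule Delta0_color)
  have "even (l' - l)" by (rule Delta0_parity[OF assms(2,1)])
  then have l': "l' \<noteq> l + 1" by auto
  define e where "e = mform N (X (i, l)) (X (i, l'))"
  \<comment> \<open>Since \<open>l < l'\<close>, the variable at \<open>l'\<close> pairs with the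
    \<open>B\<close> of column \<open>l + 1\<close> only if \<open>l' = l + 2\<close>; then one
    mixed term of the product gets a power of q different from the other three terms.\<close>
  define \<delta> where "\<delta> = (if l' = l + 2 then d i else 0)"
  have xy: "mform N (X (i, l')) (X (i, l)) = - e" unfolding e_def by (rule mform_skew)
  let ?x = "X (i, l)" and ?y = "X (i, l')" and ?b = "Bmonom n C i (l + 1)" and ?b' = "Bmonom n C i (l' + 1)"
  have xb: "mform N ?x ?b = - 2 * d i" and xb': "mform N ?x ?b' = 0"
    and yb: "mform N ?y ?b = 2 * \<delta>" and yb': "mform N ?y ?b' = - 2 * d i"
    using mform_X_Bmonom[OF i i, of l "l' + 1"] mform_X_Bmonom[OF i i, of l' "l + 1"]
      mform_X_Bmonom[OF i i, of l "l + 1"] mform_X_Bmonom[OF i i, of l' "l' + 1"] assms(3) l'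
    by (auto simp: \<delta>_def)
  have bb': "mform N ?b ?b' = - 2 * \<delta>"
    using assms(3) l' by (simp add: mform_B[OF keys_B_color[OF i] i] lookup_B[OF i] \<delta>_def)
  have skews: "mform N ?b' ?x = 0" "mform N ?b ?y = - 2 * \<delta>" "mform N ?b' ?b = 2 * \<delta>"
    by (simp_all only: mform_skew[of ?b' ?x] mform_skew[of ?b ?y] mform_skew[of ?b' ?b] xb' yb bb' minus_zero minus_minus mult_minus_left)
  have xy': "mform N ?x ?y = e" by (simp only: e_def)
  have forms: "mform N ?y (?x - ?b) = - e - 2 * \<delta>" "mform N (?y - ?b') ?x = - e"
    "mform N (?y - ?b') (?x - ?b) = - e" "mform N ?x (?y - ?b') = e"
    "mform N (?x - ?b) ?y = e + 2 * \<delta>" "mform N (?x - ?b) (?y - ?b') = e"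
    by (simp_all add: mform_diff_left mform_diff_right xy xy' xb' yb bb' skews)
  have four: "(single a1 1 + single a2 1) \<star> (single b1 1 + single b2 1) =
      single (a1 + b1) (vpow (mform N a1 b1)) + single (a1 + b2) (vpow (mform N a1 b2)) +
      single (a2 + b1) (vpow (mform N a2 b1)) + single (a2 + b2) (vpow (mform N a2 b2))" for a1 a2 b1 b2
    by (simp add: qtimes_add_left qtimes_add_right qtimes_single)
  let ?Z = "?x + ?y - ?b"
  have 1: "Gen i l' \<star> Gen i l = single (?x + ?y) (vpow (- e)) + single ?Z (vpow (- e - 2 * \<delta>)) +
      single (?x + ?y - ?b') (vpow (- e)) + single (?x + ?y - ?b - ?b') (vpow (- e))"
    by (simp only: Gen_def four fst_conv snd_conv forms xy) (simp add: algebra_simps)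
  have 2: "Gen i l \<star> Gen i l' = single (?x + ?y) (vpow e) + single (?x + ?y - ?b') (vpow e) +
      single ?Z (vpow (e + 2 * \<delta>)) + single (?x + ?y - ?b - ?b') (vpow e)"
    by (simp only: Gen_def four fst_conv snd_conv forms xy') (simp add: algebra_simps)
  have "Gen i l' \<star> Gen i l = qscalar (vpow (- 2 * e)) \<star> (Gen i l \<star> Gen i l') +
      single ?Z (vpow (- e - 2 * \<delta>) - vpow (- e + 2 * \<delta>))"
    unfolding 1 2 by (simp add: qtimes_add_right qscalar_single single_diff algebra_simps flip: vpow_add)
  moreover have "vpow (- e - 2 * \<delta>) - vpow (- e + 2 * \<delta>) = 0" if "l' \<noteq> l + 2"
    using that by (simp add: \<delta>_def)
  ultimately show ?thesis
    by (intro exI[of _ "vpow (- 2 * e)"] exI[of _ "vpow (- e - 2 * \<delta>) - vpow (- e + 2 * \<delta>)"]) auto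
qed

text \<open>The two variables of colour \<open>i\<close> in \<open>B\<close> cancel, and only the
  inverse of its neighbour part remains.\<close>

lemma colorless_Z:
  assumes "(i, l) \<in> Delta0 n C"
  shows "colorless i (X (i, l) + X (i, l + 2) - B (i, l + 1))"
  unfolding colorless_def
proof
  have i: "i \<in> I" using assms by (rule Delta0_color)
  have "keys (X (i, l) + X (i, l + 2) - B (i, l + 1)) \<subseteq> (keys (X (i, l)) \<union> keys (X (i, l + 2))) \<union> keys (B (i, l + 1))"
    using keys_diff[of "X (i, l) + X (i, l + 2)" "B (i, l + 1)"]
      Poly_Mapping.keys_add[of "X (i, l)" "X (i, l + 2)"] by blast
  then show "keys (X (i, l) + X (i, l + 2) - B (i, l + 1)) \<subseteq> Delta0 n C"
    using keys_B[of i "l + 1"] assms Delta0_shift2[OF assms] by auto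
  show "\<forall>p. lookup (X (i, l) + X (i, l + 2) - B (i, l + 1)) (i, p) = 0"
    using lookup_B[OF i, of "l + 1" i] by (auto simp: lookup_add lookup_minus lookup_single when_def)
qed

definition word :: "nat \<Rightarrow> int list \<Rightarrow> monom \<Rightarrow> qtorus" where
  "word i ls \<mu> = foldr (\<lambda>l f. Gen i l \<star> f) ls (single \<mu> 1)"

lemma word_Nil [simp]: "word i [] \<mu> = single \<mu> 1"
  and word_Cons [simp]: "word i (l # ls) \<mu> = Gen i l \<star> word i ls \<mu>"
  by (simp_all add: word_def)

text \<open>Left combinations of words with weakly increasing letters. The letter set
  \<open>L\<close> is carried along because a letter may be put in front only if it is a lower bound
  for the others.\<close>

inductive_set wspan :: "nat \<Rightarrow> int set \<Rightarrow> qtorus set" for i :: nat and L :: "int set" where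
  wspan_zero: "0 \<in> wspan i L"
| wspan_add: "\<lbrakk>f \<in> wspan i L; g \<in> wspan i L\<rbrakk> \<Longrightarrow> f + g \<in> wspan i L"
| wspan_word: "\<lbrakk>sorted ls; set ls \<subseteq> L; \<forall>l\<in>set ls. (i, l) \<in> Delta0 n C; colorless i \<mu>\<rbrakk> \<Longrightarrow>
    qscalar c \<star> word i ls \<mu> \<in> wspan i L"

lemma wspan_mono:
  assumes "L \<subseteq> L'" "f \<in> wspan i L"
  shows "f \<in> wspan i L'"
  using assms(2)
proof induction
  case (wspan_word ls \<mu> c)
  then show ?case using assms(1) by (intro wspan.wspan_word) auto
qed (auto intro: wspan.intros)

lemma wspan_scale: "f \<in> wspan i L \<Longrightarrow> qscalar c \<star> f \<in> wspan i L"
  by (induction rule: wspan.induct) (auto intro: wspan.intros simp: qtimes_add_right qscalar_times_assoc)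

lemma wspan_Cons:
  assumes "(i, l) \<in> Delta0 n C" "l \<in> L" "f \<in> wspan i (L \<inter> {l..})"
  shows "Gen i l \<star> f \<in> wspan i L"
  using assms(3)
proof induction
  case (wspan_word ls \<mu> c)
  have "qscalar c \<star> word i (l # ls) \<mu> \<in> wspan i L"
    using wspan_word assms by (intro wspan.wspan_word) auto
  then show ?case by (simp add: qscalar_left_commute[where f = "Gen i l"])
qed (auto intro: wspan.intros simp: qtimes_add_right)

lemma colorless_add: "\<lbrakk>colorless i a; colorless i b\<rbrakk> \<Longrightarrow> colorless i (a + b)"
  using Poly_Mapping.keys_add[of a b] by (auto simp: colorless_def lookup_add)

lemma wspan_single:
  assumes "colorless i \<nu>" "i \<in> I" "f \<in> wspan i L"
  shows "single \<nu> c \<star> f \<in> wspan i L"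
proof -
  have word: "\<exists>c'. single \<nu> c \<star> word i ls \<mu> = qscalar c' \<star> word i ls (\<nu> + \<mu>)" if "colorless i \<mu>" for ls \<mu>
  proof (induction ls)
    case Nil
    show ?case by (intro exI[of _ "vpow (mform N \<nu> \<mu>) * c"]) (simp add: qtimes_single qscalar_single)
  next
    case (Cons l ls)
    then obtain c' where c': "single \<nu> c \<star> word i ls \<mu> = qscalar c' \<star> word i ls (\<nu> + \<mu>)" by blast
    have "single \<nu> c \<star> word i (l # ls) \<mu> = (single \<nu> c \<star> Gen i l) \<star> word i ls \<mu>"
      by (simp add: qtimes_assoc)
    also have "\<dots> = qscalar (vpow (2 * mform N \<nu> (X (i, l)))) \<star> (Gen i l \<star> (single \<nu> c \<star> word i ls \<mu>))"
      by (simp only: single_Gen_commute[OF assms(1,2)] qtimes_assoc)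
    also have "\<dots> = qscalar (vpow (2 * mform N \<nu> (X (i, l))) * c') \<star> word i (l # ls) (\<nu> + \<mu>)"
      by (simp only: c' qscalar_left_commute[where f = "Gen i l"] qscalar_times_assoc word_Cons)
    finally show ?case by blast
  qed
  show ?thesis using assms(3)
  proof induction
    case (wspan_word ls \<mu> c2)
    obtain c' where c': "single \<nu> c \<star> word i ls \<mu> = qscalar c' \<star> word i ls (\<nu> + \<mu>)"
      using word wspan_word by blast
    have "qscalar (c2 * c') \<star> word i ls (\<nu> + \<mu>) \<in> wspan i L"
      using wspan_word assms colorless_add by (intro wspan.wspan_word) auto
    then show ?case by (simp only: qscalar_left_commute[where f = "single \<nu> c"] c' qscalar_times_assoc)
  qed (auto intro: wspan.intros simp: qtimes_add_right)
qed

text \<open>Moving the new letter past a smaller one gives the exchanged product, to which induction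
  applies with the smaller letter as lower bound, and possibly a correction in which both letters
  have turned into a colourless monomial. No letter smaller than the old first one arises in the
  exchanged product, so that letter can be put back in front.\<close>

lemma wspan_insert:
  assumes "(i, l') \<in> Delta0 n C" "l' \<ge> b" "sorted ls" "set ls \<subseteq> {b..}"
    "\<forall>l\<in>set ls. (i, l) \<in> Delta0 n C" "colorless i \<mu>"
  shows "Gen i l' \<star> word i ls \<mu> \<in> wspan i {b..}"
  using assms
proof (induction ls arbitrary: b)
  case Nil
  have "qscalar 1 \<star> word i [l'] \<mu> \<in> wspan i {b..}"
    using Nil by (intro wspan.wspan_word) auto
  then show ?case by simp
next
  case (Cons l ls)
  show ?case
  proof (cases "l' \<le> l")
    case True
    have "qscalar 1 \<star> word i (l' # l # ls) \<mu> \<in> wspan i {b..}"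
      using Cons.prems True by (intro wspan.wspan_word) auto
    then show ?thesis by simp
  next
    case False
    have D: "(i, l) \<in> Delta0 n C" using Cons.prems by simp
    have i: "i \<in> I" using D by (rule Delta0_color)
    have sub: "set ls \<subseteq> {l..}" using Cons.prems by auto
    obtain c c' where comm: "Gen i l' \<star> Gen i l = qscalar c \<star> (Gen i l \<star> Gen i l') +
        (if l' = l + 2 then single (X (i, l) + X (i, l') - B (i, l + 1)) c' else 0)"
      using Gen_commute[OF D Cons.prems(1)] False by auto
    have "Gen i l' \<star> word i (l # ls) \<mu> = (Gen i l' \<star> Gen i l) \<star> word i ls \<mu>"
      by (simp add: qtimes_assoc)
    also have "\<dots> = qscalar c \<star> (Gen i l \<star> (Gen i l' \<star> word i ls \<mu>)) +
        (if l' = l + 2 then single (X (i, l) + X (i, l') - B (i, l + 1)) c' \<star> word i ls \<mu> else 0)"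
      unfolding comm by (simp add: qtimes_add_left qtimes_assoc)
    also have "\<dots> \<in> wspan i {b..}"
    proof (rule wspan_add)
      have "Gen i l' \<star> word i ls \<mu> \<in> wspan i {l..}"
        using Cons.IH[of l] Cons.prems False sub by simp
      then have g: "Gen i l' \<star> word i ls \<mu> \<in> wspan i ({b..} \<inter> {l..})"
        by (rule wspan_mono[rotated]) (use Cons.prems in auto)
      show "qscalar c \<star> (Gen i l \<star> (Gen i l' \<star> word i ls \<mu>)) \<in> wspan i {b..}"
        by (intro wspan_scale wspan_Cons[OF D _ g]) (use Cons.prems in auto)
      have "qscalar 1 \<star> word i ls \<mu> \<in> wspan i {b..}"
        using Cons.prems sub by (intro wspan.wspan_word) auto
      then have "word i ls \<mu> \<in> wspan i {b..}" by simp
      then show "(if l' = l + 2 then single (X (i, l) + X (i, l') - B (i, l + 1)) c' \<star> word i ls \<mu> else 0)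
          \<in> wspan i {b..}"
        using colorless_Z[OF D] i by (auto intro: wspan_single wspan_zero)
    qed
    finally show ?thesis .
  qed
qed

lemma wspan_Gen:
  assumes "(i, l') \<in> Delta0 n C" "f \<in> wspan i UNIV"
  shows "Gen i l' \<star> f \<in> wspan i UNIV"
  using assms(2)
proof induction
  case (wspan_word ls \<mu> c)
  define b where "b = Min (insert l' (set ls))"
  have "Gen i l' \<star> word i ls \<mu> \<in> wspan i {b..}"
    using wspan_word assms(1) by (intro wspan_insert) (auto simp: b_def)
  then have "qscalar c \<star> (Gen i l' \<star> word i ls \<mu>) \<in> wspan i {b..}" by (rule wspan_scale)
  then show ?case by (simp add: qscalar_left_commute[where f = "Gen i l'"] wspan_mono[of "{b..}" UNIV])
qed (auto intro: wspan.intros simp: qtimes_add_right)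

text \<open>Left multiplication by each generator preserves the span of sorted words, hence so does
  every element of the algebra; this is applied to 1.\<close>

lemma Ki_subset_wspan:
  assumes i: "i \<in> I" and f: "f \<in> Ki i"
  shows "f \<in> wspan i UNIV"
proof -
  have "f \<star> s \<in> wspan i UNIV" if "s \<in> wspan i UNIV" for s
    using f[unfolded Kiq_def] that
  proof (induction arbitrary: s)
    case (scalar c)
    then show ?case by (rule wspan_scale)
  next
    case (generator g)
    then consider l where "(i, l) \<in> Delta0 n C" "g = qtimes N (Xgen d (i, l))
        (qscalar 1 + qtimes N (qscalar (vpow (- 2 * d i))) (underline N d (- Bmonom n C i (l + 1))))"
      | j s where "(j, s) \<in> Delta0 n C" "j \<noteq> i" "g = Xgen d (j, s)"
      | j s where "(j, s) \<in> Delta0 n C" "j \<noteq> i" "g = Xinv d (j, s)"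
      unfolding Kiq_gens_def by blast
    then show ?case
    proof cases
      case 1
      have XB: "mform N (X (i, l)) (Bmonom n C i (l + 1)) = - 2 * d i"
        using mform_X_Bmonom[OF i i, of l "l + 1"] by simp
      have "g = qscalar (vpow (- d i)) \<star> Gen i l"
        unfolding 1 underline_eq_single[OF N_antisym] Xgen_def Gen_def
        by (simp add: qscalar_single qtimes_add_right qtimes_single mform_minus_right XB flip: vpow_add)
      then show ?thesis using generator(2) 1 by (simp add: qtimes_assoc wspan_scale wspan_Gen)
    next
      case 2
      have "colorless i (X (j, s))" using 2 by (auto simp: colorless_def lookup_single when_def)
      then show ?thesis unfolding 2 Xgen_def by (rule wspan_single[OF _ i generator(2)])
    next
      case 3
      have "colorless i (single (j, s) (- 1))" using 3 by (auto simp: colorless_def lookup_single when_def)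
      then show ?thesis unfolding 3 Xinv_def fst_conv by (rule wspan_single[OF _ i generator(2)])
    qed
  qed (auto simp: qtimes_add_left qtimes_assoc intro: wspan.intros)
  moreover have "qscalar 1 \<in> wspan i UNIV"
  proof -
    have "qscalar 1 \<star> word i [] 0 \<in> wspan i UNIV"
      by (rule wspan.wspan_word) (auto simp: colorless_def)
    then have "single 0 1 \<in> wspan i UNIV" by (simp only: word_Nil one_qtimes)
    then show ?thesis by (simp only: qscalar_def)
  qed
  ultimately have "f \<star> qscalar 1 \<in> wspan i UNIV" by blast
  then show ?thesis by simp
qed

section \<open>Leading monomials of sorted words\<close>

definition word_top :: "nat \<Rightarrow> int list \<Rightarrow> monom \<Rightarrow> monom" where
  "word_top i ls \<mu> = (\<Sum>l\<leftarrow>ls. X (i, l)) + \<mu>"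

lemma keys_Gen: "m \<in> keys (Gen i l) \<Longrightarrow> m = X (i, l) \<or> m = X (i, l) - B (i, l + 1)"
  using Poly_Mapping.keys_add[of "single (X (i, l)) 1 :: qtorus" "single (X (i, l) - B (i, l + 1)) 1"]
  by (auto simp: Gen_def)

lemma word_keys:
  assumes "m \<in> keys (word i ls \<mu>)"
  shows "\<exists>V. V \<subseteq># mset (map (\<lambda>l. (i, l + 1)) ls) \<and> m = word_top i ls \<mu> - Bs V"
  using assms
proof (induction ls arbitrary: m)
  case (Cons l ls)
  then obtain a b where ab: "a \<in> keys (Gen i l)" "b \<in> keys (word i ls \<mu>)" "m = a + b"
    using keys_qtimes[of m N "Gen i l" "word i ls \<mu>"] Cons.prems by auto
  obtain V where V: "V \<subseteq># mset (map (\<lambda>l. (i, l + 1)) ls)" "b = word_top i ls \<mu> - Bs V"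
    using Cons.IH[OF ab(2)] by blast
  from keys_Gen[OF ab(1)] show ?case
  proof
    assume "a = X (i, l)"
    then have "m = word_top i (l # ls) \<mu> - Bs V" using ab V by (simp add: word_top_def)
    moreover have "V \<subseteq># mset (map (\<lambda>l. (i, l + 1)) (l # ls))"
      using V(1) subset_mset.order_trans[OF V(1), of "mset (map (\<lambda>l. (i, l + 1)) (l # ls))"] by simp
    ultimately show ?thesis by blast
  next
    assume a: "a = X (i, l) - B (i, l + 1)"
    have "m = word_top i (l # ls) \<mu> - Bs (add_mset (i, l + 1) V)"
      unfolding ab(3) V(2) a by (simp add: word_top_def algebra_simps)
    then show ?thesis using V(1) by (intro exI[of _ "add_mset (i, l + 1) V"]) simp
  qed
qed (auto simp: word_top_def)

text \<open>The leading monomial arises only from the leading terms of the factors, since any other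
  contribution would make a nonempty product of \<open>B\<close>'s trivial. The coefficient is thus
  a unit and can be normalised to 1.\<close>

lemma word_top_coeff:
  assumes "i \<in> I"
  shows "\<exists>k. lookup (word i ls \<mu>) (word_top i ls \<mu>) = vpow k"
proof (induction ls)
  case Nil
  then show ?case by (intro exI[of _ 0]) (simp add: word_top_def)
next
  case (Cons l ls)
  let ?t = "word_top i ls \<mu>"
  obtain k where k: "lookup (word i ls \<mu>) ?t = vpow k" using Cons.IH by blast
  have t: "word_top i (l # ls) \<mu> = X (i, l) + ?t" by (simp add: word_top_def add.assoc)
  have "?t + B (i, l + 1) \<notin> keys (word i ls \<mu>)"
  proof
    assume "?t + B (i, l + 1) \<in> keys (word i ls \<mu>)"
    then obtain V where V: "V \<subseteq># mset (map (\<lambda>l. (i, l + 1)) ls)" "?t + B (i, l + 1) = ?t - Bs V"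
      using word_keys by blast
    have "B (i, l + 1) + Bs V = (?t + B (i, l + 1)) - (?t - Bs V)" by simp
    then have "Bs (add_mset (i, l + 1) V) = 0" unfolding V(2) by simp
    moreover have "set_mset V \<subseteq> I \<times> UNIV" using set_mset_mono[OF V(1)] assms by auto
    ultimately show False using Bs_eq_0[of "add_mset (i, l + 1) V"] assms by simp
  qed
  then have "lookup (word i ls \<mu>) (?t + B (i, l + 1)) = 0" by (simp add: in_keys_iff)
  then have "lookup (word i (l # ls) \<mu>) (word_top i (l # ls) \<mu>) = vpow (mform N (X (i, l)) ?t) * vpow k"
    unfolding t by (simp add: Gen_def qtimes_add_left lookup_add lookup_single_times k algebra_simps)
  then show ?case by (metis vpow_add)
qed

lemma lookup_word_top:
  assumes "colorless i \<mu>"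
  shows "lookup (word_top i ls \<mu>) (i, l) = int (count (mset ls) l)"
proof -
  have "lookup (\<Sum>l\<leftarrow>ls. X (i, l)) (i, l) = int (count (mset ls) l)"
    by (induction ls) (auto simp: lookup_add lookup_single when_def)
  then show ?thesis using assms by (simp add: word_top_def lookup_add colorless_def)
qed

lemma keys_word_top:
  assumes "\<forall>l\<in>set ls. (i, l) \<in> Delta0 n C" "keys \<mu> \<subseteq> Delta0 n C"
  shows "keys (word_top i ls \<mu>) \<subseteq> Delta0 n C"
  using assms(1)
proof (induction ls)
  case (Cons l ls)
  have "word_top i (l # ls) \<mu> = X (i, l) + word_top i ls \<mu>" by (simp add: word_top_def add.assoc)
  then show ?case using Cons Poly_Mapping.keys_add[of "X (i, l)" "word_top i ls \<mu>"] by auto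
qed (simp add: word_top_def assms(2))

text \<open>The words with a given leading monomial are unique; \<open>Edom i a\<close> is the one with leading
  monomial \<open>a\<close>, normalised.\<close>

definition Eletters :: "nat \<Rightarrow> monom \<Rightarrow> int list" where
  "Eletters i a = (THE ls. sorted ls \<and> (\<forall>l. int (count (mset ls) l) = lookup a (i, l)))"

definition Eword :: "nat \<Rightarrow> monom \<Rightarrow> qtorus" where
  "Eword i a = word i (Eletters i a) (a - (\<Sum>l\<leftarrow>Eletters i a. X (i, l)))"

definition Edom :: "nat \<Rightarrow> monom \<Rightarrow> qtorus" where
  "Edom i a = qscalar (vpow (- (SOME k. lookup (Eword i a) a = vpow k))) \<star> Eword i a"

lemma Eletters_eq:
  assumes "sorted ls" "\<And>l. int (count (mset ls) l) = lookup a (i, l)"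
  shows "Eletters i a = ls"
  unfolding Eletters_def
proof (rule the_equality)
  fix ls' assume "sorted ls' \<and> (\<forall>l. int (count (mset ls') l) = lookup a (i, l))"
  then have "sorted ls'" "mset ls' = mset ls" using assms(2) by (auto simp: multiset_eq_iff) (metis of_nat_eq_iff)
  then show "ls' = ls" using assms(1) by (metis properties_for_sort)
qed (use assms in auto)

lemma Eletters:
  assumes "idom i a"
  shows "sorted (Eletters i a) \<and> (\<forall>l. int (count (mset (Eletters i a)) l) = lookup a (i, l))"
proof -
  define M where "M = (\<Sum>x\<in>keys a. if fst x = i then replicate_mset (nat (lookup a x)) (snd x) else {#})"
  have "count M l = nat (lookup a (i, l))" for l
  proof -
    have "count M l = (\<Sum>x\<in>keys a. if x = (i, l) then nat (lookup a x) else 0)"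
      unfolding M_def count_sum by (intro sum.cong refl) (auto split: prod.splits)
    also have "\<dots> = nat (lookup a (i, l))" by (auto simp: in_keys_iff)
    finally show ?thesis .
  qed
  then have "int (count (mset (sorted_list_of_multiset M)) l) = lookup a (i, l)" for l
    using assms by (simp add: idom_def)
  then have "Eletters i a = sorted_list_of_multiset M" by (intro Eletters_eq) auto
  then show ?thesis using \<open>\<And>l. int (count (mset (sorted_list_of_multiset M)) l) = lookup a (i, l)\<close> by simp
qed

lemma Eletters_Delta0:
  assumes "idom i a" "l \<in> set (Eletters i a)"
  shows "(i, l) \<in> Delta0 n C"
proof -
  have "count (mset (Eletters i a)) l \<noteq> 0" using assms(2) by (simp add: count_eq_zero_iff)
  then have "lookup a (i, l) \<noteq> 0" using Eletters[OF assms(1)] by (metis of_nat_eq_0_iff)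
  then show ?thesis using assms(1) by (auto simp: idom_def in_keys_iff)
qed

lemma colorless_Erest:
  assumes "idom i a"
  shows "colorless i (a - (\<Sum>l\<leftarrow>Eletters i a. X (i, l)))"
  unfolding colorless_def
proof
  let ?s = "\<Sum>l\<leftarrow>Eletters i a. X (i, l)"
  have "keys (word_top i (Eletters i a) 0) \<subseteq> Delta0 n C"
    using Eletters_Delta0[OF assms] by (intro keys_word_top) auto
  then show "keys (a - ?s) \<subseteq> Delta0 n C"
    using keys_diff[of a ?s] assms by (auto simp: word_top_def idom_def)
  have "colorless i 0" by (simp add: colorless_def)
  from lookup_word_top[OF this, of "Eletters i a"] show "\<forall>p. lookup (a - ?s) (i, p) = 0"
    using Eletters[OF assms] by (simp add: word_top_def lookup_minus)
qed

lemma Eword_top: "word_top i (Eletters i a) (a - (\<Sum>l\<leftarrow>Eletters i a. X (i, l))) = a"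
  by (simp add: word_top_def)

lemma Edom_top:
  assumes "i \<in> I"
  shows "lookup (Edom i a) a = 1"
proof -
  have "\<exists>k. lookup (Eword i a) a = vpow k"
    using word_top_coeff[OF assms] Eword_top unfolding Eword_def by metis
  then have "lookup (Eword i a) a = vpow (SOME k. lookup (Eword i a) a = vpow k)" by (rule someI_ex)
  then show ?thesis unfolding Edom_def lookup_qscalar_times using vpow_unit(2) by metis
qed

lemma Edom_keys:
  assumes "i \<in> I" "idom i a" "m \<in> keys (Edom i a)"
  shows "istep i a m"
proof -
  have "m \<in> keys (Eword i a)"
    using assms(3) by (auto simp: Edom_def in_keys_iff lookup_qscalar_times)
  then obtain V where V: "V \<subseteq># mset (map (\<lambda>l. (i, l + 1)) (Eletters i a))" "m = a - Bs V"
    using word_keys Eword_top unfolding Eword_def by metis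
  have "count (mset (map (\<lambda>l. (i, l + 1)) ls)) (i, l + 1) = count (mset ls) l" for ls and l :: int
    by (induction ls) auto
  then have "int (count V (i, l + 1)) \<le> lookup a (i, l)" for l
    using mset_subset_eq_count[OF V(1), of "(i, l + 1)"] Eletters[OF assms(2)] by (metis of_nat_le_iff)
  moreover have "set_mset V \<subseteq> {i} \<times> UNIV" using set_mset_mono[OF V(1)] by auto
  ultimately show ?thesis unfolding istep_def using V(2) assms(2) by blast
qed

lemma Eword_in_K:
  assumes "\<forall>l\<in>set ls. (i, l) \<in> Delta0 n C" "colorless i \<mu>"
  shows "word i ls \<mu> \<in> Ki i"
  using assms
proof (induction ls)
  case (Cons l ls)
  then show ?case using Gen_in_K[of i l] by (auto simp: Kiq_def intro: qsubalgebra.times)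
qed (simp add: single_in_K)

lemma Edom_in_K: "idom i a \<Longrightarrow> Edom i a \<in> Ki i"
  unfolding Edom_def Eword_def Kiq_def
  by (intro qsubalgebra_scale Eword_in_K[unfolded Kiq_def] colorless_Erest ballI Eletters_Delta0)

text \<open>A sorted word is determined by its leading monomial \<open>a\<close> and is a unit
  multiple of \<open>Edom i a\<close>; collecting terms leaves one coefficient for each
  \<open>a\<close>.\<close>

lemma wspan_expand:
  assumes "f \<in> wspan i UNIV" "i \<in> I"
  shows "\<exists>A c. finite A \<and> (\<forall>a\<in>A. idom i a) \<and> f = (\<Sum>a\<in>A. qscalar (c a) \<star> Edom i a)"
  using assms(1)
proof induction
  case wspan_zero
  then show ?case by (intro exI[of _ "{}"]) simp
next
  case (wspan_add f g)
  then obtain A c A' c' where A: "finite A" "\<forall>a\<in>A. idom i a" "f = (\<Sum>a\<in>A. qscalar (c a) \<star> Edom i a)"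
    "finite A'" "\<forall>a\<in>A'. idom i a" "g = (\<Sum>a\<in>A'. qscalar (c' a) \<star> Edom i a)" by blast
  have ext: "(\<Sum>a\<in>S. qscalar (g a) \<star> Edom i a) = (\<Sum>a\<in>T. qscalar (if a \<in> S then g a else 0) \<star> Edom i a)"
    if "finite T" "S \<subseteq> T" for S T g
    using that by (intro sum.mono_neutral_cong_left) (auto simp: qscalar_def)
  have "f + g = (\<Sum>a\<in>A \<union> A'. qscalar ((if a \<in> A then c a else 0) + (if a \<in> A' then c' a else 0)) \<star> Edom i a)"
    unfolding A(3,6) using A(1,4)
    by (subst ext[of "A \<union> A'" A], simp, simp, subst ext[of "A \<union> A'" A'], simp, simp)
      (simp only: sum.distrib[symmetric] qtimes_add_left[symmetric] qscalar_def single_add)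
  then show ?case using A by (intro exI[of _ "A \<union> A'"] exI conjI) auto
next
  case (wspan_word ls \<mu> c)
  define a where "a = word_top i ls \<mu>"
  have dom: "idom i a" unfolding idom_def a_def
    using keys_word_top lookup_word_top wspan_word by (simp add: colorless_def)
  have "Eletters i a = ls" unfolding a_def
    using wspan_word by (intro Eletters_eq) (simp_all add: lookup_word_top)
  then have "Eword i a = word i ls \<mu>" by (simp add: Eword_def a_def word_top_def)
  then obtain k where "Edom i a = qscalar (vpow (- k)) \<star> word i ls \<mu>" by (simp add: Edom_def)
  then have "qscalar c \<star> word i ls \<mu> = qscalar (c * vpow k) \<star> Edom i a"
    by (simp add: qscalar_times_assoc mult.assoc vpow_unit)
  then show ?case using dom by (intro exI[of _ "{a}"] exI[of _ "\<lambda>_. c * vpow k"]) simp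
qed

end

section \<open>Heights and uniqueness\<close>

lemma laurent_mult_left_cancel: "(c :: laurent) \<noteq> 0 \<Longrightarrow> c * a = c * b \<Longrightarrow> a = b"
  by (metis eq_iff_diff_eq_0 mult_eq_0_iff right_diff_distrib)

context cartan_data
begin

text \<open>The inner product of the classical weight of \<open>m\<close>, in which the second
  coordinates are forgotten, with the vector whose simple-root coordinates are \<open>w\<close>. The
  factor \<kappa> is the inner product of a fundamental weight with its simple root.\<close>

definition pairing :: "monom \<Rightarrow> (nat \<Rightarrow> real) \<Rightarrow> real" where
  "pairing m w = (\<Sum>x\<in>keys m. real_of_int (lookup m x) * (\<kappa> (fst x) * w (fst x)))"

lemma pairing_superset:
  assumes "finite S" "keys m \<subseteq> S"
  shows "pairing m w = (\<Sum>x\<in>S. real_of_int (lookup m x) * (\<kappa> (fst x) * w (fst x)))"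
  unfolding pairing_def using assms by (intro sum.mono_neutral_left) (auto simp: in_keys_iff)

lemma pairing_add: "pairing (a + b) w = pairing a w + pairing b w"
proof -
  let ?S = "keys a \<union> keys b"
  have "keys (a + b) \<subseteq> ?S" by (rule Poly_Mapping.keys_add)
  then show ?thesis
    by (simp add: pairing_superset[of ?S] lookup_add distrib_right sum.distrib)
qed

lemma pairing_zero [simp]: "pairing 0 w = 0"
  by (simp add: pairing_def)

lemma pairing_diff: "pairing (a - b) w = pairing a w - pairing b w"
  using pairing_add[of "a - b" b w] by simp

lemma pairing_sum: "pairing (\<Sum>x\<in>A. g x) w = (\<Sum>x\<in>A. pairing (g x) w)"
  by (induction A rule: infinite_finite_induct) (simp_all add: pairing_add)

lemma pairing_single: "pairing (single x u) w = real_of_int u * (\<kappa> (fst x) * w (fst x))"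
  by (simp add: pairing_superset[of "{x}"])

definition unit :: "nat \<Rightarrow> nat \<Rightarrow> real" where
  "unit i j = (if j = i then 1 else 0)"

lemma Bf_unit: "i \<in> I \<Longrightarrow> Bf w (unit i) = (\<Sum>k\<in>I. \<kappa> k * C k i * w k)"
  by (simp add: Bf_def unit_def if_distrib[of "\<lambda>x. _ * x"] cong: if_cong)

text \<open>The exponents in \<open>Bmonom\<close> form a column of \<open>C\<close>, so the
  classical weight of a \<open>B\<close> of colour \<open>j\<close> is the simple root of
  \<open>j\<close>, whatever its column.\<close>

lemma pairing_B:
  assumes "j \<in> I"
  shows "pairing (Bmonom n C j s) w = Bf w (unit j)"
proof -
  have fin: "finite {k. adj j k}" by (rule finite_subset[of _ I]) (auto simp: adj_def)
  have "pairing (Bmonom n C j s) w = 2 * (\<kappa> j * w j) + (\<Sum>k\<in>{k. adj j k}. C k j * (\<kappa> k * w k))"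
    unfolding Bmonom_def neighbours_eq[OF assms] by (simp add: pairing_add pairing_sum pairing_single)
  also have "(\<Sum>k\<in>{k. adj j k}. C k j * (\<kappa> k * w k)) = (\<Sum>k\<in>I - {j}. C k j * (\<kappa> k * w k))"
    using assms C_eq_0_iff[of j] by (intro sum.mono_neutral_left) (auto simp: adj_def)
  also have "2 * (\<kappa> j * w j) + \<dots> = (\<Sum>k\<in>I. C k j * (\<kappa> k * w k))"
    unfolding sum.remove[OF finite_atLeastAtMost assms] using C_diag[OF assms] by simp
  finally show ?thesis unfolding Bf_unit[OF assms] by (simp add: mult_ac)
qed

text \<open>The vector having inner product 1 with every simple root, so that each \<open>B\<close>
  gets height 1 irrespective of root lengths.\<close>

definition rho :: "nat \<Rightarrow> real" where
  "rho = (SOME w. \<forall>y. Bf w y = (\<Sum>i\<in>I. y i))"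

lemma Bf_rho: "Bf rho y = (\<Sum>i\<in>I. y i)"
proof -
  have "\<exists>w. \<forall>y. Bf w y = (\<Sum>i\<in>I. y i)" using Bf_represent[of "\<lambda>_. 1"] by simp
  then show ?thesis unfolding rho_def by (rule someI2_ex) blast
qed

definition ht :: "monom \<Rightarrow> real" where
  "ht m = pairing m rho"

lemma ht_B: "j \<in> I \<Longrightarrow> ht (Bmonom n C j s) = 1"
  by (simp add: ht_def pairing_B Bf_rho unit_def)

lemma ht_Bs: "set_mset V \<subseteq> I \<times> UNIV \<Longrightarrow> ht (Bs V) = size V"
proof (induction V)
  case (add x V)
  then show ?case using ht_B[of "fst x" "snd x"] by (auto simp: ht_def pairing_add)
qed (simp add: ht_def)

lemma ht_diff: "ht (a - b) = ht a - ht b"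
  by (simp add: ht_def pairing_diff)

section \<open>The order by divided-out \<open>B\<close>'s and the climb to dominant
  monomials\<close>

definition below :: "monom \<Rightarrow> monom \<Rightarrow> bool" where
  "below a m \<longleftrightarrow> (\<exists>V. set_mset V \<subseteq> I \<times> UNIV \<and> m = a - Bs V)"

lemma below_refl [simp]: "below a a"
  unfolding below_def by (intro exI[of _ "{#}"]) simp

lemma below_trans: "below a b \<Longrightarrow> below b c \<Longrightarrow> below a c"
  unfolding below_def
proof safe
  fix V W :: "vertex multiset" assume "set_mset V \<subseteq> I \<times> UNIV" "set_mset W \<subseteq> I \<times> UNIV"
  then show "\<exists>U. set_mset U \<subseteq> I \<times> UNIV \<and> a - Bs V - Bs W = a - Bs U"
    by (intro exI[of _ "V + W"]) (auto simp: Bs_union)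
qed

lemma below_ht: "below a m \<Longrightarrow> \<exists>k::nat. ht m = ht a - k \<and> (k = 0 \<longrightarrow> m = a)"
  unfolding below_def by (auto simp: ht_diff ht_Bs)

lemma below_ht_le: "below a m \<Longrightarrow> ht m \<le> ht a"
  using below_ht by fastforce

lemma below_ht_less: "below a m \<Longrightarrow> m \<noteq> a \<Longrightarrow> ht m < ht a"
  using below_ht by fastforce

lemma istep_below: "i \<in> I \<Longrightarrow> istep i a m \<Longrightarrow> below a m"
  unfolding istep_def below_def by blast

lemma isteps_below: "(istep i)\<^sup>*\<^sup>* a m \<Longrightarrow> i \<in> I \<Longrightarrow> below a m"
  by (induction rule: rtranclp_induct) (use below_trans istep_below below_refl in blast)+

text \<open>Divisibility by \<open>c\<close> is tracked so that \<open>c = 0\<close> gives supports and a general \<open>c\<close> allows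
  division inside \<open>\<K>\<^sub>i\<close>.\<close>

lemma K_expand_up:
  assumes i: "i \<in> I" and f: "f \<in> Ki i"
  shows "\<exists>A l. finite A \<and> (\<forall>a\<in>A. idom i a) \<and> f = (\<Sum>a\<in>A. qscalar (l a) \<star> Edom i a) \<and>
    (\<forall>a\<in>A. \<forall>c. \<not> c dvd l a \<longrightarrow> (\<exists>b. idom i b \<and> \<not> c dvd lookup f b \<and> (istep i)\<^sup>*\<^sup>* b a))"
proof -
  obtain A l where A: "finite A" "\<And>a. a \<in> A \<Longrightarrow> idom i a"
    and f_eq: "f = (\<Sum>a\<in>A. qscalar (l a) \<star> Edom i a)"
    using wspan_expand[OF Ki_subset_wspan[OF i f] i] by blast
  have lookup_f: "lookup f m = (\<Sum>a\<in>A. l a * lookup (Edom i a) m)" for m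
    unfolding f_eq by (simp add: lookup_sum lookup_qscalar_times)
  have "\<exists>b. idom i b \<and> \<not> c dvd lookup f b \<and> (istep i)\<^sup>*\<^sup>* b a" if "a \<in> A" "\<not> c dvd l a" for a c
    using that
  proof (induction "card {b \<in> A. ht b > ht a}" arbitrary: a rule: less_induct)
    case less
    show ?case
    proof (cases "c dvd lookup f a")
      case False
      then show ?thesis using A(2) less.prems by blast
    next
      case True
      \<comment> \<open>\<open>Edom i a\<close> has coefficient 1 at \<open>a\<close>, so
        \<open>l a\<close> differs from the coefficient of \<open>f\<close> only by contributions of
        other basis elements. If \<open>c\<close> divides the latter but not the former, one of
        these contributions is not divisible by \<open>c\<close>, and it comes from a strictly
        higher \<open>b\<close>.\<close>
      have eq: "lookup f a = l a + (\<Sum>b\<in>A - {a}. l b * lookup (Edom i b) a)"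
        unfolding lookup_f using A(1) less.prems(1) Edom_top[OF i, of a] by (simp add: sum.remove[of A a])
      have "\<not> c dvd (\<Sum>b\<in>A - {a}. l b * lookup (Edom i b) a)"
      proof
        assume "c dvd (\<Sum>b\<in>A - {a}. l b * lookup (Edom i b) a)"
        from dvd_diff[OF True this] show False using eq less.prems(2) by simp
      qed
      then obtain b where b: "b \<in> A" "b \<noteq> a" "\<not> c dvd l b * lookup (Edom i b) a"
        using dvd_sum[of "A - {a}" c "\<lambda>b. l b * lookup (Edom i b) a"] by blast
      have "lookup (Edom i b) a \<noteq> 0" using b(3) by auto
      then have step: "istep i b a"
        by (intro Edom_keys[OF i A(2)[OF b(1)]]) (simp add: in_keys_iff)
      then have lt: "ht a < ht b" using b(2) istep_below[OF i] below_ht_less by blast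
      have "card {b' \<in> A. ht b' > ht b} < card {b' \<in> A. ht b' > ht a}"
        by (rule psubset_card_mono) (use A(1) b(1) lt in auto)
      moreover have "\<not> c dvd l b" using b(3) by (meson dvd_mult2)
      ultimately obtain b' where "idom i b'" "\<not> c dvd lookup f b'" "(istep i)\<^sup>*\<^sup>* b' b"
        using less.hyps[of b] b(1) by blast
      then show ?thesis using step by (meson rtranclp.rtrancl_into_rtrancl)
    qed
  qed
  then show ?thesis using A f_eq by blast
qed

lemma K_up:
  assumes "i \<in> I" "f \<in> Ki i" "\<not> c dvd lookup f m"
  shows "\<exists>a. idom i a \<and> \<not> c dvd lookup f a \<and> (istep i)\<^sup>*\<^sup>* a m"
proof -
  obtain A l where A: "finite A" "\<And>a. a \<in> A \<Longrightarrow> idom i a"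
    and f_eq: "f = (\<Sum>a\<in>A. qscalar (l a) \<star> Edom i a)"
    and up: "\<And>a c. a \<in> A \<Longrightarrow> \<not> c dvd l a \<Longrightarrow> \<exists>b. idom i b \<and> \<not> c dvd lookup f b \<and> (istep i)\<^sup>*\<^sup>* b a"
    using K_expand_up[OF assms(1,2)] by blast
  have "lookup f m = (\<Sum>a\<in>A. l a * lookup (Edom i a) m)"
    unfolding f_eq by (simp add: lookup_sum lookup_qscalar_times)
  then obtain a where a: "a \<in> A" "\<not> c dvd l a * lookup (Edom i a) m"
    using assms(3) dvd_sum[of A c "\<lambda>a. l a * lookup (Edom i a) m"] by metis
  have "lookup (Edom i a) m \<noteq> 0" using a(2) by auto
  then have "istep i a m"
    by (intro Edom_keys[OF assms(1) A(2)[OF a(1)]]) (simp add: in_keys_iff)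
  moreover have "\<not> c dvd l a" using a(2) by (meson dvd_mult2)
  ultimately show ?thesis using up[OF a(1)] by (meson rtranclp.rtrancl_into_rtrancl)
qed

lemma K_up_nonzero:
  assumes "i \<in> I" "f \<in> Ki i" "m \<in> keys f"
  shows "\<exists>a\<in>keys f. idom i a \<and> (istep i)\<^sup>*\<^sup>* a m"
  using K_up[OF assms(1,2), of 0 m] assms(3) by (auto simp: in_keys_iff)

text \<open>From a monomial that is not \<open>i\<close>-dominant and whose coefficient is not
  divisible by \<open>c\<close>, \<open>K_up\<close> leads to a strictly higher one of the latter
  kind. The support of \<open>f\<close> is finite, so the climb ends at a monomial dominant for all
  of \<open>J\<close>.\<close>

lemma K_climb:
  assumes J: "J \<subseteq> I" and f: "\<And>i. i \<in> J \<Longrightarrow> f \<in> Ki i" and m: "\<not> c dvd lookup f m"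
  shows "\<exists>a. (\<forall>i\<in>J. idom i a) \<and> \<not> c dvd lookup f a \<and> below a m"
  using m
proof (induction "card {b \<in> keys f. ht b > ht m}" arbitrary: m rule: less_induct)
  case less
  show ?case
  proof (cases "\<forall>i\<in>J. idom i m")
    case True
    then show ?thesis using less.prems below_refl by blast
  next
    case False
    then obtain i where i: "i \<in> J" "\<not> idom i m" by blast
    have iI: "i \<in> I" using i J by blast
    obtain a where a: "idom i a" "\<not> c dvd lookup f a" "(istep i)\<^sup>*\<^sup>* a m"
      using K_up[OF iI f[OF i(1)] less.prems] by blast
    have bel: "below a m" using isteps_below[OF a(3) iI] .
    have lt: "ht m < ht a" using below_ht_less[OF bel] a(1) i(2) by blast
    have "lookup f a \<noteq> 0" using a(2) by auto
    then have "card {b \<in> keys f. ht b > ht a} < card {b \<in> keys f. ht b > ht m}"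
      by (intro psubset_card_mono) (use lt in \<open>auto simp: in_keys_iff\<close>)
    then obtain b where "\<forall>i\<in>J. idom i b" "\<not> c dvd lookup f b" "below b a"
      using less.hyps a(2) by blast
    then show ?thesis using below_trans[OF _ bel] by blast
  qed
qed

lemma Kq_unique:
  assumes "f \<in> Kq n C d" "\<And>m. dominant n C m \<Longrightarrow> lookup f m = 0"
  shows "f = 0"
proof (rule poly_mapping_eqI)
  fix m
  show "lookup f m = lookup 0 m"
  proof (rule ccontr)
    assume "lookup f m \<noteq> lookup 0 m"
    then have "\<not> 0 dvd lookup f m" by simp
    then obtain a where a: "\<forall>i\<in>I. idom i a" "\<not> 0 dvd lookup f a"
      using K_climb[of I f 0 m] assms(1) by (auto simp: Kq_def)
    have "1 \<in> I" using n_pos by simp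
    then have "dominant n C a" unfolding dominant_iff using a(1) by (auto simp: idom_def)
    then show False using assms(2) a(2) by simp
  qed
qed

text \<open>By \<open>K_climb\<close>, divisibility at the \<open>J\<close>-dominant monomials
  spreads to all coefficients of \<open>f\<close>, and by \<open>K_expand_up\<close> to its
  coordinates in the basis of each \<open>Ki i\<close>. The quotients found for different colours
  coincide because the scalar ring has no zero divisors.\<close>

lemma K_divide:
  assumes J: "J \<subseteq> I" "J \<noteq> {}" and f: "\<And>i. i \<in> J \<Longrightarrow> f \<in> Ki i" and c: "c \<noteq> 0"
    and dvd: "\<And>m. \<forall>i\<in>J. idom i m \<Longrightarrow> c dvd lookup f m"
  obtains g where "\<And>i. i \<in> J \<Longrightarrow> g \<in> Ki i" "f = qscalar c \<star> g"
proof -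
  have all_dvd: "c dvd lookup f m" for m
    using K_climb[OF J(1) f] dvd by blast
  have ex: "\<exists>g\<in>Ki i. f = qscalar c \<star> g" if i: "i \<in> J" for i
  proof -
    have iI: "i \<in> I" using i J by blast
    obtain A l where A: "finite A" "\<And>a. a \<in> A \<Longrightarrow> idom i a"
      and f_eq: "f = (\<Sum>a\<in>A. qscalar (l a) \<star> Edom i a)"
      and up: "\<And>a c. a \<in> A \<Longrightarrow> \<not> c dvd l a \<Longrightarrow> \<exists>b. idom i b \<and> \<not> c dvd lookup f b \<and> (istep i)\<^sup>*\<^sup>* b a"
      using K_expand_up[OF iI f[OF i]] by blast
    have "c dvd l a" if "a \<in> A" for a using up[OF that, of c] all_dvd by blast
    then have "\<forall>a\<in>A. \<exists>q. l a = c * q" by (auto simp: dvd_def)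
    from bchoice[OF this] obtain q where q: "\<And>a. a \<in> A \<Longrightarrow> l a = c * q a" by blast
    have "(\<Sum>a\<in>A. qscalar (q a) \<star> Edom i a) \<in> Ki i"
      unfolding Kiq_def by (intro qsubalgebra_sum qsubalgebra_scale) (use A(2) Edom_in_K in \<open>auto simp: Kiq_def\<close>)
    moreover have "f = qscalar c \<star> (\<Sum>a\<in>A. qscalar (q a) \<star> Edom i a)"
      unfolding f_eq qtimes_sum_right by (intro sum.cong refl) (simp add: q qscalar_times_assoc)
    ultimately show ?thesis by blast
  qed
  obtain i0 where "i0 \<in> J" using J(2) by blast
  then obtain g where g: "g \<in> Ki i0" "f = qscalar c \<star> g" using ex by blast
  have "g \<in> Ki i" if i: "i \<in> J" for i
  proof -
    obtain g' where g': "g' \<in> Ki i" "f = qscalar c \<star> g'" using ex[OF i] by blast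
    have "g' = g"
    proof (rule poly_mapping_eqI)
      fix m
      have "c * lookup g' m = c * lookup g m" using g(2) g'(2) by (metis lookup_qscalar_times)
      then show "lookup g' m = lookup g m" using c by (rule laurent_mult_left_cancel[rotated])
    qed
    then show ?thesis using g' by simp
  qed
  then show ?thesis using that g(2) by blast
qed

section \<open>Lengths of classical weights\<close>

definition weight :: "monom \<Rightarrow> nat \<Rightarrow> real" where
  "weight m = (SOME y. \<forall>w. Bf y w = pairing m w)"

lemma Bf_weight:
  assumes "keys m \<subseteq> I \<times> UNIV"
  shows "Bf (weight m) w = pairing m w"
proof -
  define \<phi> where "\<phi> i = (\<Sum>x\<in>{x \<in> keys m. fst x = i}. real_of_int (lookup m x) * \<kappa> i)" for i
  have "pairing m w = (\<Sum>i\<in>I. \<phi> i * w i)" for w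
  proof -
    have "pairing m w = (\<Sum>i\<in>I. \<Sum>x\<in>{x \<in> keys m. fst x = i}. real_of_int (lookup m x) * (\<kappa> (fst x) * w (fst x)))"
      unfolding pairing_def by (rule sum.group[symmetric]) (use assms in auto)
    also have "\<dots> = (\<Sum>i\<in>I. \<phi> i * w i)"
      unfolding \<phi>_def sum_distrib_right by (intro sum.cong refl) auto
    finally show ?thesis .
  qed
  then have "\<exists>y. \<forall>w. Bf y w = pairing m w" using Bf_represent[of \<phi>] by simp
  then show ?thesis unfolding weight_def by (rule someI2_ex) blast
qed

definition qnorm :: "monom \<Rightarrow> real" where
  "qnorm m = Bf (weight m) (weight m)"

lemma qnorm_eqI:
  assumes "keys m \<subseteq> I \<times> UNIV" "\<And>w. Bf y w = pairing m w"
  shows "qnorm m = Bf y y"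
  unfolding qnorm_def by (metis Bf_sym Bf_weight assms)

text \<open>The form is nonnegative at the weight of \<open>m\<close> plus \<open>rho\<close>; in
  its expansion the cross term is twice the height.\<close>

lemma ht_lower_bound:
  assumes "keys m \<subseteq> I \<times> UNIV"
  shows "ht m \<ge> - (qnorm m + Bf rho rho) / 2"
proof -
  have "0 \<le> Bf (\<lambda>i. weight m i - (- rho i)) (\<lambda>i. weight m i - (- rho i))" by (rule Bf_nonneg)
  also have "\<dots> = qnorm m - 2 * Bf (weight m) (\<lambda>i. - rho i) + Bf (\<lambda>i. - rho i) (\<lambda>i. - rho i)"
    unfolding Bf_diff qnorm_def ..
  also have "\<dots> = qnorm m + 2 * Bf (weight m) rho + Bf rho rho" by (simp add: Bf_def sum_negf)
  also have "Bf (weight m) rho = ht m" unfolding ht_def by (rule Bf_weight[OF assms])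
  finally show ?thesis by simp
qed

lemma keys_Bs: "set_mset V \<subseteq> I \<times> UNIV \<Longrightarrow> keys (Bs V) \<subseteq> I \<times> UNIV"
  using lookup_Bs_outside[of V] by (fastforce simp: in_keys_iff)

lemma keys_below: "keys a \<subseteq> I \<times> UNIV \<Longrightarrow> below a m \<Longrightarrow> keys m \<subseteq> I \<times> UNIV"
  unfolding below_def using keys_diff keys_Bs by blast

text \<open>Let \<open>u\<close> be the total exponent of colour \<open>i\<close> in
  \<open>a\<close>. Subtracting \<open>b\<close> times the simple root of \<open>i\<close> changes
  the squared length by \<open>- 2 * \<kappa> i * b * (u - b)\<close>, and an \<open>istep\<close>
  has \<open>0 \<le> b \<le> u\<close>: the weight stays between the old one and its
  reflection.\<close>

lemma istep_qnorm:
  assumes i: "i \<in> I" and step: "istep i a m"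
  shows "qnorm m \<le> qnorm a"
proof -
  obtain W where W: "set_mset W \<subseteq> {i} \<times> UNIV" "\<And>l. int (count W (i, l + 1)) \<le> lookup a (i, l)" "m = a - Bs W"
    and dom: "idom i a" using step by (auto simp: istep_def)
  have WI: "set_mset W \<subseteq> I \<times> UNIV" using W(1) i by auto
  have keys_a: "keys a \<subseteq> I \<times> UNIV" using dom Delta0_sub by (auto simp: idom_def)
  have keys_m: "keys m \<subseteq> I \<times> UNIV" using keys_below[OF keys_a] WI W(3) by (auto simp: below_def)
  define b where "b = real (size W)"
  have pairing_Bs: "pairing (Bs V) w = real (size V) * Bf w (unit i)" if "set_mset V \<subseteq> {i} \<times> UNIV" for V w
    using that
  proof (induction V)
    case (add x V)
    then have x: "fst x = i" by auto
    have "pairing (B x) w = Bf w (unit i)" unfolding x by (rule pairing_B[OF i])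
    then show ?case using add by (simp add: pairing_add distrib_right)
  qed simp
  let ?y = "\<lambda>j. weight a j - b * unit i j"
  have lin: "Bf ?y w = Bf (weight a) w - b * Bf (unit i) w" for w
    unfolding Bf_def sum_distrib_left sum_subtractf[symmetric] by (intro sum.cong refl) (simp add: algebra_simps)
  have "Bf ?y w = pairing m w" for w
    unfolding lin Bf_weight[OF keys_a] W(3) pairing_diff pairing_Bs[OF W(1)]
    by (simp add: b_def Bf_sym[of "unit i" w])
  then have "qnorm m = Bf ?y ?y" by (rule qnorm_eqI[OF keys_m])
  also have "\<dots> = Bf (weight a) ?y - b * Bf (unit i) ?y" by (rule lin)
  also have "\<dots> = qnorm a - 2 * b * Bf (weight a) (unit i) + b * b * Bf (unit i) (unit i)"
    unfolding Bf_sym[of "weight a" ?y] Bf_sym[of "unit i" ?y] lin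
    by (simp add: qnorm_def Bf_sym[of "unit i" "weight a"] algebra_simps)
  also have "Bf (unit i) (unit i) = 2 * \<kappa> i"
    unfolding Bf_unit[OF i] using i C_diag[OF i] by (simp add: unit_def if_distrib[of "\<lambda>x. _ * x"] cong: if_cong)
  also have "Bf (weight a) (unit i) = \<kappa> i * (\<Sum>x\<in>{x \<in> keys a. fst x = i}. lookup a x)"
  proof -
    have "pairing a (unit i) = (\<Sum>x\<in>keys a. if fst x = i then \<kappa> i * lookup a x else 0)"
      unfolding pairing_def by (intro sum.cong refl) (auto simp: unit_def)
    also have "\<dots> = (\<Sum>x\<in>{x \<in> keys a. fst x = i}. \<kappa> i * lookup a x)"
      by (simp add: sum.inter_filter)
    finally show ?thesis unfolding Bf_weight[OF keys_a] by (simp add: sum_distrib_left)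
  qed
  finally have "qnorm m = qnorm a - 2 * \<kappa> i * b * ((\<Sum>x\<in>{x \<in> keys a. fst x = i}. lookup a x) - b)"
    by (simp add: algebra_simps)
  moreover have "b \<le> (\<Sum>x\<in>{x \<in> keys a. fst x = i}. lookup a x)"
  proof -
    \<comment> \<open>Each \<open>B\<close> of column \<open>s\<close> is charged to the variable in
      column \<open>s - 1\<close>.\<close>
    let ?h = "\<lambda>x :: vertex. (fst x, snd x - 1)"
    have cnt: "int (count W x) \<le> lookup a (?h x)" if "x \<in># W" for x
    proof -
      have "x = (i, (snd x - 1) + 1)" "?h x = (i, snd x - 1)" using that W(1) by auto
      then show ?thesis using W(2)[of "snd x - 1"] by simp
    qed
    have "int (size W) = (\<Sum>x\<in>set_mset W. int (count W x))" by (simp add: size_multiset_overloaded_eq)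
    also have "\<dots> \<le> (\<Sum>x\<in>set_mset W. lookup a (?h x))" by (intro sum_mono cnt)
    also have "\<dots> = (\<Sum>x\<in>?h ` set_mset W. lookup a x)"
      by (subst sum.reindex) (auto simp: inj_on_def prod_eq_iff)
    also have "\<dots> \<le> (\<Sum>x\<in>{x \<in> keys a. fst x = i}. lookup a x)"
    proof (rule sum_mono2)
      show "?h ` set_mset W \<subseteq> {x \<in> keys a. fst x = i}"
      proof
        fix y assume "y \<in> ?h ` set_mset W"
        then obtain x where x: "x \<in># W" "y = ?h x" by blast
        then have "lookup a y \<noteq> 0" using cnt[OF x(1)] by (metis count_greater_zero_iff not_less of_nat_0_less_iff)
        then show "y \<in> {x \<in> keys a. fst x = i}" using x W(1) by (auto simp: in_keys_iff)
      qed
      show "0 \<le> lookup a x" if "x \<in> {x \<in> keys a. fst x = i} - ?h ` set_mset W" for x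
        using that dom by (cases x) (auto simp: idom_def)
    qed simp
    finally show ?thesis unfolding b_def by linarith
  qed
  moreover have "0 \<le> b" "0 < \<kappa> i" using \<kappa>_pos[OF i] by (simp_all add: b_def)
  ultimately show ?thesis by simp
qed

lemma isteps_qnorm:
  assumes "(istep i)\<^sup>*\<^sup>* a m" "i \<in> I"
  shows "qnorm m \<le> qnorm a"
  using assms(1) by induction (use istep_qnorm[OF assms(2)] order_trans in blast)+

section \<open>Rank two\<close>

definition lead :: "qtorus \<Rightarrow> monom \<Rightarrow> bool" where
  "lead f m \<longleftrightarrow> lookup f m = 1 \<and> (\<forall>m'\<in>keys f. below m m')"

lemma lookup_qtimes_pair:
  assumes "\<And>a b. \<lbrakk>a \<in> keys f; b \<in> keys g; a + b = m\<rbrakk> \<Longrightarrow> a = a0 \<and> b = b0" and "a0 + b0 = m"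
  shows "lookup (f \<star> g) m = vpow (mform N a0 b0) * lookup f a0 * lookup g b0"
proof -
  have "lookup (f \<star> g) m = (\<Sum>a\<in>keys f. \<Sum>b\<in>keys g.
      if a = a0 then if b = b0 then vpow (mform N a0 b0) * lookup f a0 * lookup g b0 else 0 else 0)"
    unfolding lookup_qtimes[OF finite_keys finite_keys subset_refl subset_refl]
  proof (intro sum.cong refl)
    fix a b assume ab: "a \<in> keys f" "b \<in> keys g"
    show "(if a + b = m then vpow (mform N a b) * lookup f a * lookup g b else 0) =
      (if a = a0 then if b = b0 then vpow (mform N a0 b0) * lookup f a0 * lookup g b0 else 0 else 0)"
    proof (cases "a + b = m")
      case True
      then have "a = a0 \<and> b = b0" using assms(1) ab by blast
      then show ?thesis using True by simp
    next
      case False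
      then have "\<not> (a = a0 \<and> b = b0)" using assms(2) by blast
      then show ?thesis using False by auto
    qed
  qed
  also have "\<dots> = (\<Sum>a\<in>keys f. if a = a0 then \<Sum>b\<in>keys g.
      if b = b0 then vpow (mform N a0 b0) * lookup f a0 * lookup g b0 else 0 else 0)"
    by (intro sum.cong refl) auto
  also have "\<dots> = vpow (mform N a0 b0) * lookup f a0 * lookup g b0"
    by (auto simp: in_keys_iff)
  finally show ?thesis .
qed

lemma below_add: "below a a' \<Longrightarrow> below b b' \<Longrightarrow> below (a + b) (a' + b')"
  unfolding below_def
proof safe
  fix V W :: "vertex multiset" assume "set_mset V \<subseteq> I \<times> UNIV" "set_mset W \<subseteq> I \<times> UNIV"
  then show "\<exists>U. set_mset U \<subseteq> I \<times> UNIV \<and> a - Bs V + (b - Bs W) = a + b - Bs U"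
    by (intro exI[of _ "V + W"]) (auto simp: Bs_union)
qed

lemma below_add_eq:
  assumes "below a a'" "below b b'" "a' + b' = a + b"
  shows "a' = a \<and> b' = b"
proof -
  obtain V W where V: "set_mset V \<subseteq> I \<times> UNIV" "a' = a - Bs V"
    and W: "set_mset W \<subseteq> I \<times> UNIV" "b' = b - Bs W"
    using assms(1,2) by (auto simp: below_def)
  have "Bs (V + W) = 0" using assms(3) V W by (simp add: Bs_union algebra_simps)
  then have "V + W = {#}" using V W by (intro Bs_eq_0) auto
  then show ?thesis using V W by simp
qed

lemma lead_mult:
  assumes "lead f a" "lead g b"
  shows "lead (qscalar (vpow (- mform N a b)) \<star> (f \<star> g)) (a + b)"
proof -
  have "lookup (f \<star> g) (a + b) = vpow (mform N a b) * lookup f a * lookup g b"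
    by (rule lookup_qtimes_pair) (use assms below_add_eq in \<open>auto simp: lead_def\<close>)
  then have "lookup (qscalar (vpow (- mform N a b)) \<star> (f \<star> g)) (a + b) = 1"
    using assms by (simp add: lookup_qscalar_times lead_def vpow_unit)
  moreover have "below (a + b) m" if "m \<in> keys (qscalar (vpow (- mform N a b)) \<star> (f \<star> g))" for m
  proof -
    have "m \<in> keys (f \<star> g)" using that by (auto simp: in_keys_iff lookup_qscalar_times)
    then obtain a' b' where "a' \<in> keys f" "b' \<in> keys g" "m = a' + b'" using keys_qtimes by blast
    then show ?thesis using assms below_add by (simp add: lead_def)
  qed
  ultimately show ?thesis by (simp add: lead_def)
qed

definition leads :: "nat \<Rightarrow> nat \<Rightarrow> monom \<Rightarrow> bool" where
  "leads i j m \<longleftrightarrow> (\<exists>f. f \<in> Ki i \<and> f \<in> Ki j \<and> lead f m)"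

lemma leads_sym: "leads i j m \<Longrightarrow> leads j i m"
  by (auto simp: leads_def)

lemma leads_add:
  assumes "leads i j a" "leads i j b"
  shows "leads i j (a + b)"
proof -
  obtain f g where "f \<in> Ki i" "f \<in> Ki j" "lead f a" "g \<in> Ki i" "g \<in> Ki j" "lead g b"
    using assms by (auto simp: leads_def)
  then show ?thesis unfolding leads_def
    by (intro exI[of _ "qscalar (vpow (- mform N a b)) \<star> (f \<star> g)"] conjI lead_mult)
      (auto simp: Kiq_def intro: qsubalgebra_scale qsubalgebra.times)
qed

lemma leads_colorless:
  assumes "colorless i m" "colorless j m"
  shows "leads i j m"
  unfolding leads_def
  by (intro exI[of _ "single m 1"]) (auto simp: single_in_K assms lead_def)

text \<open>Leading monomials multiply, so single variables suffice: those of colours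
  \<open>i\<close> and \<open>j\<close> occur with nonnegative exponents and are covered by
  \<open>fund\<close>, the others are units in both algebras.\<close>

lemma leads_dominant:
  assumes fund: "\<And>k l. k \<in> {i, j} \<Longrightarrow> (k, l) \<in> Delta0 n C \<Longrightarrow> leads i j (X (k, l))"
    and m: "idom i m" "idom j m"
  shows "leads i j m"
proof -
  have zero: "leads i j 0" by (rule leads_colorless) (auto simp: colorless_def)
  have one: "leads i j (single x (lookup m x))" if x: "x \<in> keys m" for x
  proof -
    obtain k l where kl: "x = (k, l)" by (cases x)
    have D: "(k, l) \<in> Delta0 n C" using x m kl by (auto simp: idom_def)
    show ?thesis
    proof (cases "k \<in> {i, j}")
      case True
      have pow: "leads i j (single x (int u))" for u
      proof (induction u)
        case (Suc u)
        have "leads i j (X x + single x (int u))" using leads_add fund[OF True D] Suc kl by blast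
        then show ?case by (simp add: single_add[symmetric])
      qed (simp add: zero)
      have "lookup m x \<ge> 0" using m True kl by (auto simp: idom_def)
      then show ?thesis using pow[of "nat (lookup m x)"] by simp
    next
      case False
      then show ?thesis using D kl
        by (intro leads_colorless) (auto simp: colorless_def lookup_single when_def)
    qed
  qed
  have "leads i j (\<Sum>x\<in>A. single x (lookup m x))" if "finite A" "A \<subseteq> keys m" for A
    using that by induction (auto simp: zero one leads_add)
  from this[of "keys m"] show ?thesis by (simp add: sum_single_lookup)
qed

lemma lead_Gen:
  assumes "i \<in> I"
  shows "lead (Gen i l) (X (i, l))"
proof -
  have "B (i, l + 1) \<noteq> 0"
  proof
    assume "B (i, l + 1) = 0"
    then have "Bs {#(i, l + 1)#} = 0" by simp
    then show False using Bs_eq_0[of "{#(i, l + 1)#}"] assms by simp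
  qed
  then have "lookup (Gen i l) (X (i, l)) = 1"
    by (simp add: Gen_def lookup_add lookup_single when_def)
  moreover have "below (X (i, l)) m" if "m \<in> keys (Gen i l)" for m
    using keys_Gen[OF that]
  proof
    assume "m = X (i, l) - B (i, l + 1)"
    then show ?thesis unfolding below_def using assms by (intro exI[of _ "{#(i, l + 1)#}"]) simp
  qed simp
  ultimately show ?thesis by (simp add: lead_def)
qed

section \<open>Fundamental elements for two colours\<close>

lemma binomial_product:
  "(single a1 1 + single a2 1) \<star> (single b1 1 + single b2 1) =
      single (a1 + b1) (vpow (mform N a1 b1)) + single (a1 + b2) (vpow (mform N a1 b2)) +
      single (a2 + b1) (vpow (mform N a2 b1)) + single (a2 + b2) (vpow (mform N a2 b2))"
  by (simp add: qtimes_add_left qtimes_add_right qtimes_single)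

text \<open>A colourless monomial times one generator. Colourless monomials pair to zero with the
  \<open>B\<close>'s of colour \<open>i\<close>, so both terms receive the same power of q.\<close>

lemma K_string1:
  assumes keys: "keys m \<subseteq> Delta0 n C" and i: "i \<in> I" and m: "\<And>p. lookup m (i, p) = of_bool (p = l)"
  shows "single m 1 + single (m - Bmonom n C i (l + 1)) 1 \<in> Ki i"
proof -
  have D: "(i, l) \<in> Delta0 n C" using m[of l] keys by (auto simp: in_keys_iff)
  define \<mu> where "\<mu> = m - X (i, l)"
  have \<mu>: "colorless i \<mu>" unfolding colorless_def \<mu>_def
    using keys_diff[of m "X (i, l)"] keys D m by (auto simp: lookup_minus lookup_single when_def)
  have "qscalar (vpow (- mform N \<mu> (X (i, l)))) \<star> (single \<mu> 1 \<star> Gen i l) \<in> Ki i"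
    using single_in_K[OF \<mu>] Gen_in_K[OF D] unfolding Kiq_def by (intro qsubalgebra_scale qsubalgebra.times)
  also have "qscalar (vpow (- mform N \<mu> (X (i, l)))) \<star> (single \<mu> 1 \<star> Gen i l) =
      single m 1 + single (m - Bmonom n C i (l + 1)) 1"
    by (simp add: Gen_def qtimes_add_right qtimes_single qscalar_single mform_diff_right
        mform_colorless_B[OF \<mu> i] vpow_unit) (simp add: \<mu>_def)
  finally show ?thesis .
qed

text \<open>A colourless monomial times the square of \<open>Gen i l\<close>. The two mixed terms
  fall on the same monomial with opposite powers of q and add up to the quantum integer
  \<open>q_i + q_i^-1\<close>.\<close>

lemma K_string2:
  assumes keys: "keys m \<subseteq> Delta0 n C" and i: "i \<in> I" and m: "\<And>p. lookup m (i, p) = 2 * of_bool (p = l)"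
  shows "single m 1 + single (m - Bmonom n C i (l + 1)) (vpow (2 * d i) + vpow (- 2 * d i)) +
    single (m - Bmonom n C i (l + 1) - Bmonom n C i (l + 1)) 1 \<in> Ki i"
proof -
  have D: "(i, l) \<in> Delta0 n C" using m[of l] keys by (auto simp: in_keys_iff)
  let ?x = "X (i, l)" and ?b = "Bmonom n C i (l + 1)"
  define \<mu> where "\<mu> = m - ?x - ?x"
  have \<mu>: "colorless i \<mu>" unfolding colorless_def \<mu>_def
    using keys_diff[of m ?x] keys_diff[of "m - ?x" ?x] keys D m by (auto simp: lookup_minus lookup_single when_def)
  define e where "e = mform N \<mu> (?x + ?x)"
  have xb: "mform N ?x ?b = - 2 * d i" using mform_X_Bmonom[OF i i, of l "l + 1"] by simp
  then have bx: "mform N ?b ?x = 2 * d i" using mform_skew[of ?b ?x] by simp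
  have forms: "mform N ?x (?x - ?b) = 2 * d i" "mform N (?x - ?b) ?x = - 2 * d i"
    by (simp_all add: mform_diff_left mform_diff_right xb bx)
  have GG: "Gen i l \<star> Gen i l = single (?x + ?x) 1 +
      single (?x + ?x - ?b) (vpow (2 * d i) + vpow (- 2 * d i)) + single (?x + ?x - ?b - ?b) 1"
    by (simp only: Gen_def binomial_product fst_conv snd_conv forms mform_self)
      (simp add: single_add algebra_simps)
  have "qscalar (vpow (- e)) \<star> (single \<mu> 1 \<star> (Gen i l \<star> Gen i l)) \<in> Ki i"
    using single_in_K[OF \<mu>] Gen_in_K[OF D] unfolding Kiq_def by (intro qsubalgebra_scale qsubalgebra.times)
  also have "qscalar (vpow (- e)) \<star> (single \<mu> 1 \<star> (Gen i l \<star> Gen i l)) =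
      single (\<mu> + (?x + ?x)) 1 + single (\<mu> + (?x + ?x - ?b)) (vpow (2 * d i) + vpow (- 2 * d i)) +
      single (\<mu> + (?x + ?x - ?b - ?b)) 1"
    unfolding GG
    by (simp add: qtimes_add_right qtimes_single qscalar_single mform_diff_right
        mform_colorless_B[OF \<mu> i] flip: e_def mult.assoc) (simp add: vpow_unit)
  also have "\<mu> + (?x + ?x) = m" by (simp add: \<mu>_def)
  also have "\<mu> + (?x + ?x - ?b) = m - ?b" by (simp add: \<mu>_def)
  also have "\<mu> + (?x + ?x - ?b - ?b) = m - ?b - ?b" by (simp add: \<mu>_def)
  finally show ?thesis .
qed

lemma K_add: "f \<in> Ki i \<Longrightarrow> g \<in> Ki i \<Longrightarrow> f + g \<in> Ki i"
  unfolding Kiq_def by (rule qsubalgebra.add)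

lemma keys_Bs_Delta0:
  assumes "\<forall>(j, s)\<in>#V. (j, s - 1) \<in> Delta0 n C"
  shows "keys (Bs V) \<subseteq> Delta0 n C"
  using assms
proof (induction V)
  case (add x V)
  then have "keys (B x) \<subseteq> Delta0 n C" using keys_B[of "fst x" "snd x"] by (auto split: prod.splits)
  then show ?case using add Poly_Mapping.keys_add[of "B x" "Bs V"] by auto
qed simp

text \<open>The fundamental element of \<open>\<K>\<^sub>i \<inter> \<K>\<^sub>j\<close> at the node with \<open>c\<^sub>j\<^sub>i = -1\<close>; it has 3, 4 or 7
  terms in types \<open>A\<^sub>2\<close>, \<open>B\<^sub>2\<close>, \<open>G\<^sub>2\<close>.\<close>

lemma rank2_short:
  assumes adj: "adj i j" and Cji: "C j i = - 1" and D: "(i, p) \<in> Delta0 n C"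
  shows "\<exists>R. single (X (i, p)) 1 + single (X (i, p) - Bs {#(i, p + 1)#}) 1 + R \<in> Ki i \<inter> Ki j \<and>
    (\<forall>m\<in>keys R. \<exists>V. m = X (i, p) - Bs V \<and> set_mset V \<subseteq> {i, j} \<times> UNIV \<and>
      (i, p + 1) \<in># V \<and> (j, p + 2) \<in># V)"
proof -
  have ij: "i \<in> I" "j \<in> I" "i \<noteq> j" using adj by (auto simp: adj_def)
  have Cij: "C i j = - 1 \<or> C i j = - 2 \<or> C i j = - 3" using adj_cases[OF adj] Cji by auto
  define t where "t V = X (i, p) - Bs V" for V
  have D': "(i, p + 2) \<in> Delta0 n C" "(i, p + 4) \<in> Delta0 n C" "(j, p + 1) \<in> Delta0 n C" "(j, p + 3) \<in> Delta0 n C"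
    using D Delta0_adj(1)[OF D adj] by (simp_all add: Delta0_iff)
  have keys_t: "keys (t V) \<subseteq> Delta0 n C"
    if "set_mset V \<subseteq> {(i, p + 1), (j, p + 2), (i, p + 3), (j, p + 4), (i, p + 5)}" for V
  proof -
    have "keys (Bs V) \<subseteq> Delta0 n C"
    proof (rule keys_Bs_Delta0, rule ballI)
      fix x assume "x \<in># V"
      then have "x \<in> {(i, p + 1), (j, p + 2), (i, p + 3), (j, p + 4), (i, p + 5)}" using that by blast
      then show "case x of (j, s) \<Rightarrow> (j, s - 1) \<in> Delta0 n C" using D D' by (auto simp: add.commute)
    qed
    then show ?thesis using keys_diff[of "X (i, p)" "Bs V"] D by (auto simp: t_def)
  qed
  have t_add: "t V - Bmonom n C k s = t (add_mset (k, s) V)" for V k s by (simp add: t_def algebra_simps)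
  note lk = t_def lookup_minus lookup_add lookup_B ij ij(3)[symmetric] lookup_single when_def Aoff_def Cji
  \<comment> \<open>The monomials of the seven-term element. Type \<open>A_2\<close> stops at
    \<open>?t2\<close> and type \<open>B_2\<close> at \<open>?t3\<close>. The terms are grouped into
    strings of colour \<open>i\<close> for membership in \<open>Ki i\<close> and into strings of
    colour \<open>j\<close> for \<open>Ki j\<close>.\<close>
  let ?t0 = "t {#}" and ?t1 = "t {#(i, p + 1)#}" and ?t2 = "t {#(j, p + 2), (i, p + 1)#}"
    and ?t3 = "t {#(i, p + 3), (j, p + 2), (i, p + 1)#}"
    and ?t4 = "t {#(i, p + 3), (i, p + 3), (j, p + 2), (i, p + 1)#}"
    and ?t5 = "t {#(j, p + 4), (i, p + 3), (i, p + 3), (j, p + 2), (i, p + 1)#}"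
    and ?t6 = "t {#(i, p + 5), (j, p + 4), (i, p + 3), (i, p + 3), (j, p + 2), (i, p + 1)#}"
  have i01: "single ?t0 1 + single ?t1 1 \<in> Ki i"
    using K_string1[of ?t0 i p] keys_t[of "{#}"] ij unfolding t_add by (auto simp: lk)
  have j0: "single ?t0 1 \<in> Ki j"
    using keys_t[of "{#}"] ij by (intro single_in_K) (auto simp: colorless_def lk)
  have j12: "single ?t1 1 + single ?t2 1 \<in> Ki j"
  proof -
    have "single ?t1 1 + single (?t1 - Bmonom n C j (p + 1 + 1)) 1 \<in> Ki j"
      by (rule K_string1) (use keys_t[of "{#(i, p + 1)#}"] ij in \<open>auto simp: lk\<close>)
    then show ?thesis unfolding t_add by (simp add: add.assoc)
  qed
  have shape: "\<exists>V'. t V = X (i, p) - Bs V' \<and> set_mset V' \<subseteq> {i, j} \<times> UNIV \<and> (i, p + 1) \<in># V' \<and> (j, p + 2) \<in># V'"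
    if "set_mset V \<subseteq> {i, j} \<times> UNIV" "(i, p + 1) \<in># V" "(j, p + 2) \<in># V" for V
    using that by (auto simp: t_def)
  have conclude: ?thesis
    if R: "single ?t0 1 + single ?t1 1 + R \<in> Ki i" "single ?t0 1 + single ?t1 1 + R \<in> Ki j"
      and keys: "keys R \<subseteq> {?t2, ?t3, ?t4, ?t5, ?t6}" for R
  proof (intro exI[of _ R] conjI ballI)
    have "X (i, p) = ?t0" "X (i, p) - Bs {#(i, p + 1)#} = ?t1" by (simp_all add: t_def)
    then show "single (X (i, p)) 1 + single (X (i, p) - Bs {#(i, p + 1)#}) 1 + R \<in> Ki i \<inter> Ki j"
      using R by simp
    fix m assume "m \<in> keys R"
    then have "m = ?t2 \<or> m = ?t3 \<or> m = ?t4 \<or> m = ?t5 \<or> m = ?t6" using keys by blast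
    then show "\<exists>V. m = X (i, p) - Bs V \<and> set_mset V \<subseteq> {i, j} \<times> UNIV \<and> (i, p + 1) \<in># V \<and> (j, p + 2) \<in># V"
      by (elim disjE; simp only:; intro shape; simp)
  qed
  from Cij show ?thesis
  proof (elim disjE)
    assume C: "C i j = - 1"
    have "single ?t2 1 \<in> Ki i"
      using keys_t[of "{#(j, p + 2), (i, p + 1)#}"] ij by (intro single_in_K) (auto simp: colorless_def lk C)
    then have "single ?t0 1 + single ?t1 1 + single ?t2 1 \<in> Ki i" using i01 by (rule K_add[rotated])
    moreover have "single ?t0 1 + single ?t1 1 + single ?t2 1 \<in> Ki j"
      using K_add[OF j0 j12] by (simp add: add.assoc)
    ultimately show ?thesis by (rule conclude) simp
  next
    assume C: "C i j = - 2"
    have i23: "single ?t2 1 + single ?t3 1 \<in> Ki i"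
    proof -
      have "single ?t2 1 + single (?t2 - Bmonom n C i (p + 2 + 1)) 1 \<in> Ki i"
        by (rule K_string1) (use keys_t[of "{#(j, p + 2), (i, p + 1)#}"] ij in \<open>auto simp: lk C\<close>)
      then show ?thesis unfolding t_add by (simp add: add.assoc)
    qed
    have "single ?t3 1 \<in> Ki j"
      using keys_t[of "{#(i, p + 3), (j, p + 2), (i, p + 1)#}"] ij by (intro single_in_K) (auto simp: colorless_def lk C)
    then have "single ?t0 1 + single ?t1 1 + (single ?t2 1 + single ?t3 1) \<in> Ki j"
      using K_add[OF K_add[OF j0 j12]] by (simp add: add.assoc)
    moreover have "single ?t0 1 + single ?t1 1 + (single ?t2 1 + single ?t3 1) \<in> Ki i"
      using K_add[OF i01 i23] .
    ultimately show ?thesis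
      using Poly_Mapping.keys_add[of "single ?t2 1 :: qtorus" "single ?t3 1"] by (intro conclude) auto
  next
    assume C: "C i j = - 3"
    \<comment> \<open>For \<open>C i j = - 3\<close> the monomial \<open>?t2\<close> contains the
      square of the variable at \<open>(i, p + 2)\<close>, hence starts a string with middle
      coefficient \<open>?q\<close>. For colour \<open>j\<close> that middle monomial
      \<open>?t3\<close> is colourless and may carry any coefficient.\<close>
    let ?q = "vpow (2 * d i) + vpow (- 2 * d i)"
    let ?R = "single ?t2 1 + (single ?t3 ?q + (single ?t4 1 + (single ?t5 1 + single ?t6 1)))"
    have i234: "single ?t2 1 + single ?t3 ?q + single ?t4 1 \<in> Ki i"
    proof -
      have "single ?t2 1 + single (?t2 - Bmonom n C i (p + 2 + 1)) ?q +
          single (?t2 - Bmonom n C i (p + 2 + 1) - Bmonom n C i (p + 2 + 1)) 1 \<in> Ki i"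
        by (rule K_string2) (use keys_t[of "{#(j, p + 2), (i, p + 1)#}"] ij in \<open>auto simp: lk C\<close>)
      then show ?thesis unfolding t_add by (simp add: add.assoc)
    qed
    have i56: "single ?t5 1 + single ?t6 1 \<in> Ki i"
    proof -
      have "single ?t5 1 + single (?t5 - Bmonom n C i (p + 4 + 1)) 1 \<in> Ki i"
        by (rule K_string1)
          (use keys_t[of "{#(j, p + 4), (i, p + 3), (i, p + 3), (j, p + 2), (i, p + 1)#}"] ij in \<open>auto simp: lk C\<close>)
      then show ?thesis unfolding t_add by (simp add: add.assoc)
    qed
    have j3: "single ?t3 ?q \<in> Ki j"
      using keys_t[of "{#(i, p + 3), (j, p + 2), (i, p + 1)#}"] ij by (intro single_in_K) (auto simp: colorless_def lk C)
    have j45: "single ?t4 1 + single ?t5 1 \<in> Ki j"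
    proof -
      have "single ?t4 1 + single (?t4 - Bmonom n C j (p + 3 + 1)) 1 \<in> Ki j"
        by (rule K_string1)
          (use keys_t[of "{#(i, p + 3), (i, p + 3), (j, p + 2), (i, p + 1)#}"] ij in \<open>auto simp: lk C\<close>)
      then show ?thesis unfolding t_add by (simp add: add.assoc)
    qed
    have j6: "single ?t6 1 \<in> Ki j"
      using keys_t[of "{#(i, p + 5), (j, p + 4), (i, p + 3), (i, p + 3), (j, p + 2), (i, p + 1)#}"] ij
      by (intro single_in_K) (auto simp: colorless_def lk C)
    have "single ?t0 1 + single ?t1 1 + ?R \<in> Ki i"
      using K_add[OF i01 K_add[OF i234 i56]] by (simp add: add.assoc)
    moreover have "single ?t0 1 + single ?t1 1 + ?R \<in> Ki j"
      using K_add[OF j0 K_add[OF j12 K_add[OF j3 K_add[OF j45 j6]]]] by (simp add: add.assoc)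
    moreover have "keys ?R \<subseteq> {?t2, ?t3, ?t4, ?t5, ?t6}"
      using Poly_Mapping.keys_add[of "single ?t2 1 :: qtorus"]
        Poly_Mapping.keys_add[of "single ?t3 ?q" "single ?t4 1 + (single ?t5 1 + single ?t6 1)"]
        Poly_Mapping.keys_add[of "single ?t4 1 :: qtorus" "single ?t5 1 + single ?t6 1"]
        Poly_Mapping.keys_add[of "single ?t5 1 :: qtorus" "single ?t6 1"]
      by (fastforce split: if_splits)
    ultimately show ?thesis by (rule conclude)
  qed
qed

text \<open>By injectivity of \<open>Bs\<close> the further terms do not meet the first two
  monomials. The coefficients of these two are what the q-commutator in \<open>rank2_long\<close> is
  computed from.\<close>

lemma rank2_short_expanded:
  assumes "adj i j" "C j i = - 1" "(i, p) \<in> Delta0 n C"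
  obtains F where "F \<in> Ki i" "F \<in> Ki j" "lookup F (X (i, p)) = 1" "lookup F (X (i, p) - Bs {#(i, p + 1)#}) = 1"
    "\<And>m. m \<in> keys F \<Longrightarrow> \<exists>V. m = X (i, p) - Bs V \<and> set_mset V \<subseteq> {i, j} \<times> UNIV \<and>
      (V = {#} \<or> V = {#(i, p + 1)#} \<or> (i, p + 1) \<in># V \<and> (j, p + 2) \<in># V)"
proof -
  have ij: "i \<in> I" "j \<in> I" "i \<noteq> j" using assms(1) by (auto simp: adj_def)
  let ?x = "X (i, p)" and ?b = "Bs {#(i, p + 1)#}"
  obtain R where R: "single ?x 1 + single (?x - ?b) 1 + R \<in> Ki i \<inter> Ki j"
    and keys_R: "\<And>m. m \<in> keys R \<Longrightarrow> \<exists>V. m = ?x - Bs V \<and> set_mset V \<subseteq> {i, j} \<times> UNIV \<and>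
      (i, p + 1) \<in># V \<and> (j, p + 2) \<in># V"
    using rank2_short[OF assms] by blast
  let ?F = "single ?x 1 + single (?x - ?b) 1 + R"
  have distinct: "Bs V \<noteq> Bs W" if "(j, p + 2) \<in># V" "set_mset V \<subseteq> {i, j} \<times> UNIV" "W \<in> {{#}, {#(i, p + 1)#}}" for V W
  proof
    assume "Bs V = Bs W"
    moreover have "set_mset V \<subseteq> I \<times> UNIV" "set_mset W \<subseteq> I \<times> UNIV" using that ij by auto
    ultimately have "V = W" by (intro Bs_inject)
    then show False using that(1,3) ij by auto
  qed
  have "lookup R (?x - Bs W) = 0" if W: "W \<in> {{#}, {#(i, p + 1)#}}" for W
  proof (rule ccontr)
    assume "lookup R (?x - Bs W) \<noteq> 0"
    then obtain V where "?x - Bs W = ?x - Bs V" "set_mset V \<subseteq> {i, j} \<times> UNIV" "(j, p + 2) \<in># V"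
      using keys_R[of "?x - Bs W"] by (auto simp: in_keys_iff)
    then show False using distinct[of V W] W by simp
  qed
  from this[of "{#}"] this[of "{#(i, p + 1)#}"] have R0: "lookup R ?x = 0" "lookup R (?x - ?b) = 0" by simp_all
  have b: "?b \<noteq> 0" using Bs_eq_0[of "{#(i, p + 1)#}"] ij by auto
  have x_b: "?x \<noteq> ?x - ?b" using b by (metis diff_zero add_diff_cancel_left' diff_add_cancel)
  show ?thesis
  proof (rule that[of ?F])
    show "?F \<in> Ki i" "?F \<in> Ki j" using R by simp_all
    show "lookup ?F ?x = 1" "lookup ?F (?x - ?b) = 1"
      using x_b by (simp_all only: lookup_add R0 lookup_single_eq lookup_single_not_eq[OF x_b]
          lookup_single_not_eq[OF x_b[symmetric]]) simp_all
    fix m assume "m \<in> keys ?F"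
    then have "m \<in> keys (single ?x (1::laurent)) \<or> m \<in> keys (single (?x - ?b) (1::laurent)) \<or> m \<in> keys R"
      using Poly_Mapping.keys_add[of "single ?x 1 + single (?x - ?b) 1" R]
        Poly_Mapping.keys_add[of "single ?x (1::laurent)" "single (?x - ?b) 1"] by blast
    then have "m = ?x - Bs {#} \<or> m = ?x - ?b \<or> m \<in> keys R" by auto
    then show "\<exists>V. m = ?x - Bs V \<and> set_mset V \<subseteq> {i, j} \<times> UNIV \<and>
      (V = {#} \<or> V = {#(i, p + 1)#} \<or> (i, p + 1) \<in># V \<and> (j, p + 2) \<in># V)"
    proof (elim disjE)
      assume "m = ?x - Bs {#}"
      then show ?thesis by (intro exI[of _ "{#}"]) simp
    next
      assume "m = ?x - ?b"
      then show ?thesis by (intro exI[of _ "{#(i, p + 1)#}"]) simp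
    next
      assume "m \<in> keys R"
      then show ?thesis using keys_R by blast
    qed
  qed
qed

text \<open>The other fundamental element is obtained by dividing the \<open>q\<close>-commutator of two
  neighbouring short ones by the coefficient of its leading monomial: by the rightmost-column
  argument, that monomial is the only \<open>{i, j}\<close>-dominant one.\<close>

lemma rank2_long:
  assumes adj: "adj i j" and Cji: "C j i = - 1" and D: "(j, p) \<in> Delta0 n C"
  shows "leads i j (X (j, p))"
proof -
  have ij: "i \<in> I" "j \<in> I" "i \<noteq> j" using adj by (auto simp: adj_def)
  have adj': "adj j i" using adj adj_sym by blast
  have Di: "(i, p - 1) \<in> Delta0 n C" "(i, p + 1) \<in> Delta0 n C" using Delta0_adj[OF D adj'] by simp_all
  let ?x = "X (i, p - 1)" and ?y = "X (i, p + 1)" and ?b = "Bmonom n C i p"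
  let ?good = "\<lambda>c V. set_mset V \<subseteq> {i, j} \<times> UNIV \<and>
      (V = {#} \<or> V = {#(i, c)#} \<or> (i, c) \<in># V \<and> (j, c + 1) \<in># V)"
  obtain F where F: "F \<in> Ki i" "F \<in> Ki j" "lookup F ?x = 1" "lookup F (?x - ?b) = 1"
    and keys_F: "\<And>m. m \<in> keys F \<Longrightarrow> \<exists>V. m = ?x - Bs V \<and> ?good p V"
    by (rule rank2_short_expanded[OF adj Cji Di(1)]) (simp add: add.commute)
  obtain G where G: "G \<in> Ki i" "G \<in> Ki j" "lookup G ?y = 1"
    and keys_G: "\<And>m. m \<in> keys G \<Longrightarrow> \<exists>V. m = ?y - Bs V \<and> ?good (p + 2) V"
    by (rule rank2_short_expanded[OF adj Cji Di(2)]) (simp add: add.commute)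
  define e where "e = mform N ?x ?y"
  \<comment> \<open>The power \<open>2 * e\<close> cancels the product of the two leading monomials.
    The next monomial \<open>?M\<close> survives with coefficient \<open>c\<close>, because
    \<open>?b\<close> pairs nontrivially with \<open>?y\<close>.\<close>
  define P where "P = F \<star> G - qscalar (vpow (2 * e)) \<star> (G \<star> F)"
  define c where "c = vpow (e + 2 * d i) - vpow (e - 2 * d i)"
  let ?M = "?x + ?y - ?b"
  have c: "c \<noteq> 0" using vpow_inject[of "e + 2 * d i" "e - 2 * d i"] d_pos[OF ij(1)] by (simp add: c_def)
  have pairs: "a = ?x - Bs V' \<and> b = ?y" if ab: "a \<in> keys F" "b \<in> keys G" "a + b = ?x + ?y - Bs V'"
    and V': "V' \<in> {{#}, {#(i, p)#}}" for a b V'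
  proof -
    obtain V where V: "a = ?x - Bs V" "?good p V" using keys_F[OF ab(1)] by blast
    obtain W where W: "b = ?y - Bs W" "?good (p + 2) W" using keys_G[OF ab(2)] by blast
    have "Bs (V + W) = Bs V'" using ab(3) V(1) W(1) by (simp add: Bs_union algebra_simps)
    moreover have "set_mset (V + W) \<subseteq> I \<times> UNIV" "set_mset V' \<subseteq> I \<times> UNIV" using V(2) W(2) V' ij by auto
    ultimately have VW: "V + W = V'" by (intro Bs_inject)
    have "W = {#}"
    proof (rule ccontr)
      assume "W \<noteq> {#}"
      then have "(i, p + 2) \<in># V'" using W(2) VW by auto
      then show False using V' by auto
    qed
    then show ?thesis using V(1) W(1) VW by simp
  qed
  have P_keys_in: "P \<in> Ki i" "P \<in> Ki j"
    using F G unfolding P_def Kiq_def by (auto intro!: qsubalgebra_diff qsubalgebra_scale qsubalgebra.times)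
  have lookup_P: "lookup P m = lookup (F \<star> G) m - vpow (2 * e) * lookup (G \<star> F) m" for m
    by (simp add: P_def lookup_minus lookup_qscalar_times)
  have yx: "mform N ?y ?x = - e" unfolding e_def by (rule mform_skew)
  have yb: "mform N ?y ?b = 2 * d i" using mform_X_Bmonom[OF ij(1,1), of "p + 1" p] by simp
  then have "mform N ?b ?y = - 2 * d i" using mform_skew[of ?b ?y] by simp
  then have forms: "mform N (?x - ?b) ?y = e + 2 * d i" "mform N ?y (?x - ?b) = - e - 2 * d i"
    by (simp_all add: mform_diff_left mform_diff_right yx yb e_def)
  have top: "lookup P (?x + ?y) = 0"
  proof -
    have "lookup (F \<star> G) (?x + ?y) = vpow (mform N ?x ?y) * lookup F ?x * lookup G ?y"
      by (rule lookup_qtimes_pair) (use pairs[of _ _ "{#}"] in auto)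
    moreover have "lookup (G \<star> F) (?x + ?y) = vpow (mform N ?y ?x) * lookup G ?y * lookup F ?x"
      by (rule lookup_qtimes_pair) (use pairs[of _ _ "{#}"] in \<open>auto simp: add.commute\<close>)
    ultimately show ?thesis unfolding lookup_P by (simp add: F G yx e_def[symmetric] flip: vpow_add)
  qed
  have coeff_M: "lookup P ?M = c"
  proof -
    have "lookup (F \<star> G) ?M = vpow (mform N (?x - ?b) ?y) * lookup F (?x - ?b) * lookup G ?y"
      by (rule lookup_qtimes_pair) (use pairs[of _ _ "{#(i, p)#}"] in auto)
    moreover have "lookup (G \<star> F) ?M = vpow (mform N ?y (?x - ?b)) * lookup G ?y * lookup F (?x - ?b)"
      by (rule lookup_qtimes_pair) (use pairs[of _ _ "{#(i, p)#}"] in \<open>auto simp: add.commute\<close>)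
    ultimately show ?thesis
      unfolding lookup_P by (simp add: F G forms c_def mult.assoc flip: vpow_add)
  qed
  \<comment> \<open>The rightmost column \<open>s\<close> of the divided-out \<open>B\<close>'s has
    to be compensated by \<open>?x\<close> or \<open>?y\<close> in column \<open>s + 1\<close>, so
    \<open>s \<le> p\<close>. Among the possible supports this leaves the empty one, excluded by
    \<open>top\<close>, and the single \<open>B\<close> at \<open>(i, p)\<close>.\<close>
  have dom: "m = ?M" if m: "idom i m" "idom j m" "lookup P m \<noteq> 0" for m
  proof -
    have "m \<in> keys (F \<star> G) \<or> m \<in> keys (G \<star> F)" using m(3) unfolding lookup_P by (auto simp: in_keys_iff)
    then obtain a b where ab: "a \<in> keys F" "b \<in> keys G" "m = a + b"
      using keys_qtimes[of m N F G] keys_qtimes[of m N G F] by (metis add.commute)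
    obtain V where V: "a = ?x - Bs V" "?good p V" using keys_F[OF ab(1)] by blast
    obtain W where W: "b = ?y - Bs W" "?good (p + 2) W" using keys_G[OF ab(2)] by blast
    define U where "U = V + W"
    have mU: "m = ?x + ?y - Bs U" using ab(3) V(1) W(1) by (simp add: Bs_union U_def)
    have UI: "set_mset U \<subseteq> {i, j} \<times> UNIV" "set_mset U \<subseteq> I \<times> UNIV" using V(2) W(2) ij by (auto simp: U_def)
    have "U \<noteq> {#}" using m(3) top mU by auto
    define s where "s = Max (snd ` set_mset U)"
    have "s \<in> snd ` set_mset U" unfolding s_def using \<open>U \<noteq> {#}\<close> by (intro Max_in) auto
    then obtain k where k: "(k, s) \<in># U" by force
    have le: "s' \<le> s" if "(k', s') \<in># U" for k' s'
      unfolding s_def using that by (intro Max_ge) force+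
    have zero: "count U (k', s') = 0" if "s' > s" for k' s'
      using le[of k' s'] that by (meson count_inI not_le)
    have kij: "k \<in> {i, j}" "k \<in> I" using k UI by auto
    have "lookup m (k, s + 1) = lookup (?x + ?y) (k, s + 1) - lookup (Bs U) (k, s + 1)"
      unfolding mU by (rule lookup_minus)
    moreover have "lookup (Bs U) (k, s + 1) = int (count U (k, s))"
      using lookup_Bs[OF UI(2) kij(2), of "s + 1"] by (simp add: zero)
    moreover have "int (count U (k, s)) > 0" using k by simp
    moreover have "lookup m (k, s + 1) \<ge> 0" using m(1,2) kij(1) by (auto simp: idom_def)
    ultimately have "lookup (?x + ?y) (k, s + 1) \<noteq> 0" by linarith
    then have s: "s \<le> p" by (auto simp: lookup_add lookup_single when_def split: if_splits)
    have "W = {#}"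
    proof (rule ccontr)
      assume "W \<noteq> {#}"
      then have "(i, p + 2) \<in># U" using W(2) by (auto simp: U_def)
      then show False using le s by fastforce
    qed
    moreover have "(j, p + 1) \<notin># V" using le[of j "p + 1"] s by (auto simp: U_def)
    ultimately have "U = {#(i, p)#}" using V(2) \<open>U \<noteq> {#}\<close> by (auto simp: U_def)
    then show ?thesis using mU by simp
  qed
  obtain g where g: "\<And>k. k \<in> {i, j} \<Longrightarrow> g \<in> Ki k" "P = qscalar c \<star> g"
  proof (rule K_divide[of "{i, j}" P c])
    fix m assume "\<forall>k\<in>{i, j}. idom k m"
    then show "c dvd lookup P m" using dom[of m] coeff_M by (cases "lookup P m = 0") auto
  qed (use ij P_keys_in c in auto)
  have lookup_g: "lookup P m = c * lookup g m" for m unfolding g(2) by (simp add: lookup_qscalar_times)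
  have "lookup g ?M = 1"
    using laurent_mult_left_cancel[OF c, of "lookup g ?M" 1] lookup_g[of ?M] coeff_M by simp
  moreover have "below ?M m" if mg: "m \<in> keys g" for m
  proof -
    obtain a where a: "\<forall>k\<in>{i, j}. idom k a" "\<not> 0 dvd lookup g a" "below a m"
      using K_climb[of "{i, j}" g 0 m] g(1) mg ij by (auto simp: in_keys_iff)
    have "lookup P a \<noteq> 0"
    proof
      assume "lookup P a = 0"
      then have "c * lookup g a = c * 0" using lookup_g by simp
      then have "lookup g a = 0" by (rule laurent_mult_left_cancel[OF c])
      then show False using a(2) by simp
    qed
    then show ?thesis using dom[of a] a by simp
  qed
  ultimately have "leads i j ?M" unfolding leads_def lead_def using g(1) by blast
  \<comment> \<open>As \<open>C j i = - 1\<close>, the monomial \<open>?M\<close> is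
    \<open>X (j, p)\<close> times variables of colours other than \<open>i\<close> and
    \<open>j\<close>; the two differ by a unit of both algebras.\<close>
  moreover have "leads i j (X (j, p) - ?M)"
  proof -
    have keys: "keys (X (j, p) - ?M) \<subseteq> Delta0 n C"
      using keys_diff[of "X (j, p)" ?M] keys_diff[of "?x + ?y" ?b] Poly_Mapping.keys_add[of ?x ?y]
        keys_B[OF Di(1)] D Di by auto
    show ?thesis
      by (rule leads_colorless; unfold colorless_def; intro conjI allI keys)
        (use ij Cji in \<open>auto simp: lookup_minus lookup_add lookup_B lookup_single when_def Aoff_def\<close>)
  qed
  ultimately have "leads i j (?M + (X (j, p) - ?M))" by (rule leads_add)
  then show ?thesis by simp
qed

lemma leads_fundamental:
  assumes "i \<in> I" "j \<in> I" "(i, p) \<in> Delta0 n C"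
  shows "leads i j (X (i, p))"
proof -
  consider "i = j" | "i \<noteq> j" "C j i = 0" | "adj i j" "C j i = - 1" | "adj j i" "C i j = - 1"
    using adj_cases[of i j] adj_sym assms C_eq_0_iff[of i j] by (auto simp: adj_def)
  then show ?thesis
  proof cases
    case 1
    then show ?thesis unfolding leads_def using lead_Gen Gen_in_K assms by blast
  next
    case 2
    have keys: "keys (X (i, p)) \<subseteq> Delta0 n C" "keys (X (i, p) - Bmonom n C i (p + 1)) \<subseteq> Delta0 n C"
      using keys_diff[of "X (i, p)" "Bmonom n C i (p + 1)"] keys_B[of i "p + 1"] assms(3) by auto
    have "single (X (i, p)) 1 \<in> Ki j" "single (X (i, p) - Bmonom n C i (p + 1)) 1 \<in> Ki j"
      by (intro single_in_K; unfold colorless_def; intro conjI allI keys,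
          use 2 assms in \<open>auto simp: lookup_minus lookup_B lookup_single when_def Aoff_def\<close>)+
    then have "Gen i p \<in> Ki j" unfolding Gen_def by (simp add: K_add)
    then show ?thesis unfolding leads_def using lead_Gen Gen_in_K assms by blast
  next
    case 3
    obtain F where F: "F \<in> Ki i" "F \<in> Ki j" "lookup F (X (i, p)) = 1"
      and keys_F: "\<And>m. m \<in> keys F \<Longrightarrow> \<exists>V. m = X (i, p) - Bs V \<and> set_mset V \<subseteq> {i, j} \<times> UNIV"
      by (rule rank2_short_expanded[OF 3 assms(3)]) blast
    have "below (X (i, p)) m" if "m \<in> keys F" for m
      using keys_F[OF that] assms unfolding below_def by blast
    then show ?thesis unfolding leads_def lead_def using F by blast
  next
    case 4
    then show ?thesis using rank2_long[OF 4 assms(3)] leads_sym by blast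
  qed
qed

lemma leads_pair:
  assumes "i \<in> I" "j \<in> I" "idom i m" "idom j m"
  shows "\<exists>f. f \<in> Ki i \<and> f \<in> Ki j \<and> lead f m"
proof -
  have "leads i j m"
    by (rule leads_dominant) (use assms leads_fundamental leads_sym in blast)+
  then show ?thesis by (simp add: leads_def)
qed

section \<open>Existence of \<open>F\<^sub>q\<close>\<close>

lemma below_ht_le_minus_one:
  assumes "below a m" "m \<noteq> a"
  shows "ht m \<le> ht a - 1"
proof -
  obtain V where V: "set_mset V \<subseteq> I \<times> UNIV" "m = a - Bs V" using assms(1) by (auto simp: below_def)
  then have "real (size V) \<ge> 1" using assms(2) by (cases V) auto
  then show ?thesis using V by (simp add: ht_diff ht_Bs)
qed

text \<open>In the difference of the two elements a monomial that is not \<open>i\<close>-dominant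
  would come from one at least a unit higher, where they already agree. So the part above a cut
  determines such coefficients one layer further down.\<close>

lemma K_agree:
  assumes i: "i \<in> I" and g: "g \<in> Ki i" "g' \<in> Ki i"
    and agree: "\<And>m. ht m \<ge> H \<Longrightarrow> lookup g m = lookup g' m"
    and m: "ht m \<ge> H - 1" "\<not> idom i m"
  shows "lookup g m = lookup g' m"
proof (rule ccontr)
  assume neq: "lookup g m \<noteq> lookup g' m"
  have "g - g' \<in> Ki i" using g unfolding Kiq_def by (rule qsubalgebra_diff)
  moreover have "m \<in> keys (g - g')" using neq by (simp add: in_keys_iff lookup_minus)
  ultimately obtain a where a: "a \<in> keys (g - g')" "idom i a" "(istep i)\<^sup>*\<^sup>* a m"
    using K_up_nonzero[OF i] by blast
  have "m \<noteq> a" using a(2) m(2) by blast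
  then have "ht a \<ge> H" using below_ht_le_minus_one[OF isteps_below[OF a(3) i]] m(1) by simp
  then show False using agree[of a] a(1) by (simp add: in_keys_iff lookup_minus)
qed

lemma not_dominant: "\<not> dominant n C m \<Longrightarrow> \<exists>i\<in>I. \<not> idom i m"
  unfolding dominant_iff using n_pos by (auto simp: idom_def intro: bexI[of _ 1])

text \<open>The Frenkel--Mukhin algorithm. Requiring an extension for each pair of colours, not only for each
  single one, makes the coefficients prescribed by different colours agree.\<close>

definition stage :: "monom \<Rightarrow> nat \<Rightarrow> qtorus \<Rightarrow> bool" where
  "stage m0 h f \<longleftrightarrow> (\<forall>m\<in>keys f. below m0 m \<and> ht m \<ge> ht m0 - h) \<and> lookup f m0 = 1 \<and>
     (\<forall>m. dominant n C m \<and> m \<noteq> m0 \<longrightarrow> lookup f m = 0) \<and>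
     (\<forall>i\<in>I. \<forall>j\<in>I. \<exists>g. g \<in> Ki i \<and> g \<in> Ki j \<and> (\<forall>m\<in>keys g. below m0 m) \<and>
        (\<forall>m. ht m \<ge> ht m0 - h \<longrightarrow> lookup g m = lookup f m))"

lemma stage_0:
  assumes "dominant n C m0"
  shows "stage m0 0 (single m0 1)"
proof -
  have "\<exists>g. g \<in> Ki i \<and> g \<in> Ki j \<and> (\<forall>m\<in>keys g. below m0 m) \<and>
      (\<forall>m. ht m \<ge> ht m0 \<longrightarrow> lookup g m = lookup (single m0 1) m)" if ij: "i \<in> I" "j \<in> I" for i j
  proof -
    have "idom i m0" "idom j m0" using assms ij by (auto simp: dominant_iff)
    then obtain g where g: "g \<in> Ki i" "g \<in> Ki j" "lead g m0" using leads_pair[OF ij] by blast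
    have "lookup g m = lookup (single m0 1) m" if m: "ht m \<ge> ht m0" for m
    proof (cases "m = m0")
      case True
      then show ?thesis using g by (simp add: lead_def)
    next
      case False
      then have "m \<notin> keys g" using below_ht_less[of m0 m] m g(3) by (auto simp: lead_def)
      then show ?thesis using False by (simp add: in_keys_iff lookup_single)
    qed
    then show ?thesis using g by (auto simp: lead_def)
  qed
  then show ?thesis by (auto simp: stage_def lookup_single)
qed

text \<open>In the next layer a dominant monomial gets coefficient 0, any other one the value
  prescribed by a colour for which it is not dominant; the pair extensions make the choice of that
  colour immaterial. The extension for a pair is then renewed: only coefficients at monomials
  dominant for both colours can still be wrong, and elements from \<open>leads_pair\<close> correct
  them.\<close>

lemma stage_Suc:
  assumes st: "stage m0 h f"
  shows "\<exists>f'. stage m0 (Suc h) f'"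
proof -
  define L where "L = ht m0 - h"
  have f1: "below m0 m \<and> ht m \<ge> L" if "m \<in> keys f" for m using st that by (simp add: stage_def L_def)
  have f2: "lookup f m0 = 1" and f3: "\<And>m. dominant n C m \<Longrightarrow> m \<noteq> m0 \<Longrightarrow> lookup f m = 0"
    using st by (auto simp: stage_def)
  have "\<forall>i\<in>I. \<forall>j\<in>I. \<exists>g. g \<in> Ki i \<and> g \<in> Ki j \<and> (\<forall>m\<in>keys g. below m0 m) \<and>
        (\<forall>m. ht m \<ge> L \<longrightarrow> lookup g m = lookup f m)"
    using st by (simp add: stage_def L_def)
  then have "\<exists>g. \<forall>i\<in>I. \<forall>j\<in>I. g i j \<in> Ki i \<and> g i j \<in> Ki j \<and> (\<forall>m\<in>keys (g i j). below m0 m) \<and>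
        (\<forall>m. ht m \<ge> L \<longrightarrow> lookup (g i j) m = lookup f m)"
    by (simp only: bchoice_iff)
  then obtain g where g: "\<And>i j. i \<in> I \<Longrightarrow> j \<in> I \<Longrightarrow> g i j \<in> Ki i"
      "\<And>i j. i \<in> I \<Longrightarrow> j \<in> I \<Longrightarrow> g i j \<in> Ki j"
      "\<And>i j m. i \<in> I \<Longrightarrow> j \<in> I \<Longrightarrow> m \<in> keys (g i j) \<Longrightarrow> below m0 m"
      "\<And>i j m. i \<in> I \<Longrightarrow> j \<in> I \<Longrightarrow> ht m \<ge> L \<Longrightarrow> lookup (g i j) m = lookup f m"
    by blast
  \<comment> \<open>Heights are real, so a layer is the half-open slab from \<open>L - 1\<close> to
    \<open>L\<close>. A nontrivial step lowers the height by at least 1 and therefore leaves the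
    slab.\<close>
  define lev where "lev m \<longleftrightarrow> \<not> ht m \<ge> L \<and> ht m \<ge> L - 1" for m
  define M where "M = {m \<in> (\<Union>i\<in>I. keys (g i i)). lev m}"
  define i0 where "i0 m = (SOME i. i \<in> I \<and> \<not> idom i m)" for m
  define val where "val m = (if dominant n C m then 0 else lookup (g (i0 m) (i0 m)) m)" for m
  define f' where "f' = f + (\<Sum>m\<in>M. single m (val m))"
  have finM: "finite M" by (simp add: M_def)
  have lookup_f': "lookup f' m = lookup f m + (if m \<in> M then val m else 0)" for m
    using finM by (simp add: f'_def lookup_add lookup_sum lookup_single when_def)
  have f'_old: "lookup f' m = lookup f m" if "ht m \<ge> L" for m
    using that by (simp add: lookup_f' M_def lev_def)
  have f'_dom: "lookup f' m = 0" if "dominant n C m" "m \<noteq> m0" for m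
    using that f3 by (simp add: lookup_f' val_def)
  have f'_new: "lookup f' m = lookup (g i i) m" if i: "i \<in> I" and m: "lev m" "\<not> idom i m" for i m
  proof -
    have nd: "\<not> dominant n C m" using i m(2) by (auto simp: dominant_iff)
    have "\<exists>i. i \<in> I \<and> \<not> idom i m" using i m(2) by blast
    then have i0: "i0 m \<in> I \<and> \<not> idom (i0 m) m" unfolding i0_def by (rule someI_ex)
    \<comment> \<open>The extension for the pair \<open>i0 m\<close>, \<open>i\<close> lies in both
      algebras and mediates between the two prescriptions.\<close>
    have "lookup (g (i0 m) (i0 m)) m = lookup (g (i0 m) i) m"
      by (rule K_agree[of "i0 m" _ _ L]) (use i0 i g m in \<open>auto simp: lev_def\<close>)
    also have "\<dots> = lookup (g i i) m"
      by (rule K_agree[of i _ _ L]) (use i0 i g m in \<open>auto simp: lev_def\<close>)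
    finally have val: "val m = lookup (g i i) m" using nd by (simp add: val_def)
    have "lookup f m = 0" using f1[of m] m(1) by (auto simp: lev_def in_keys_iff)
    moreover have "lookup (g i i) m = 0" if "m \<notin> M"
      using that i m(1) by (auto simp: M_def in_keys_iff)
    ultimately show ?thesis using val by (auto simp: lookup_f')
  qed
  have f'_keys: "below m0 m \<and> ht m \<ge> L - 1" if m: "m \<in> keys f'" for m
  proof (cases "m \<in> M")
    case True
    then show ?thesis using g(3) by (auto simp: M_def lev_def)
  next
    case False
    then have "m \<in> keys f" using m by (simp add: in_keys_iff lookup_f')
    then show ?thesis using f1[of m] by simp
  qed
  have ext: "\<exists>g'. g' \<in> Ki i \<and> g' \<in> Ki j \<and> (\<forall>m\<in>keys g'. below m0 m) \<and>
        (\<forall>m. ht m \<ge> L - 1 \<longrightarrow> lookup g' m = lookup f' m)" if ij: "i \<in> I" "j \<in> I" for i j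
  proof -
    define M' where "M' = {m \<in> keys f' \<union> keys (g i j). idom i m \<and> idom j m \<and> lev m}"
    have finM': "finite M'" by (simp add: M'_def)
    have "\<forall>m\<in>M'. \<exists>e. e \<in> Ki i \<and> e \<in> Ki j \<and> lead e m"
      using leads_pair[OF ij] by (auto simp: M'_def)
    then obtain e where e: "\<And>m. m \<in> M' \<Longrightarrow> e m \<in> Ki i \<and> e m \<in> Ki j \<and> lead (e m) m"
      using bchoice[of M'] by metis
    define g' where "g' = g i j + (\<Sum>m\<in>M'. qscalar (lookup f' m - lookup (g i j) m) \<star> e m)"
    have lookup_g': "lookup g' m = lookup (g i j) m + (\<Sum>m'\<in>M'. (lookup f' m' - lookup (g i j) m') * lookup (e m') m)" for m
      by (simp add: g'_def lookup_add lookup_sum lookup_qscalar_times)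
    have e_zero: "lookup (e m') m = 0" if "m' \<in> M'" "ht m \<ge> L - 1" "m \<noteq> m'" for m m'
    proof (rule ccontr)
      assume "lookup (e m') m \<noteq> 0"
      then have "below m' m" using e[OF that(1)] by (simp add: lead_def in_keys_iff)
      then have "ht m \<le> ht m' - 1" using that(3) by (rule below_ht_le_minus_one)
      then show False using that(1,2) by (auto simp: M'_def lev_def)
    qed
    have eval: "lookup g' m = lookup (g i j) m + (if m \<in> M' then lookup f' m - lookup (g i j) m else 0)"
      if m: "ht m \<ge> L - 1" for m
    proof -
      have "(\<Sum>m'\<in>M'. (lookup f' m' - lookup (g i j) m') * lookup (e m') m) =
          (\<Sum>m'\<in>M'. if m' = m then lookup f' m - lookup (g i j) m else 0)"
        by (intro sum.cong refl) (use e e_zero m in \<open>auto simp: lead_def\<close>)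
      then show ?thesis using finM' by (simp add: lookup_g')
    qed
    have "lookup g' m = lookup f' m" if m: "ht m \<ge> L - 1" for m
    proof (cases "ht m \<ge> L")
      case True
      then have "m \<notin> M'" by (simp add: M'_def lev_def)
      then show ?thesis using eval[OF m] g(4)[OF ij True] f'_old[OF True] by simp
    next
      case False
      then have lev: "lev m" using m by (simp add: lev_def)
      consider "idom i m \<and> idom j m" | "\<not> idom i m" | "\<not> idom j m" by blast
      then show ?thesis
      proof cases
        case 1
        have "lookup f' m = 0 \<and> lookup (g i j) m = 0" if "m \<notin> M'"
          using that 1 lev by (auto simp: M'_def in_keys_iff)
        then show ?thesis using eval[OF m] by auto
      next
        case 2
        have "lookup (g i j) m = lookup (g i i) m"
          by (rule K_agree[of i _ _ L]) (use ij g m 2 in auto)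
        then show ?thesis using eval[OF m] f'_new[OF ij(1) lev 2] by (auto simp: M'_def)
      next
        case 3
        have "lookup (g i j) m = lookup (g j j) m"
          by (rule K_agree[of j _ _ L]) (use ij g m 3 in auto)
        then show ?thesis using eval[OF m] f'_new[OF ij(2) lev 3] by (auto simp: M'_def)
      qed
    qed
    moreover have "g' \<in> Ki i" "g' \<in> Ki j"
      unfolding g'_def using g(1,2)[OF ij] e unfolding Kiq_def
      by (auto intro!: qsubalgebra.add qsubalgebra_sum qsubalgebra_scale)
    moreover have "below m0 m" if m: "m \<in> keys g'" for m
    proof (rule ccontr)
      assume nb: "\<not> below m0 m"
      then have "m \<notin> keys (g i j)" using g(3)[OF ij] by blast
      moreover have "lookup (e m') m = 0" if "m' \<in> M'" for m'
      proof -
        have "below m0 m'" using that f'_keys g(3)[OF ij] by (auto simp: M'_def)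
        then have "\<not> below m' m" using nb below_trans by blast
        then show ?thesis using e[OF that] by (auto simp: lead_def in_keys_iff)
      qed
      ultimately have "lookup g' m = 0" by (simp add: lookup_g' in_keys_iff)
      then show False using m by (simp add: in_keys_iff)
    qed
    ultimately show ?thesis by blast
  qed
  have L': "ht m0 - real (Suc h) = L - 1" by (simp add: L_def)
  have "lookup f' m0 = 1" using f'_old[of m0] f2 by (simp add: L_def)
  then have "stage m0 (Suc h) f'" unfolding stage_def L' using f'_keys f'_dom ext by blast
  then show ?thesis by blast
qed

lemma stage_exists: "dominant n C m0 \<Longrightarrow> \<exists>f. stage m0 h f"
  by (induction h) (use stage_0 stage_Suc in blast)+

text \<open>A monomial of \<open>f\<close> other than \<open>m0\<close> is not dominant for some
  colour; the extension in that colour exhibits it below a higher monomial of \<open>f\<close>,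
  through steps that do not increase the length.\<close>

lemma stage_qnorm:
  assumes "stage m0 h f" "m \<in> keys f"
  shows "qnorm m \<le> qnorm m0"
  using assms(2)
proof (induction "card {b \<in> keys f. ht b > ht m}" arbitrary: m rule: less_induct)
  case less
  show ?case
  proof (cases "m = m0")
    case False
    then have "\<not> dominant n C m" using assms(1) less.prems by (auto simp: stage_def in_keys_iff)
    then obtain i where i: "i \<in> I" "\<not> idom i m" using not_dominant by blast
    obtain g where g: "g \<in> Ki i" "\<And>m. ht m \<ge> ht m0 - h \<Longrightarrow> lookup g m = lookup f m"
      using assms(1) i(1) unfolding stage_def by blast
    have hm: "ht m \<ge> ht m0 - h" using assms(1) less.prems by (simp add: stage_def)
    then have "m \<in> keys g" using g(2) less.prems by (simp add: in_keys_iff)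
    then obtain a where a: "a \<in> keys g" "idom i a" "(istep i)\<^sup>*\<^sup>* a m" using K_up_nonzero[OF i(1) g(1)] by blast
    have lt: "ht m < ht a" using below_ht_less[OF isteps_below[OF a(3) i(1)]] a(2) i(2) by blast
    then have af: "a \<in> keys f" using g(2)[of a] hm a(1) by (simp add: in_keys_iff)
    have "card {b \<in> keys f. ht b > ht a} < card {b \<in> keys f. ht b > ht m}"
      by (intro psubset_card_mono) (use lt af in auto)
    then have "qnorm a \<le> qnorm m0" using less.hyps af by blast
    then show ?thesis using isteps_qnorm[OF a(3) i(1)] by simp
  qed simp
qed

text \<open>The depth \<open>h\<close> is chosen so that no monomial of length at most that of
  \<open>m0\<close> lies at or under the cut. For each colour the extension \<open>g\<close> may
  continue below it, but those of its basis elements that start above the cut contain no monomial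
  below it, so the sum of these is exactly \<open>f\<close>.\<close>

lemma F_exists:
  assumes dom: "dominant n C m0"
  shows "\<exists>F. F \<in> Kq n C d \<and> lookup F m0 = 1 \<and> (\<forall>m. dominant n C m \<and> m \<noteq> m0 \<longrightarrow> lookup F m = 0) \<and>
    (\<forall>m\<in>keys F. below m0 m)"
proof -
  define L where "L = - (qnorm m0 + Bf rho rho) / 2"
  obtain h :: nat where h: "real h > ht m0 - L" using reals_Archimedean2 by blast
  obtain f where st: "stage m0 h f" using stage_exists[OF dom] by blast
  have low: "ht m > ht m0 - h" if "keys m \<subseteq> I \<times> UNIV" "qnorm m \<le> qnorm m0" for m
    using ht_lower_bound[OF that(1)] that(2) h by (simp add: L_def field_simps)
  have f_keys: "ht m \<ge> ht m0 - h" if "m \<in> keys f" for m using st that by (simp add: stage_def)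
  have "f \<in> Ki i" if i: "i \<in> I" for i
  proof -
    obtain g where g: "g \<in> Ki i" "\<And>m. ht m \<ge> ht m0 - h \<Longrightarrow> lookup g m = lookup f m"
      using st i unfolding stage_def by blast
    obtain A l where A: "finite A" "\<And>a. a \<in> A \<Longrightarrow> idom i a"
      and g_eq: "g = (\<Sum>a\<in>A. qscalar (l a) \<star> Edom i a)"
      and up: "\<And>a c. a \<in> A \<Longrightarrow> \<not> c dvd l a \<Longrightarrow> \<exists>b. idom i b \<and> \<not> c dvd lookup g b \<and> (istep i)\<^sup>*\<^sup>* b a"
      using K_expand_up[OF i g(1)] by blast
    define A' where "A' = {a \<in> A. l a \<noteq> 0 \<and> ht a \<ge> ht m0 - h}"
    have nrm: "qnorm a \<le> qnorm m0" if aA: "a \<in> A'" for a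
    proof -
      obtain b where b: "lookup g b \<noteq> 0" "(istep i)\<^sup>*\<^sup>* b a"
        using up[of a 0] aA by (auto simp: A'_def)
      have "ht b \<ge> ht m0 - h" using below_ht_le[OF isteps_below[OF b(2) i]] aA by (simp add: A'_def)
      then have "b \<in> keys f" using b(1) g(2) by (simp add: in_keys_iff)
      then show ?thesis using stage_qnorm[OF st] isteps_qnorm[OF b(2) i] by fastforce
    qed
    have step: "istep i a m" if "a \<in> A" "lookup (Edom i a) m \<noteq> 0" for a m
      using Edom_keys[OF i A(2)[OF that(1)]] that(2) by (simp add: in_keys_iff)
    have "f = (\<Sum>a\<in>A'. qscalar (l a) \<star> Edom i a)"
    proof (rule poly_mapping_eqI)
      fix m
      have rhs: "lookup (\<Sum>a\<in>A'. qscalar (l a) \<star> Edom i a) m = (\<Sum>a\<in>A'. l a * lookup (Edom i a) m)"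
        by (simp add: lookup_sum lookup_qscalar_times)
      show "lookup f m = lookup (\<Sum>a\<in>A'. qscalar (l a) \<star> Edom i a) m"
      proof (cases "ht m \<ge> ht m0 - h")
        case True
        have "lookup f m = (\<Sum>a\<in>A. l a * lookup (Edom i a) m)"
          unfolding g(2)[OF True, symmetric] g_eq by (simp add: lookup_sum lookup_qscalar_times)
        also have "\<dots> = (\<Sum>a\<in>A'. l a * lookup (Edom i a) m)"
        proof (rule sum.mono_neutral_right[OF A(1)])
          show "\<forall>a\<in>A - A'. l a * lookup (Edom i a) m = 0"
          proof (rule ballI, rule ccontr)
            fix a assume a: "a \<in> A - A'" "l a * lookup (Edom i a) m \<noteq> 0"
            then have "l a \<noteq> 0" "istep i a m" using step by auto
            then have "ht a \<ge> ht m0 - h" using below_ht_le[OF istep_below[OF i]] True by fastforce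
            then show False using a(1) \<open>l a \<noteq> 0\<close> by (simp add: A'_def)
          qed
        qed (simp add: A'_def)
        finally show ?thesis unfolding rhs .
      next
        case False
        then have "lookup f m = 0" using f_keys by (auto simp: in_keys_iff)
        moreover have "lookup (Edom i a) m = 0" if a: "a \<in> A'" for a
        proof (rule ccontr)
          assume "lookup (Edom i a) m \<noteq> 0"
          then have s: "istep i a m" using step a by (simp add: A'_def)
          have "keys a \<subseteq> I \<times> UNIV" using A(2) a Delta0_sub by (auto simp: A'_def idom_def)
          then have "keys m \<subseteq> I \<times> UNIV" using keys_below istep_below[OF i s] by blast
          moreover have "qnorm m \<le> qnorm m0" using istep_qnorm[OF i s] nrm[OF a] by simp
          ultimately show False using low[of m] False by simp
        qed
        ultimately show ?thesis unfolding rhs by simp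
      qed
    qed
    also have "\<dots> \<in> Ki i"
      unfolding Kiq_def by (intro qsubalgebra_sum qsubalgebra_scale)
        (use A(2) Edom_in_K in \<open>auto simp: A'_def Kiq_def\<close>)
    finally show ?thesis .
  qed
  then have "f \<in> Kq n C d" by (simp add: Kq_def)
  then show ?thesis using st unfolding stage_def by blast
qed

section \<open>Properties of \<open>Fq\<close> and induction over its monomials\<close>

lemma Kq_diff: "f \<in> Kq n C d \<Longrightarrow> g \<in> Kq n C d \<Longrightarrow> f - g \<in> Kq n C d"
  by (auto simp: Kq_def Kiq_def intro: qsubalgebra_diff)

lemma Fq_properties:
  assumes dom: "dominant n C m0"
  shows "Fq n C d m0 \<in> Kq n C d" "lookup (Fq n C d m0) m0 = 1"
    "\<And>m. dominant n C m \<Longrightarrow> m \<noteq> m0 \<Longrightarrow> lookup (Fq n C d m0) m = 0"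
    "\<And>m. m \<in> keys (Fq n C d m0) \<Longrightarrow> below m0 m"
proof -
  obtain F where F: "F \<in> Kq n C d" "lookup F m0 = 1"
    "\<And>m. dominant n C m \<Longrightarrow> m \<noteq> m0 \<Longrightarrow> lookup F m = 0" "\<And>m. m \<in> keys F \<Longrightarrow> below m0 m"
    using F_exists[OF dom] by blast
  have "Fq n C d m0 = F" unfolding Fq_def
  proof (rule the_equality)
    fix G assume G: "G \<in> Kq n C d \<and> lookup G m0 = 1 \<and>
     (\<forall>m'. dominant n C m' \<and> m' \<noteq> m0 \<longrightarrow> lookup G m' = 0)"
    have "G - F = 0"
    proof (rule Kq_unique)
      fix m assume "dominant n C m"
      then show "lookup (G - F) m = 0" using F G by (cases "m = m0") (auto simp: lookup_minus)
    qed (use Kq_diff F G in blast)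
    then show "G = F" by simp
  qed (use F in auto)
  then show "Fq n C d m0 \<in> Kq n C d" "lookup (Fq n C d m0) m0 = 1"
    "\<And>m. dominant n C m \<Longrightarrow> m \<noteq> m0 \<Longrightarrow> lookup (Fq n C d m0) m = 0"
    "\<And>m. m \<in> keys (Fq n C d m0) \<Longrightarrow> below m0 m"
    using F by auto
qed

text \<open>A monomial other than \<open>m0\<close> fails to be dominant for some colour
  \<open>i\<close>, so \<open>K_up_nonzero\<close> places it below a higher monomial of the same
  element. The steps in between may leave the support, which is why the rule speaks of a whole
  chain.\<close>

lemma Fq_induct:
  assumes dom: "dominant n C m0" and m: "m \<in> keys (Fq n C d m0)"
    and base: "P m0"
    and step: "\<And>i a m. \<lbrakk>i \<in> I; a \<in> keys (Fq n C d m0); m \<in> keys (Fq n C d m0); P a; m \<noteq> m0; idom i a; (istep i)\<^sup>*\<^sup>* a m\<rbrakk> \<Longrightarrow> P m"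
  shows "P m"
  using m
proof (induction "card {b \<in> keys (Fq n C d m0). ht b > ht m}" arbitrary: m rule: less_induct)
  case less
  let ?F = "Fq n C d m0"
  show ?case
  proof (cases "m = m0")
    case False
    then have "\<not> dominant n C m" using Fq_properties(3)[OF dom] less.prems by (auto simp: in_keys_iff)
    then obtain i where i: "i \<in> I" "\<not> idom i m" using not_dominant by blast
    have "?F \<in> Ki i" using Fq_properties(1)[OF dom] i(1) by (simp add: Kq_def)
    then obtain a where a: "a \<in> keys ?F" "idom i a" "(istep i)\<^sup>*\<^sup>* a m"
      using K_up_nonzero[OF i(1)] less.prems by blast
    have lt: "ht m < ht a" using below_ht_less[OF isteps_below[OF a(3) i(1)]] a(2) i(2) by blast
    have "card {b \<in> keys ?F. ht b > ht a} < card {b \<in> keys ?F. ht b > ht m}"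
      by (intro psubset_card_mono) (use lt a(1) in auto)
    then have "P a" using less.hyps a(1) by blast
    then show ?thesis using step i(1) a less.prems False by blast
  qed (simp add: base)
qed

section \<open>Kirillov--Reshetikhin monomials\<close>

lemma lookup_KR: "lookup (KR_monom i k r) (j, p) = of_bool (j = i \<and> (\<exists>a<k. p = r + 2 * int a))"
proof -
  have "lookup (KR_monom i k r) (j, p) = (\<Sum>a<k. if i = j \<and> r + 2 * int a = p then 1 else 0)"
    unfolding KR_monom_def lookup_sum by (intro sum.cong refl) (auto simp: lookup_single when_def)
  also have "\<dots> = of_bool (j = i \<and> (\<exists>a<k. p = r + 2 * int a))"
  proof (cases "j = i \<and> (\<exists>a<k. p = r + 2 * int a)")
    case True
    then obtain a0 where a0: "a0 < k" "p = r + 2 * int a0" by blast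
    have "(\<Sum>a<k. if i = j \<and> r + 2 * int a = p then 1 else 0 :: int) = (\<Sum>a<k. if a = a0 then 1 else 0)"
      using True a0 by (intro sum.cong refl) auto
    then show ?thesis using True a0(1) by simp
  next
    case False
    then have "(\<Sum>a<k. if i = j \<and> r + 2 * int a = p then 1 else 0 :: int) = (\<Sum>a<k. 0)"
      by (intro sum.cong refl) auto
    then show ?thesis using False by simp
  qed
  finally show ?thesis .
qed

lemma keys_KR:
  assumes "(i, r) \<in> Delta0 n C"
  shows "keys (KR_monom i k r) \<subseteq> Delta0 n C"
proof
  fix x assume "x \<in> keys (KR_monom i k r)"
  moreover obtain j p where x: "x = (j, p)" by (cases x)
  ultimately obtain a where "j = i" "p = r + 2 * int a"
    using lookup_KR[of i k r j p] by (auto simp: in_keys_iff split: if_splits)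
  then show "x \<in> Delta0 n C" using assms x by (simp add: Delta0_iff)
qed

lemma dominant_KR: "(i, r) \<in> Delta0 n C \<Longrightarrow> dominant n C (KR_monom i k r)"
  using keys_KR by (simp add: dominant_iff idom_def lookup_KR)

lemma KR_Suc: "KR_monom i (Suc k) r = X (i, r) + KR_monom i k (r + 2)"
  unfolding KR_monom_def by (subst sum.lessThan_Suc_shift) (simp add: algebra_simps)

text \<open>The columns of \<open>b\<close> successive \<open>B\<close>'s, from \<open>t\<close>
  leftwards in steps of two: the order in which a string of one colour is divided out.\<close>

definition descent :: "nat \<Rightarrow> int \<Rightarrow> nat \<Rightarrow> vertex multiset" where
  "descent i t b = mset (map (\<lambda>c. (i, t - 2 * int c)) [0..<b])"

lemma descent_0 [simp]: "descent i t 0 = {#}"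
  and descent_Suc: "descent i t (Suc b) = add_mset (i, t - 2 * int b) (descent i t b)"
  by (simp_all add: descent_def)

lemma set_descent: "set_mset (descent i t b) = (\<lambda>c. (i, t - 2 * int c)) ` {..<b}"
  by (auto simp: descent_def)

lemma count_descent: "count (descent i t b) (j, s) = of_bool (j = i \<and> (\<exists>c<b. s = t - 2 * int c))"
proof (induction b)
  case (Suc b)
  have ex: "(\<exists>c<Suc b. s = t - 2 * int c) \<longleftrightarrow> (\<exists>c<b. s = t - 2 * int c) \<or> s = t - 2 * int b"
    using less_Suc_eq by metis
  have "\<not> (\<exists>c<b. s = t - 2 * int c)" if "s = t - 2 * int b" using that by simp
  then show ?case unfolding descent_Suc ex using Suc.IH by (cases "s = t - 2 * int b"; cases "j = i") simp_all
qed simp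

text \<open>The element with leading monomial \<open>m\<^sup>(\<^sup>i\<^sup>)\<^sub>k\<^sub>,\<^sub>r\<close> and no other dominant monomial in rank one.\<close>

definition RK :: "nat \<Rightarrow> nat \<Rightarrow> int \<Rightarrow> qtorus" where
  "RK i k r = (\<Sum>b\<le>k. single (KR_monom i k r - Bs (descent i (r + 2 * int k - 1) b)) 1)"

lemma lookup_Bs_color:
  assumes "set_mset V \<subseteq> {i} \<times> UNIV" "i \<in> I"
  shows "lookup (Bs V) (i, p) = int (count V (i, p + 1)) + int (count V (i, p - 1))"
    and "j \<in> I \<Longrightarrow> j \<noteq> i \<Longrightarrow> lookup (Bs V) (j, p) = C j i * int (count V (i, p))"
proof -
  have VI: "set_mset V \<subseteq> I \<times> UNIV" using assms by auto
  have z: "count V (a, s) = 0" if "a \<noteq> i" for a s using assms(1) that by (auto simp: count_eq_zero_iff)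
  have S: "(\<Sum>a\<in>I. Aoff j a * int (count V (a, p))) = Aoff j i * int (count V (i, p))" for j
  proof -
    have "(\<Sum>a\<in>I. Aoff j a * int (count V (a, p))) = (\<Sum>a\<in>I. if a = i then Aoff j i * int (count V (i, p)) else 0)"
      by (intro sum.cong refl) (auto simp: z)
    then show ?thesis using assms(2) by simp
  qed
  show "lookup (Bs V) (i, p) = int (count V (i, p + 1)) + int (count V (i, p - 1))"
    unfolding lookup_Bs[OF VI assms(2)] S by (simp add: Aoff_def)
  show "lookup (Bs V) (j, p) = C j i * int (count V (i, p))" if "j \<in> I" "j \<noteq> i"
    unfolding lookup_Bs[OF VI that(1)] S using that by (simp add: Aoff_def z)
qed

lemma descent_color: "set_mset (descent i t b) \<subseteq> {i} \<times> UNIV"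
  by (auto simp: set_descent)

text \<open>A q-analogue of the Chebyshev recursion for sl_2 characters. The first term of
  \<open>Gen i r\<close> gives all terms of the longer string but the last. The second term gives
  that last one from \<open>b = Suc k\<close>, and its other contributions form the string with two
  letters fewer, times a colourless monomial.\<close>

lemma RK_recursion:
  assumes D: "(i, r) \<in> Delta0 n C"
  shows "\<exists>e c. Gen i r \<star> RK i (Suc k) (r + 2) = qscalar (vpow e) \<star> RK i (Suc (Suc k)) r +
    single (X (i, r) + X (i, r + 2) - B (i, r + 1)) c \<star> RK i k (r + 4)"
proof -
  have i: "i \<in> I" using D by (rule Delta0_color)
  let ?x = "X (i, r)" and ?b = "Bmonom n C i (r + 1)"
  let ?Z = "X (i, r) + X (i, r + 2) - ?b"
  define M where "M = KR_monom i (Suc k) (r + 2)"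
  define M' where "M' = KR_monom i k (r + 4)"
  define t where "t = r + 2 * int k + 3"
  let ?T = "descent i t"
  have MM': "M = X (i, r + 2) + M'" by (simp add: M_def M'_def KR_Suc add.commute)
  have keys_T: "keys (Bs (?T b)) \<subseteq> I \<times> UNIV" for b using descent_color[of i t b] i by (intro keys_Bs) auto
  have keys_M: "keys M \<subseteq> I \<times> UNIV"
    using keys_KR[of i "r + 2" "Suc k"] Delta0_shift2[OF D] Delta0_sub by (auto simp: M_def)
  have lkM: "lookup M (i, r + 2) = 1" "lookup M (i, r) = 0" by (auto simp: M_def lookup_KR)
  have xT: "mform N ?x (Bs (?T b)) = 0" if "b \<le> Suc k" for b
    using that
  proof (induction b)
    case (Suc b)
    have "mform N ?x (Bmonom n C i (t - 2 * int b)) = 0"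
      using mform_X_Bmonom[OF i i, of r "t - 2 * int b"] Suc.prems by (auto simp: t_def)
    then show ?case using Suc by (simp add: descent_Suc mform_add_right)
  qed simp
  define e where "e = mform N ?x M"
  have bM: "mform N ?b M = - 2 * d i"
    using mform_B[OF keys_M i, of "r + 1"] mform_skew[of ?b M] lkM by (simp add: add.commute)
  \<comment> \<open>\<open>?b\<close> pairs with the descent only once this has come down to column
    \<open>r + 3\<close>, which is \<open>b = Suc k\<close>; this offsets the pairing of
    \<open>?b\<close> with \<open>M\<close>, so the last term carries the power
    \<open>e\<close>.\<close>
  have bT: "mform N ?b (Bs (?T b)) = (if b = Suc k then - 2 * d i else 0)" if "b \<le> Suc k" for b
  proof -
    have ex: "(\<exists>c<b. r + 2 + 1 = t - 2 * int c) \<longleftrightarrow> b = Suc k"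
    proof
      assume "b = Suc k"
      then show "\<exists>c<b. r + 2 + 1 = t - 2 * int c" by (intro exI[of _ k]) (simp add: t_def)
    qed (use that in \<open>auto simp: t_def\<close>)
    have nex: "\<not> (\<exists>c<b. r + 1 = t - 2 * int c)" "\<not> (\<exists>c<b. r - 1 = t - 2 * int c)"
      using that by (auto simp: t_def)
    have "lookup (Bs (?T b)) (i, r + 2) = of_bool (b = Suc k)"
      unfolding lookup_Bs_color(1)[OF descent_color i] count_descent ex using nex(1) by (simp add: add.commute)
    moreover have "lookup (Bs (?T b)) (i, r) = 0"
      unfolding lookup_Bs_color(1)[OF descent_color i] count_descent using nex by simp
    ultimately show ?thesis
      using mform_B[OF keys_T i, of b "r + 1"] mform_skew[of ?b "Bs (?T b)"] by (simp add: add.commute)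
  qed
  have first: "mform N ?x (M - Bs (?T b)) = e" if "b \<le> Suc k" for b
    using xT[OF that] by (simp add: mform_diff_right e_def)
  have second: "mform N (?x - ?b) (M - Bs (?T b)) = (if b = Suc k then e else e + 2 * d i)" if "b \<le> Suc k" for b
    using xT[OF that] bM bT[OF that] by (simp add: mform_diff_right mform_diff_left e_def)
  have top: "r + 2 + 2 * int (Suc k) - 1 = t" "r + 4 + 2 * int k - 1 = t" "r + 2 * int (Suc (Suc k)) - 1 = t"
    by (simp_all add: t_def)
  have RK1: "RK i (Suc k) (r + 2) = (\<Sum>b\<le>Suc k. single (M - Bs (?T b)) 1)"
    by (simp only: RK_def M_def top)
  have RK0: "RK i k (r + 4) = (\<Sum>b\<le>k. single (M' - Bs (?T b)) 1)"
    by (simp only: RK_def M'_def top)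
  have RK2: "RK i (Suc (Suc k)) r = (\<Sum>b\<le>Suc (Suc k). single (?x + M - Bs (?T b)) 1)"
    by (simp only: RK_def KR_Suc[of i "Suc k" r] M_def top)
  have last: "?x - ?b + (M - Bs (?T (Suc k))) = ?x + M - Bs (?T (Suc (Suc k)))"
  proof -
    have "t - 2 * int (Suc k) = r + 1" by (simp add: t_def)
    then have "?T (Suc (Suc k)) = add_mset (i, r + 1) (?T (Suc k))" by (simp only: descent_Suc[of i t "Suc k"])
    then have "Bs (?T (Suc (Suc k))) = ?b + Bs (?T (Suc k))" by (simp only: Bs_add_mset fst_conv snd_conv)
    then show ?thesis by (simp only: algebra_simps)
  qed
  have Zsum: "single ?Z (vpow (e + 2 * d i - mform N ?Z M')) \<star> RK i k (r + 4) =
      (\<Sum>b\<le>k. single (?x - ?b + (M - Bs (?T b))) (vpow (e + 2 * d i)))"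
    unfolding RK0 qtimes_sum_right
  proof (intro sum.cong refl)
    fix b assume "b \<in> {..k}"
    have z: "mform N ?Z (Bs (?T b)) = 0"
    proof -
      have zB: "mform N ?Z (Bmonom n C i s) = 0" for s
        by (rule mform_colorless_B(1)[OF colorless_Z[OF D, unfolded fst_conv snd_conv] i])
      have "mform N ?Z (Bs V) = 0" if "set_mset V \<subseteq> {i} \<times> UNIV" for V
        using that
      proof (induction V)
        case (add x V)
        then have "fst x = i" by auto
        then show ?case using add zB[of "snd x"] by (simp only: Bs_add_mset mform_add_right) simp
      qed simp
      then show ?thesis using descent_color by blast
    qed
    have eqm: "?Z + (M' - Bs (?T b)) = ?x - ?b + (M - Bs (?T b))" by (simp add: MM' algebra_simps)
    show "single ?Z (vpow (e + 2 * d i - mform N ?Z M')) \<star> single (M' - Bs (?T b)) 1 =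
        single (?x - ?b + (M - Bs (?T b))) (vpow (e + 2 * d i))"
      unfolding qtimes_single eqm mform_diff_right[of N ?Z M'] z by (simp flip: vpow_add)
  qed
  have expand: "Gen i r \<star> RK i (Suc k) (r + 2) =
      (\<Sum>b\<le>Suc k. single (?x + (M - Bs (?T b))) (vpow e)) +
      (\<Sum>b\<le>Suc k. single (?x - ?b + (M - Bs (?T b))) (vpow (if b = Suc k then e else e + 2 * d i)))"
    unfolding RK1 qtimes_sum_right sum.distrib[symmetric]
  proof (intro sum.cong refl)
    fix b assume "b \<in> {..Suc k}"
    then have b: "b \<le> Suc k" by simp
    show "Gen i r \<star> single (M - Bs (?T b)) 1 = single (?x + (M - Bs (?T b))) (vpow e) +
        single (?x - ?b + (M - Bs (?T b))) (vpow (if b = Suc k then e else e + 2 * d i))"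
      unfolding Gen_def fst_conv snd_conv qtimes_add_left qtimes_single first[OF b] second[OF b]
      by (simp only: mult_1_right)
  qed
  have lower: "(\<Sum>b\<le>Suc k. single (?x - ?b + (M - Bs (?T b))) (vpow (if b = Suc k then e else e + 2 * d i))) =
      (\<Sum>b\<le>k. single (?x - ?b + (M - Bs (?T b))) (vpow (e + 2 * d i))) +
      single (?x + M - Bs (?T (Suc (Suc k)))) (vpow e)"
  proof -
    have "(\<Sum>b\<le>k. single (?x - ?b + (M - Bs (?T b))) (vpow (if b = Suc k then e else e + 2 * d i))) =
        (\<Sum>b\<le>k. single (?x - ?b + (M - Bs (?T b))) (vpow (e + 2 * d i)))"
    proof (intro sum.cong refl)
      fix b assume "b \<in> {..k}"
      then have "(if b = Suc k then e else e + 2 * d i) = e + 2 * d i" by simp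
      then show "single (?x - ?b + (M - Bs (?T b))) (vpow (if b = Suc k then e else e + 2 * d i)) =
          single (?x - ?b + (M - Bs (?T b))) (vpow (e + 2 * d i))" by (simp only:)
    qed
    then show ?thesis by (simp only: sum.atMost_Suc last simp_thms if_True)
  qed
  have upper: "qscalar (vpow e) \<star> RK i (Suc (Suc k)) r =
      (\<Sum>b\<le>Suc k. single (?x + (M - Bs (?T b))) (vpow e)) + single (?x + M - Bs (?T (Suc (Suc k)))) (vpow e)"
  proof -
    have "qscalar (vpow e) \<star> RK i (Suc (Suc k)) r = (\<Sum>b\<le>Suc (Suc k). single (?x + M - Bs (?T b)) (vpow e))"
      unfolding RK2 qtimes_sum_right by (intro sum.cong refl) (simp add: qscalar_single)
    then show ?thesis by (simp only: sum.atMost_Suc[of _ "Suc k"] add_diff_eq[of ?x])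
  qed
  have "Gen i r \<star> RK i (Suc k) (r + 2) = qscalar (vpow e) \<star> RK i (Suc (Suc k)) r +
      single ?Z (vpow (e + 2 * d i - mform N ?Z M')) \<star> RK i k (r + 4)"
    unfolding expand lower upper Zsum by (simp only: add_ac)
  then show ?thesis unfolding fst_conv snd_conv by (intro exI)
qed

lemma RK_in_K:
  assumes "(i, r) \<in> Delta0 n C"
  shows "RK i k r \<in> Ki i"
  using assms
proof (induction k arbitrary: r rule: induct_nat_012)
  case 0
  have "RK i 0 r = qscalar 1" by (simp add: RK_def KR_monom_def qscalar_def)
  then show ?case unfolding Kiq_def by (simp add: qsubalgebra.scalar)
next
  case 1
  have "RK i (Suc 0) r = Gen i r"
    by (simp add: RK_def Gen_def KR_monom_def descent_Suc algebra_simps)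
  then show ?case using Gen_in_K 1 by simp
next
  case (ge2 k)
  have D: "(i, r + 2) \<in> Delta0 n C" "(i, r + 4) \<in> Delta0 n C" using ge2.prems by (simp_all add: Delta0_iff)
  obtain e c where rec: "Gen i r \<star> RK i (Suc k) (r + 2) = qscalar (vpow e) \<star> RK i (Suc (Suc k)) r +
      single (X (i, r) + X (i, r + 2) - B (i, r + 1)) c \<star> RK i k (r + 4)"
    using RK_recursion[OF ge2.prems] by blast
  let ?Z = "X (i, r) + X (i, r + 2) - B (i, r + 1)"
  have "qscalar (vpow (- e)) \<star> (Gen i r \<star> RK i (Suc k) (r + 2) - single ?Z c \<star> RK i k (r + 4)) \<in> Ki i"
    using ge2.IH(1)[OF D(2)] ge2.IH(2)[OF D(1)] Gen_in_K[OF ge2.prems] single_in_K[OF colorless_Z[OF ge2.prems]]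
    unfolding Kiq_def by (intro qsubalgebra_scale qsubalgebra_diff qsubalgebra.times) auto
  also have "qscalar (vpow (- e)) \<star> (Gen i r \<star> RK i (Suc k) (r + 2) - single ?Z c \<star> RK i k (r + 4)) =
      RK i (Suc (Suc k)) r"
    unfolding rec by (simp add: qscalar_times_assoc vpow_unit)
  finally show ?case .
qed

lemma keys_RK: "m \<in> keys (RK i k r) \<Longrightarrow> \<exists>b\<le>k. m = KR_monom i k r - Bs (descent i (r + 2 * int k - 1) b)"
proof -
  assume "m \<in> keys (RK i k r)"
  then have "lookup (RK i k r) m \<noteq> 0" by (simp add: in_keys_iff)
  then have "(\<Sum>b\<le>k. lookup (single (KR_monom i k r - Bs (descent i (r + 2 * int k - 1) b)) (1::laurent)) m) \<noteq> 0"
    unfolding RK_def lookup_sum .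
  then obtain b where "b \<le> k" "lookup (single (KR_monom i k r - Bs (descent i (r + 2 * int k - 1) b)) (1::laurent)) m \<noteq> 0"
    by (rule sum.not_neutral_contains_not_neutral) auto
  then show ?thesis by (auto simp: lookup_single when_def split: if_splits)
qed

lemma RK_top:
  assumes "i \<in> I"
  shows "lookup (RK i k r) (KR_monom i k r) = 1"
proof -
  have "Bs (descent i t b) \<noteq> 0" if "b \<noteq> 0" for b t
  proof
    assume "Bs (descent i t b) = 0"
    then have "descent i t b = {#}" using descent_color[of i t b] assms by (intro Bs_eq_0) auto
    then have "set_mset (descent i t b) = {}" by simp
    then show False using that unfolding set_descent by auto
  qed
  then have "lookup (RK i k r) (KR_monom i k r) = (\<Sum>b\<le>k. if b = 0 then 1 else 0)"
    unfolding RK_def lookup_sum by (intro sum.cong refl) (auto simp: lookup_single when_def)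
  then show ?thesis by simp
qed

lemma RK_dominant:
  assumes i: "i \<in> I" and m: "m \<in> keys (RK i k r)" "idom i m"
  shows "m = KR_monom i k r"
proof -
  obtain b where b: "b \<le> k" "m = KR_monom i k r - Bs (descent i (r + 2 * int k - 1) b)" using keys_RK[OF m(1)] by blast
  have "b = 0"
  proof (rule ccontr)
    assume "b \<noteq> 0"
    then have "count (descent i (r + 2 * int k - 1) b) (i, r + 2 * int k - 1) = 1"
      by (auto simp: count_descent intro!: exI[of _ 0])
    then have "lookup (Bs (descent i (r + 2 * int k - 1) b)) (i, r + 2 * int k) \<ge> 1"
      unfolding lookup_Bs_color(1)[OF descent_color i] by simp
    moreover have "lookup (KR_monom i k r) (i, r + 2 * int k) = 0" by (auto simp: lookup_KR)
    ultimately have "lookup m (i, r + 2 * int k) < 0" by (simp add: b(2) lookup_minus)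
    then show False using m(2) by (auto simp: idom_def not_less[symmetric])
  qed
  then show ?thesis using b(2) by simp
qed

text \<open>Dividing by a \<open>B\<close> of colour \<open>i\<close> multiplies by nonnegative
  powers of variables of the other colours. So an \<open>i\<close>-dominant monomial obtained from
  \<open>?m0\<close> in colour \<open>i\<close> alone is dominant, and there \<open>Fq\<close> and
  \<open>RK\<close> have the same coefficient. Their difference lies in \<open>Ki i\<close> and
  would have to start at such a monomial.\<close>

lemma Fq_KR_color:
  assumes D: "(i, r) \<in> Delta0 n C" and W: "set_mset W \<subseteq> {i} \<times> UNIV"
  shows "lookup (Fq n C d (KR_monom i k r)) (KR_monom i k r - Bs W) =
    lookup (RK i k r) (KR_monom i k r - Bs W)"
proof (rule ccontr)
  let ?m0 = "KR_monom i k r" let ?F = "Fq n C d ?m0" let ?R = "RK i k r"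
  have i: "i \<in> I" using D by (rule Delta0_color)
  note F = Fq_properties[OF dominant_KR[OF D, of k]]
  assume neq: "lookup ?F (?m0 - Bs W) \<noteq> lookup ?R (?m0 - Bs W)"
  have "?F - ?R \<in> Ki i"
    using F(1) RK_in_K[OF D] i unfolding Kq_def Kiq_def by (intro qsubalgebra_diff) auto
  moreover have "?m0 - Bs W \<in> keys (?F - ?R)" using neq by (simp add: in_keys_iff lookup_minus)
  ultimately obtain a where a: "a \<in> keys (?F - ?R)" "idom i a" "(istep i)\<^sup>*\<^sup>* a (?m0 - Bs W)"
    using K_up_nonzero[OF i] by blast
  have "\<exists>W'. set_mset W' \<subseteq> {i} \<times> UNIV \<and> m = a - Bs W'" if "(istep i)\<^sup>*\<^sup>* a m" for m
    using that
  proof induction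
    case base
    show ?case by (intro exI[of _ "{#}"]) simp
  next
    case (step b m)
    then obtain W1 W2 where "set_mset W1 \<subseteq> {i} \<times> UNIV" "b = a - Bs W1"
      "set_mset W2 \<subseteq> {i} \<times> UNIV" "m = b - Bs W2" by (auto simp: istep_def)
    then show ?case by (intro exI[of _ "W1 + W2"]) (auto simp: Bs_union)
  qed
  then obtain W' where W': "set_mset W' \<subseteq> {i} \<times> UNIV" "?m0 - Bs W = a - Bs W'" using a(3) by blast
  have "below ?m0 a"
  proof -
    have "a \<in> keys ?F \<or> a \<in> keys ?R" using a(1) by (auto simp: in_keys_iff lookup_minus)
    then show ?thesis
    proof
      assume "a \<in> keys ?R"
      then obtain b where "a = ?m0 - Bs (descent i (r + 2 * int k - 1) b)" using keys_RK by blast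
      moreover have "set_mset (descent i (r + 2 * int k - 1) b) \<subseteq> I \<times> UNIV" using descent_color i by fastforce
      ultimately show ?thesis unfolding below_def by blast
    qed (rule F(4))
  qed
  then obtain V where V: "set_mset V \<subseteq> I \<times> UNIV" "a = ?m0 - Bs V" by (auto simp: below_def)
  have "Bs W = Bs (V + W')" using W'(2) V(2) by (simp add: Bs_union algebra_simps)
  then have "W = V + W'" using W W'(1) V(1) i by (intro Bs_inject) auto
  then have Vi: "set_mset V \<subseteq> {i} \<times> UNIV" using W by auto
  have "idom j a" if j: "j \<in> I" for j
  proof (cases "j = i")
    case False
    have "lookup a (j, p) \<ge> 0" for p
      using lookup_Bs_color(2)[OF Vi i j False, of p] C_nonpos[OF j i False] lookup_KR[of i k r j p]
False
      by (simp add: V(2) lookup_minus mult_nonpos_nonneg)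
    then show ?thesis using a(2) by (simp add: idom_def)
  qed (use a(2) in simp)
  then have "dominant n C a" using a(2) by (simp add: dominant_iff idom_def)
  then have F_a: "lookup ?F a = of_bool (a = ?m0)" using F(2,3) by auto
  have "lookup ?R a = of_bool (a = ?m0)"
  proof (cases "a = ?m0")
    case False
    then have "a \<notin> keys ?R" using RK_dominant[OF i _ a(2)] by blast
    then show ?thesis using False by (simp add: in_keys_iff)
  qed (simp add: RK_top[OF i])
  then show False using a(1) F_a by (simp add: in_keys_iff lookup_minus)
qed

text \<open>A \<open>B\<close> at \<open>(i', s)\<close> can be divided out only if the variable at
  \<open>(i', s - 1)\<close> has positive exponent. That variable stems from the string itself or
  from an earlier \<open>B\<close> of a neighbouring colour in column \<open>s - 1\<close>, so each
  edge travelled away from \<open>i\<close> costs a column.\<close>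

lemma istep_spread:
  assumes D: "(i, r) \<in> Delta0 n C" and i': "i' \<in> I" and step: "istep i' a m"
    and V: "a = KR_monom i k r - Bs V" "set_mset V \<subseteq> I \<times> UNIV"
    and S: "\<And>j s. (j, s) \<in># V \<Longrightarrow> s \<ge> r + 1 + int (dynkin_dist n C i j)"
  shows "\<exists>W. m = KR_monom i k r - Bs (V + W) \<and> set_mset W \<subseteq> {i'} \<times> UNIV \<and>
    (\<forall>(j, s)\<in>#W. s \<ge> r + 1 + int (dynkin_dist n C i j))"
proof -
  have i: "i \<in> I" using D by (rule Delta0_color)
  obtain W where W: "set_mset W \<subseteq> {i'} \<times> UNIV" "\<And>l. int (count W (i', l + 1)) \<le> lookup a (i', l)" "m = a - Bs W"
    using step by (auto simp: istep_def)
  have "s \<ge> r + 1 + int (dynkin_dist n C i i')" if s: "(i', s) \<in># W" for s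
  proof -
    have "count W (i', s) \<noteq> 0" using s by (simp add: count_eq_zero_iff)
    moreover have "int (count W (i', s)) \<le> lookup a (i', s - 1)" using W(2)[of "s - 1"] by simp
    ultimately have pos: "lookup a (i', s - 1) \<ge> 1" by linarith
    show ?thesis
    proof (cases "lookup (KR_monom i k r) (i', s - 1) = 0")
      case False
      then show ?thesis by (auto simp: lookup_KR split: if_splits)
    next
      case True
      then have "lookup (Bs V) (i', s - 1) < 0" using pos V(1) by (simp add: lookup_minus)
      then have "(\<Sum>j\<in>I. Aoff i' j * int (count V (j, s - 1))) \<noteq> 0"
        unfolding lookup_Bs[OF V(2) i'] by linarith
      then obtain j where j: "j \<in> I" "Aoff i' j * int (count V (j, s - 1)) \<noteq> 0"
        by (rule sum.not_neutral_contains_not_neutral)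
      then have m: "(j, s - 1) \<in># V" "adj i' j"
        using i' by (auto simp: Aoff_def adj_def split: if_splits intro: count_inI)
      have "s - 1 \<ge> r + 1 + int (dynkin_dist n C i j)" by (rule S[OF m(1)])
      moreover have "dynkin_dist n C i i' \<le> dynkin_dist n C i j + 1"
        using dist_adj_le[OF i, of j i'] m(2) adj_sym by blast
      ultimately show ?thesis by linarith
    qed
  qed
  then show ?thesis using W V(1) by (intro exI[of _ W]) (auto simp: Bs_union)
qed

text \<open>The bound on the columns is inherited along the chains of \<open>Fq_induct\<close>. A
  chain leaving \<open>?m0\<close> must have colour \<open>i\<close>, the only colour present there;
  on it \<open>Fq\<close> agrees with \<open>RK\<close>, whose nontrivial terms all divide out the
  rightmost \<open>B\<close> of the string.\<close>

lemma Fq_KR_support: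
  assumes D: "(i, r) \<in> Delta0 n C" and m: "m \<in> keys (Fq n C d (KR_monom i k r))"
  shows "\<exists>V. m = KR_monom i k r - Bs V \<and> set_mset V \<subseteq> I \<times> UNIV \<and>
    (\<forall>(j, s)\<in>#V. s \<ge> r + 1 + int (dynkin_dist n C i j)) \<and>
    (V = {#} \<or> (i, r + 2 * int k - 1) \<in># V)"
proof -
  let ?m0 = "KR_monom i k r" and ?S = "\<lambda>V. \<forall>(j, s)\<in>#V. s \<ge> r + 1 + int (dynkin_dist n C i j)"
  have i: "i \<in> I" using D by (rule Delta0_color)
  show ?thesis
  proof (rule Fq_induct[OF dominant_KR[OF D] m])
    show "\<exists>V. ?m0 = ?m0 - Bs V \<and> set_mset V \<subseteq> I \<times> UNIV \<and> ?S V \<and> (V = {#} \<or> (i, r + 2 * int k - 1) \<in># V)"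
      by (intro exI[of _ "{#}"]) simp
  next
    fix i' a m
    assume i': "i' \<in> I" and mF: "m \<in> keys (Fq n C d ?m0)" and m_ne: "m \<noteq> ?m0"
      and steps: "(istep i')\<^sup>*\<^sup>* a m"
      and IH: "\<exists>V. a = ?m0 - Bs V \<and> set_mset V \<subseteq> I \<times> UNIV \<and> ?S V \<and> (V = {#} \<or> (i, r + 2 * int k - 1) \<in># V)"
    from IH obtain V where V: "a = ?m0 - Bs V" "set_mset V \<subseteq> I \<times> UNIV" "?S V" "V = {#} \<or> (i, r + 2 * int k - 1) \<in># V"
      by blast
    have "\<exists>W. m = ?m0 - Bs (V + W) \<and> set_mset W \<subseteq> {i'} \<times> UNIV \<and> ?S W"
      using steps
    proof induction
      case base
      show ?case by (intro exI[of _ "{#}"]) (simp add: V(1))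
    next
      case (step b m)
      then obtain W where W: "b = ?m0 - Bs (V + W)" "set_mset W \<subseteq> {i'} \<times> UNIV" "?S W" by blast
      have VW: "set_mset (V + W) \<subseteq> I \<times> UNIV" using V(2) W(2) i' by auto
      obtain W' where W': "m = ?m0 - Bs (V + W + W')" "set_mset W' \<subseteq> {i'} \<times> UNIV" "?S W'"
      proof -
        have S: "s \<ge> r + 1 + int (dynkin_dist n C i j)" if "(j, s) \<in># V + W" for j s
          using that V(3) W(3) by auto
        show ?thesis using istep_spread[OF D i' step.hyps(2) W(1) VW S] that by blast
      qed
      then show ?case using W by (intro exI[of _ "W + W'"]) (auto simp: add.assoc)
    qed
    then obtain W where W: "m = ?m0 - Bs (V + W)" "set_mset W \<subseteq> {i'} \<times> UNIV" "?S W" by blast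
    have VW: "set_mset (V + W) \<subseteq> I \<times> UNIV" "?S (V + W)" using V W(2,3) i' by auto
    have "(i, r + 2 * int k - 1) \<in># V + W"
    proof (cases "V = {#}")
      case False
      then show ?thesis using V(4) by auto
    next
      case True
      have a: "a = ?m0" using V(1) True by simp
      have "i' = i"
      proof (rule ccontr)
        assume ne: "i' \<noteq> i"
        have "b = ?m0" if "(istep i')\<^sup>*\<^sup>* ?m0 b" for b
          using that
        proof induction
          case (step b b')
          then obtain U where U: "set_mset U \<subseteq> {i'} \<times> UNIV" "\<And>l. int (count U (i', l + 1)) \<le> lookup ?m0 (i', l)"
            "b' = ?m0 - Bs U" by (auto simp: istep_def)
          have "count U (i', s) = 0" for s using U(2)[of "s - 1"] ne by (simp add: lookup_KR)
          then have "x \<notin># U" for x using U(1) by (cases x) (auto simp: count_eq_zero_iff)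
          then have "U = {#}" by (meson multiset_nonemptyE)
          then show ?case using U(3) by simp
        qed simp
        then have "m = ?m0" using steps a by blast
        then show False using m_ne by blast
      qed
      then have Wi: "set_mset W \<subseteq> {i} \<times> UNIV" "m = ?m0 - Bs W" using W True by simp_all
      have "lookup (RK i k r) m \<noteq> 0" using Fq_KR_color[OF D Wi(1), of k] Wi(2) mF by (simp add: in_keys_iff)
      then have "m \<in> keys (RK i k r)" by (simp add: in_keys_iff)
      then obtain b where b: "m = ?m0 - Bs (descent i (r + 2 * int k - 1) b)" using keys_RK by blast
      have "Bs W = Bs (descent i (r + 2 * int k - 1) b)" using b Wi(2) by simp
      then have Wd: "W = descent i (r + 2 * int k - 1) b"
        using Wi(1) descent_color[of i _ b] i by (intro Bs_inject) fastforce+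
      have "b \<noteq> 0"
      proof
        assume "b = 0"
        then have "m = ?m0" using b by simp
        then show False using m_ne by simp
      qed
      then show ?thesis unfolding True Wd by (auto simp: set_descent intro!: image_eqI[of _ _ 0])
    qed
    then show "\<exists>V. m = ?m0 - Bs V \<and> set_mset V \<subseteq> I \<times> UNIV \<and> ?S V \<and> (V = {#} \<or> (i, r + 2 * int k - 1) \<in># V)"
      using W(1) VW by (intro exI[of _ "V + W"]) blast
  qed
qed

section \<open>Dominant monomials of a product under interlacing\<close>

lemma max_column:
  fixes V :: "vertex multiset"
  assumes "V \<noteq> {#}"
  obtains k c where "(k, c) \<in># V" "\<And>k' s. (k', s) \<in># V \<Longrightarrow> s \<le> c"
proof -
  define c where "c = Max (snd ` set_mset V)"
  have "c \<in> snd ` set_mset V" unfolding c_def using assms by (intro Max_in) auto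
  then obtain k where "(k, c) \<in># V" by force
  moreover have "s \<le> c" if "(k', s) \<in># V" for k' s
    unfolding c_def using that by (intro Max_ge) force+
  ultimately show ?thesis using that by blast
qed

lemma lookup_Bs_right:
  assumes V: "set_mset V \<subseteq> I \<times> UNIV" and k: "k \<in> I" and max: "\<And>k' s. (k', s) \<in># V \<Longrightarrow> s \<le> c"
  shows "lookup (Bs V) (k, c + 1) = int (count V (k, c))"
proof -
  have z: "count V (k', s) = 0" if "s > c" for k' s
    using max[of k' s] that by (meson count_inI not_le)
  show ?thesis unfolding lookup_Bs[OF V k] by (simp add: z)
qed

lemma lookup_KR_eq_0: "p < r \<or> p > r + 2 * int k - 2 \<or> j \<noteq> i \<Longrightarrow> lookup (KR_monom i k r) (j, p) = 0"
  by (auto simp: lookup_KR)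

text \<open>The rightmost column of the divided-out \<open>B\<close>'s can only be compensated by \<open>m\<^sub>2\<close>, so
  it has colour \<open>j\<close>, and tracing it back to \<open>(i, r + 2k - 1)\<close> puts it beyond the end of \<open>m\<^sub>2\<close>.\<close>

lemma dominant_product_left:
  assumes D: "(i, r) \<in> Delta0 n C" "(j, t) \<in> Delta0 n C"
    and right: "t + 2 * (int l - 1) \<le> r + 2 * (int k - 1) + int (dynkin_dist n C i j)"
    and V: "set_mset V \<subseteq> I \<times> UNIV" "V = {#} \<or> (i, r + 2 * int k - 1) \<in># V"
    and U: "set_mset U \<subseteq> I \<times> UNIV" "U = {#} \<or> (j, t + 2 * int l - 1) \<in># U"
    and dom: "dominant n C (KR_monom i k r + KR_monom j l t - Bs (V + U))"
  shows "V = {#}"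
proof (rule ccontr)
  assume ne: "V \<noteq> {#}"
  have i: "i \<in> I" and j: "j \<in> I" using D by (auto dest: Delta0_color)
  let ?m1 = "KR_monom i k r" and ?m2 = "KR_monom j l t"
  have end_V: "(i, r + 2 * int k - 1) \<in># V" using V(2) ne by blast
  have VU: "set_mset (V + U) \<subseteq> I \<times> UNIV" using V(1) U(1) by simp
  have nonneg: "lookup (Bs (V + U)) x \<le> lookup ?m1 x + lookup ?m2 x" for x
    using dom unfolding dominant_def lookup_minus lookup_add by (metis diff_ge_0_iff_ge)
  have "V + U \<noteq> {#}" using ne by simp
  then obtain k0 c where k0: "(k0, c) \<in># V + U" and max: "\<And>k' s. (k', s) \<in># V + U \<Longrightarrow> s \<le> c"
    by (rule max_column) blast
  have c_ge: "c \<ge> r + 2 * int k - 1" using max[of i] end_V by auto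
  \<comment> \<open>In column \<open>c + 1\<close> only the \<open>B\<close>'s of column
    \<open>c\<close> are seen, and \<open>?m1\<close> has ended before it. So \<open>?m2\<close>
    must supply the variable, which fixes the colour and the range.\<close>
  have column: "k' = j \<and> c + 1 \<le> t + 2 * int l - 2" if k': "(k', c) \<in># V + U" for k'
  proof (rule ccontr)
    assume far: "\<not> (k' = j \<and> c + 1 \<le> t + 2 * int l - 2)"
    have k'I: "k' \<in> I" using VU k' by auto
    have "lookup ?m1 (k', c + 1) = 0" using c_ge by (intro lookup_KR_eq_0) auto
    moreover have "lookup ?m2 (k', c + 1) = 0" using far by (intro lookup_KR_eq_0) auto
    ultimately have "int (count (V + U) (k', c)) \<le> 0"
      using nonneg[of "(k', c + 1)"] lookup_Bs_right[OF VU k'I max] by simp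
    then show False using k' by (simp add: count_eq_zero_iff del: count_union)
  qed
  have c_le: "c + 1 \<le> t + 2 * int l - 2" using column[OF k0] by simp
  have "U = {#}"
  proof (rule ccontr)
    assume "U \<noteq> {#}"
    then have "c \<ge> t + 2 * int l - 1" using U(2) max[of j] by auto
    then show False using c_le by simp
  qed
  then have VU_eq: "V + U = V" by simp
  \<comment> \<open>Past the end of \<open>?m1\<close>, a \<open>B\<close> at \<open>(k', s)\<close>
    with \<open>k'\<close> different from \<open>j\<close> must be offset by a \<open>B\<close> of a
    neighbouring colour in column \<open>s + 1\<close>. This walk to the right can end only at
    colour \<open>j\<close> and crosses one edge per column.\<close>
  have "int (dynkin_dist n C j k') \<le> c - s" if "(k', s) \<in># V" "s \<ge> r + 2 * int k - 1" for k' s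
    using that
  proof (induction "nat (c - s)" arbitrary: k' s rule: less_induct)
    case less
    have s_le: "s \<le> c" using max[of k' s] less.prems by (simp add: VU_eq)
    have k'I: "k' \<in> I" using V(1) less.prems by auto
    show ?case
    proof (cases "k' = j")
      case False
      have "lookup ?m1 (k', s + 1) = 0" using less.prems by (intro lookup_KR_eq_0) auto
      moreover have "lookup ?m2 (k', s + 1) = 0" using False by (intro lookup_KR_eq_0) auto
      ultimately have "lookup (Bs V) (k', s + 1) \<le> 0" using nonneg[of "(k', s + 1)"] by (simp add: VU_eq)
      then have "int (count V (k', s + 1 + 1)) + int (count V (k', s + 1 - 1)) +
          (\<Sum>x\<in>I. Aoff k' x * int (count V (x, s + 1))) \<le> 0"
        unfolding lookup_Bs[OF V(1) k'I] .
      moreover have "count V (k', s + 1 - 1) \<noteq> 0" using less.prems by (simp add: count_eq_zero_iff)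
      ultimately have "(\<Sum>x\<in>I. Aoff k' x * int (count V (x, s + 1))) \<noteq> 0" by linarith
      then obtain x where x: "x \<in> I" "Aoff k' x * int (count V (x, s + 1)) \<noteq> 0"
        by (rule sum.not_neutral_contains_not_neutral)
      then have xV: "(x, s + 1) \<in># V" and adj: "adj x k'"
        using k'I adj_sym[of x k'] by (auto simp: Aoff_def adj_def split: if_splits intro: count_inI)
      have "s + 1 \<le> c" using max[of x "s + 1"] xV by (simp add: VU_eq)
      then have "int (dynkin_dist n C j x) \<le> c - (s + 1)"
        using less.hyps[of "s + 1" x] xV less.prems by simp
      moreover have "dynkin_dist n C j k' \<le> dynkin_dist n C j x + 1" by (rule dist_adj_le[OF j adj])
      ultimately show ?thesis by linarith
    qed (simp add: s_le)
  qed
  from this[OF end_V] have "int (dynkin_dist n C i j) \<le> c - (r + 2 * int k - 1)"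
    using dist_sym[OF i j] by simp
  \<comment> \<open>By \<open>c_le\<close> and \<open>right\<close> the difference
    \<open>c - (r + 2 * int k - 1)\<close> is at most the distance of \<open>i\<close> and
    \<open>j\<close> minus 2.\<close>
  then show False using c_le right by simp
qed

text \<open>A \<open>B\<close> of colour \<open>i\<close> pairs nontrivially with the string only at
  its ends, in the columns \<open>r - 1\<close> and \<open>r + 2 * int k - 1\<close>. The first is
  out of reach for \<open>U\<close> by \<open>left\<close> and the bound on its columns. If the
  second occurred, the rightmost column of \<open>U\<close> would lie past both strings and could
  not be compensated.\<close>

lemma dominant_product_form:
  assumes D: "(i, r) \<in> Delta0 n C" "(j, t) \<in> Delta0 n C"
    and left: "r - int (dynkin_dist n C i j) \<le> t"
    and U: "set_mset U \<subseteq> I \<times> UNIV" "U = {#} \<or> (j, t + 2 * int l - 1) \<in># U"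
      "\<forall>(k', s)\<in>#U. s \<ge> t + 1 + int (dynkin_dist n C j k')"
    and dom: "dominant n C (KR_monom i k r + KR_monom j l t - Bs U)"
  shows "mform N (KR_monom i k r) (Bs U) = 0"
proof -
  have i: "i \<in> I" and j: "j \<in> I" using D by (auto dest: Delta0_color)
  let ?m1 = "KR_monom i k r" and ?m2 = "KR_monom j l t"
  have keys1: "keys ?m1 \<subseteq> I \<times> UNIV" using keys_KR[OF D(1)] Delta0_sub by blast
  have not_end: "(i, r + 2 * int k - 1) \<notin># U"
  proof
    assume end_U: "(i, r + 2 * int k - 1) \<in># U"
    then have "U \<noteq> {#}" by auto
    then obtain k0 c where k0: "(k0, c) \<in># U" and max: "\<And>k' s. (k', s) \<in># U \<Longrightarrow> s \<le> c"
      by (rule max_column) blast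
    have k0I: "k0 \<in> I" using U(1) k0 by auto
    have "c \<ge> t + 2 * int l - 1" using U(2) \<open>U \<noteq> {#}\<close> max by blast
    then have "lookup ?m2 (k0, c + 1) = 0" by (intro lookup_KR_eq_0) auto
    moreover have "lookup ?m1 (k0, c + 1) = 0" using max[OF end_U] by (intro lookup_KR_eq_0) auto
    moreover have "lookup (?m1 + ?m2 - Bs U) (k0, c + 1) \<ge> 0" using dom by (simp add: dominant_def)
    ultimately have "int (count U (k0, c)) \<le> 0"
      using lookup_Bs_right[OF U(1) k0I max] by (simp add: lookup_minus lookup_add)
    then show False using k0 by (simp add: count_eq_zero_iff)
  qed
  have zero: "mform N ?m1 (B x) = 0" if x: "x \<in># U" for x
  proof -
    obtain k' s where x_eq: "x = (k', s)" by (cases x)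
    have k'I: "k' \<in> I" using U(1) x x_eq by auto
    have "lookup ?m1 (k', s + 1) = lookup ?m1 (k', s - 1)"
    proof (cases "k' = i")
      case True
      have "s \<ge> t + 1 + int (dynkin_dist n C j i)" using U(3) x True x_eq by auto
      then have s_ge: "s \<ge> r + 1" using left dist_sym[OF i j] by simp
      have s_ne: "s \<noteq> r + 2 * int k - 1" using not_end x True x_eq by auto
      have "(\<exists>a<k. s + 1 = r + 2 * int a) \<longleftrightarrow> (\<exists>a<k. s - 1 = r + 2 * int a)"
      proof
        assume "\<exists>a<k. s + 1 = r + 2 * int a"
        then obtain a where a: "a < k" "s + 1 = r + 2 * int a" by blast
        then have "a \<noteq> 0" using s_ge by (cases a) auto
        then show "\<exists>a<k. s - 1 = r + 2 * int a" using a by (intro exI[of _ "a - 1"]) auto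
      next
        assume "\<exists>a<k. s - 1 = r + 2 * int a"
        then obtain a where a: "a < k" "s - 1 = r + 2 * int a" by blast
        then have "Suc a \<noteq> k" using s_ne by auto
        then show "\<exists>a<k. s + 1 = r + 2 * int a" using a by (intro exI[of _ "Suc a"]) auto
      qed
      then show ?thesis by (simp only: lookup_KR)
    next
      case False
      then show ?thesis by (simp add: lookup_KR)
    qed
    then show ?thesis using mform_B[OF keys1 k'I, of s] by (simp add: x_eq)
  qed
  have "mform N ?m1 (Bs W) = 0" if "W \<subseteq># U" for W
    using that
  proof (induction W)
    case (add x W)
    have "x \<in># U" using mset_subset_eqD[OF add.prems] by simp
    moreover have "W \<subseteq># U" using add.prems by (meson mset_subset_eq_insertD subset_mset.less_imp_le)
    ultimately show ?case using add.IH zero by (simp add: mform_add_right)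
  qed simp
  then show ?thesis by simp
qed

lemma Fq_KR_commute:
  assumes D: "(i, r) \<in> Delta0 n C" "(j, t) \<in> Delta0 n C"
    and left: "r - int (dynkin_dist n C i j) \<le> t"
    and right: "t + 2 * (int l - 1) \<le> r + 2 * (int k - 1) + int (dynkin_dist n C i j)"
  shows "q_commute N (Fq n C d (KR_monom i k r)) (Fq n C d (KR_monom j l t))"
proof -
  let ?m1 = "KR_monom i k r" and ?m2 = "KR_monom j l t"
  let ?F = "Fq n C d ?m1" and ?G = "Fq n C d ?m2"
  define e where "e = mform N ?m1 ?m2"
  have F: "?F \<in> Kq n C d" and G: "?G \<in> Kq n C d"
    using Fq_properties(1) dominant_KR D by blast+
  have form: "mform N a b = e" if ab: "a \<in> keys ?F" "b \<in> keys ?G" "dominant n C (a + b)" for a b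
  proof -
    obtain V where V: "a = ?m1 - Bs V" "set_mset V \<subseteq> I \<times> UNIV" "V = {#} \<or> (i, r + 2 * int k - 1) \<in># V"
      using Fq_KR_support[OF D(1) ab(1)] by blast
    obtain U where U: "b = ?m2 - Bs U" "set_mset U \<subseteq> I \<times> UNIV"
      "\<forall>(k', s)\<in>#U. s \<ge> t + 1 + int (dynkin_dist n C j k')" "U = {#} \<or> (j, t + 2 * int l - 1) \<in># U"
      using Fq_KR_support[OF D(2) ab(2)] by blast
    have sum: "a + b = ?m1 + ?m2 - Bs (V + U)" unfolding V(1) U(1) by (simp add: Bs_union algebra_simps)
    have V0: "V = {#}"
      by (rule dominant_product_left[OF D right V(2,3) U(2,4)]) (use ab(3) sum in simp)
    have "mform N ?m1 (Bs U) = 0"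
      by (rule dominant_product_form[OF D left U(2,4,3)]) (use ab(3) sum V0 in simp)
    then show ?thesis unfolding V(1) U(1) V0 by (simp add: mform_diff_right e_def)
  qed
  define P where "P = ?F \<star> ?G - qscalar (vpow (2 * e)) \<star> (?G \<star> ?F)"
  have "P = 0"
  proof (rule Kq_unique)
    show "P \<in> Kq n C d"
      using F G unfolding P_def Kq_def Kiq_def
      by (auto intro!: qsubalgebra_diff qsubalgebra_scale qsubalgebra.times)
  next
    fix m assume m: "dominant n C m"
    \<comment> \<open>The part common to both products: by \<open>form\<close> the order of the
      factors affects only the power in front, \<open>vpow e\<close> or
      \<open>vpow (- e)\<close>.\<close>
    define T where "T = (\<Sum>a\<in>keys ?F. \<Sum>b\<in>keys ?G. if a + b = m then lookup ?F a * lookup ?G b else 0)"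
    have "lookup (?F \<star> ?G) m = vpow e * T"
      unfolding lookup_qtimes[OF finite_keys finite_keys subset_refl subset_refl] T_def sum_distrib_left
      by (intro sum.cong refl) (use form m in \<open>auto simp: mult.assoc\<close>)
    moreover have "lookup (?G \<star> ?F) m = vpow (- e) * T"
    proof -
      have "lookup (?G \<star> ?F) m = (\<Sum>a\<in>keys ?F. \<Sum>b\<in>keys ?G.
          if b + a = m then vpow (mform N b a) * lookup ?G b * lookup ?F a else 0)"
        unfolding lookup_qtimes[OF finite_keys finite_keys subset_refl subset_refl] by (rule sum.swap)
      also have "\<dots> = vpow (- e) * T"
        unfolding T_def sum_distrib_left
      proof (intro sum.cong refl)
        fix a b assume ab: "a \<in> keys ?F" "b \<in> keys ?G"
        show "(if b + a = m then vpow (mform N b a) * lookup ?G b * lookup ?F a else 0) =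
            vpow (- e) * (if a + b = m then lookup ?F a * lookup ?G b else 0)"
        proof (cases "a + b = m")
          case True
          then have "mform N b a = - e" using form[OF ab] m mform_skew[of b a] by simp
          then show ?thesis using True by (simp add: add.commute mult_ac)
        qed (simp add: add.commute)
      qed
      finally show ?thesis .
    qed
    ultimately show "lookup P m = 0"
      by (simp add: P_def lookup_minus lookup_qscalar_times mult.assoc[symmetric] flip: vpow_add)
  qed
  then have "?F \<star> ?G = qscalar (vpow (2 * e)) \<star> (?G \<star> ?F)" by (simp add: P_def)
  then show ?thesis unfolding q_commute_def by blast
qed

lemma q_commute_sym: "q_commute N f g \<Longrightarrow> q_commute N g f"
  unfolding q_commute_def
proof (elim exE)
  fix k assume "f \<star> g = qscalar (vpow k) \<star> (g \<star> f)"
  then have "g \<star> f = qscalar (vpow (- k)) \<star> (f \<star> g)" by (simp add: qscalar_times_assoc vpow_unit)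
  then show "\<exists>k. g \<star> f = qscalar (vpow k) \<star> (f \<star> g)" by blast
qed

lemma KR_one: "KR_monom j 1 p = single (j, p) 1"
  by (simp add: KR_monom_def)

end

theorem theorem8p9:
  fixes scale :: "complex \<Rightarrow> 'g::ab_group_add \<Rightarrow> 'g"
    and br :: "'g \<Rightarrow> 'g \<Rightarrow> 'g"
    and n :: nat and C :: "nat \<Rightarrow> nat \<Rightarrow> int" and d :: "nat \<Rightarrow> int"
    and i j k l :: nat and r t :: int
  assumes "simple_lie_algebra scale br"
    and "simple_lie_algebra.is_cartan_matrix scale br n C"
    and "is_minimal_symmetrizer n C d"
    and "(i, r) \<in> Delta0 n C" and "(j, t) \<in> Delta0 n C"
    and "k \<ge> 1" and "l \<ge> 1"
  shows
    "((r - int (dynkin_dist n C i j) \<le> t \<and> t \<le> t + 2 * (int l - 1) \<and>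
         t + 2 * (int l - 1) \<le> r + 2 * (int k - 1) + int (dynkin_dist n C i j)) \<or>
      (t - int (dynkin_dist n C i j) \<le> r \<and> r \<le> r + 2 * (int k - 1) \<and>
         r + 2 * (int k - 1) \<le> t + 2 * (int l - 1) + int (dynkin_dist n C i j))
        \<longrightarrow> q_commute (Nexp n C d) (Fq n C d (KR_monom i k r)) (Fq n C d (KR_monom j l t))) \<and>
     (\<forall>j p. (j, p) \<in> Delta0 n C \<and>
            r - int (dynkin_dist n C i j) \<le> p \<and>
            p \<le> r + 2 * (int k - 1) + int (dynkin_dist n C i j)
        \<longrightarrow> q_commute (Nexp n C d) (Fq n C d (KR_monom i k r))
              (Fq n C d (Poly_Mapping.single (j, p) 1)))"
proof -
  interpret simple_lie_algebra scale br by (rule assms(1))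
  obtain e f h :: "nat \<Rightarrow> 'g" where "chevalley_generators scale br n C e f h"
    using chevalley_generators_exist[OF assms(2)] by blast
  then interpret chevalley_generators scale br n C e f h .
  obtain \<kappa> :: "nat \<Rightarrow> real" where \<kappa>:
    "\<And>i. i \<in> {1..n} \<Longrightarrow> \<kappa> i > 0"
    "\<And>i j. i \<in> {1..n} \<Longrightarrow> j \<in> {1..n} \<Longrightarrow> \<kappa> i * C i j = \<kappa> j * C j i"
    "\<And>y. \<exists>i\<in>{1..n}. y i \<noteq> 0 \<Longrightarrow> (\<Sum>i\<in>{1..n}. \<Sum>j\<in>{1..n}. \<kappa> i * C i j * y i * y j) > 0"
    by (rule C_positive_definite) blast
  interpret cartan_data n C d \<kappa>
  proof (rule cartan_data.intro)
    show "n \<ge> 1" using assms(4) by (auto simp: Delta0_def)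
    show "d i \<ge> 1" if "i \<in> {1..n}" for i
      using assms(3) that unfolding is_minimal_symmetrizer_def by blast
    show "d i * C i j = d j * C j i" if "i \<in> {1..n}" "j \<in> {1..n}" for i j
      using assms(3) that unfolding is_minimal_symmetrizer_def by blast
  qed (fact C_diag C_nonpos connected \<kappa>)+
  have ij: "i \<in> {1..n}" "j \<in> {1..n}" using assms(4,5) by (auto dest: Delta0_color)
  show ?thesis
  proof (intro conjI impI allI)
    assume "(r - int (dynkin_dist n C i j) \<le> t \<and> t \<le> t + 2 * (int l - 1) \<and>
         t + 2 * (int l - 1) \<le> r + 2 * (int k - 1) + int (dynkin_dist n C i j)) \<or>
      (t - int (dynkin_dist n C i j) \<le> r \<and> r \<le> r + 2 * (int k - 1) \<and>
         r + 2 * (int k - 1) \<le> t + 2 * (int l - 1) + int (dynkin_dist n C i j))"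
    then show "q_commute (Nexp n C d) (Fq n C d (KR_monom i k r)) (Fq n C d (KR_monom j l t))"
    proof (elim disjE conjE)
      assume "t - int (dynkin_dist n C i j) \<le> r" "r + 2 * (int k - 1) \<le> t + 2 * (int l - 1) + int (dynkin_dist n C i j)"
      then have "q_commute (Nexp n C d) (Fq n C d (KR_monom j l t)) (Fq n C d (KR_monom i k r))"
        unfolding dist_sym[OF ij] by (rule Fq_KR_commute[OF assms(5,4)])
      then show ?thesis by (rule q_commute_sym)
    qed (rule Fq_KR_commute[OF assms(4,5)])
  next
    fix j' p
    assume "(j', p) \<in> Delta0 n C \<and> r - int (dynkin_dist n C i j') \<le> p \<and>
      p \<le> r + 2 * (int k - 1) + int (dynkin_dist n C i j')"
    then have "q_commute (Nexp n C d) (Fq n C d (KR_monom i k r)) (Fq n C d (KR_monom j' 1 p))"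
      by (intro Fq_KR_commute[OF assms(4)]) simp_all
    then show "q_commute (Nexp n C d) (Fq n C d (KR_monom i k r)) (Fq n C d (Poly_Mapping.single (j', p) 1))"
      by (simp only: KR_one)
  qed
qed

end
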